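(* Let $0<s<\sigma_\infty$, where $\sigma_\infty=\frac{\log 3}{\log 5}$. For $\mu=\pm1$ and for every integer $k\ge 1$, the nonlinear Schr\"odinger equation on the Sierpinski gasket $$\begin{cases} i\partial_t u+\Delta u=\mu|u|^{2k}u, & (t,x)\in\mathbb{R}\times \mathrm{SG},\\ u(0,\cdot)=u_0\in H^s(\mathrm{SG}),\end{cases}$$ is $C^{2k+1}$-ill-posed in $H^s(\mathrm{SG})$. In particular, the flow map cannot be extended from $H^1(\mathrm{SG})$ to $H^s(\mathrm{SG})$ as a $C^{2k+1}$ flow map near the origin: there do not exist $T>0$, a neighborhood $U$ of $0$ in $H^s(\mathrm{SG})$ and a map $\Phi\colon U\to C([-T,T];H^s(\mathrm{SG}))$ of class $C^{2k+1}$ such that, for all $u_0$ in some neighborhood of $0$ in $H^1(\mathrm{SG})$, $\Phi(u_0)$ coincides with the $H^1$-solution $u$ on $[-T,T]$ with initial datum $u_0$.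
   Context: Sierpinski gasket. Let $V_0=\{p_0,p_1,p_2\}\subset\mathbb{R}^2$ be the vertices of an equilateral triangle of side length one, $F_i(p)=\frac12(p-p_i)+p_i$ for $i=0,1,2$, and let $\mathrm{SG}$ be the unique nonempty compact set with $\mathrm{SG}=F_0(\mathrm{SG})\cup F_1(\mathrm{SG})\cup F_2(\mathrm{SG})$. It carries the self-similar Bernoulli probability measure $\nu$ with $\nu(F_w(\mathrm{SG}))=3^{-m}$ for all $w=w_1\cdots w_m\in\{0,1,2\}^m$, $F_w=F_{w_1}\circ\cdots\circ F_{w_m}$. $L^p$ spaces and $\langle\cdot,\cdot\rangle$ are with respect to $\nu$. Laplacian. Let $V_m=\bigcup_{|w|=m}F_w(V_0)$, with $p\sim_m q$ if $p\neq q$ both belong to a common $F_w(V_0)$, $|w|=m$. Put $\mathcal{E}_m(u)=\frac12\sum_{p\sim_m q}(u(q)-u(p))^2$ and $\mathcal{E}(u)=\lim_{m\to\infty}(5/3)^m\mathcal{E}_m(u)$ (extended by polarization), with domain $\mathcal{F}$ the continuous functions of finite energy. The (Neumann) Laplacian is the nonnegative self-adjoint operator $-\Delta$ on $L^2$ defined by $-\Delta u=f$ iff $\mathcal{E}(u,v)=\langle f,v\rangle$ for all $v\in\mathcal{F}$. It has compact resolvent; $\{\varphi\}$ denotes an orthonormal basis of eigenfunctions with eigenvalues $\lambda_\varphi\ge0$. $S_tu=e^{it\Delta}u=\sum_\varphi e^{-it\lambda_\varphi}\langle u,\varphi\rangle\varphi$. Sobolev spaces. For $0<s\le 1$, $H^s(\mathrm{SG})=(I-\Delta)^{-s/2}L^2$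 with norm $\|u\|_{H^s}^2=\sum_\varphi(1+\lambda_\varphi)^s|\langle u,\varphi\rangle|^2$; $H^1(\mathrm{SG})=\mathcal{F}$. The number $\sigma_\infty=\frac{d_S}{2}=\frac{\log3}{\log5}<1$ (with spectral dimension $d_S=\frac{\log 9}{\log 5}$) is the threshold such that $H^s\subseteq L^\infty$ for $s>\sigma_\infty$. Solutions and flow map. A solution on $[-T,T]$ is a function $u$ satisfying Duhamel's formula $u(t)=S_tu_0-i\mu\int_0^tS_{t-\tau}(|u|^{2k}u)(\tau)\,d\tau$ for $t\in[-T,T]$. Since $H^1(\mathrm{SG})$ is an algebra, the problem is locally well-posed in $H^1(\mathrm{SG})$ by a fixed-point argument; for $u_0\in H^1(\mathrm{SG})$ the $H^1$-solution is the unique solution in $C([-T,T];H^1(\mathrm{SG}))$, and the flow map is $u_0\mapsto u$. The problem is called $C^\gamma$-ill-posed in $H^s$ if the flow map $u_0\mapsto u$, regarded as a map from $H^s$ (near the origin) into $C([-T,T];H^s)$, fails to be of class $C^\gamma$ for every $T>0$. Differentiability is in the (real) Fr\'echet sense. *)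

theory Defs
  imports "HOL-Analysis.Analysis" "HOL-Library.Function_Algebras"
begin

section \<open>Functions as a real vector space\<close>

instantiation "fun" :: (type, real_vector) real_vector
begin

definition scaleR_fun :: "real \<Rightarrow> ('a \<Rightarrow> 'b) \<Rightarrow> 'a \<Rightarrow> 'b" where
  "scaleR_fun c f = (\<lambda>x. c *\<^sub>R f x)"

instance
  by standard (simp_all add: scaleR_fun_def fun_eq_iff algebra_simps)

end


section \<open>Calculus in seminormed spaces\<close>

text \<open>
  Spaces of functions modulo null sets are represented by a carrier \<open>X\<close> of representatives
  together with a seminorm \<open>N\<close> whose null vectors are the functions that vanish almost
  everywhere. All notions below are invariant under changing representatives, so they are the usual
  notions for the quotient normed space.
\<close>

definition seminorm_open :: "'a::real_vector set \<Rightarrow> ('a \<Rightarrow> real) \<Rightarrow> 'a set \<Rightarrow> bool" where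
  "seminorm_open X N U \<longleftrightarrow>
     U \<subseteq> X \<and> (\<forall>x\<in>U. \<exists>r>0. \<forall>y\<in>X. N (y - x) < r \<longrightarrow> y \<in> U)"

text \<open>
  Bounded real \<open>j\<close>-linear maps from \<open>X\<close> to \<open>Y\<close>, taking the list of their arguments. Linearity is
  an identity in the quotient of \<open>Y\<close>.
\<close>

definition bounded_multilinear_map ::
  "nat \<Rightarrow> 'a::real_vector set \<Rightarrow> ('a \<Rightarrow> real) \<Rightarrow> 'b::real_vector set \<Rightarrow> ('b \<Rightarrow> real)
     \<Rightarrow> ('a list \<Rightarrow> 'b) \<Rightarrow> bool" where
  "bounded_multilinear_map j X NX Y NY M \<longleftrightarrow>
     (\<forall>hs. length hs = j \<and> set hs \<subseteq> X \<longrightarrow> M hs \<in> Y) \<and>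
     (\<forall>hs i a b c. length hs = j \<and> set hs \<subseteq> X \<and> i < j \<and> a \<in> X \<and> b \<in> X \<longrightarrow>
        NY (M (hs[i := c *\<^sub>R a + b]) - (c *\<^sub>R M (hs[i := a]) + M (hs[i := b]))) = 0) \<and>
     (\<exists>C. \<forall>hs. length hs = j \<and> set hs \<subseteq> X \<longrightarrow> NY (M hs) \<le> C * prod_list (map NX hs))"

text \<open>
  Maps of class \<open>C\<^sup>n\<close> in the real Frechet sense: \<open>D j x\<close> is the \<open>j\<close>-th derivative at \<open>x\<close>, an
  element of \<open>L(X, L(X, \<dots>, Y))\<close> written as a \<open>j\<close>-linear map. For \<open>j < n\<close> the map \<open>D j\<close> is
  Frechet differentiable with derivative \<open>D (Suc j)\<close>, the new direction being the first argument,
  and \<open>D n\<close> is continuous, both with respect to the operator norm.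
\<close>

definition Ck_map_on ::
  "nat \<Rightarrow> 'a::real_vector set \<Rightarrow> ('a \<Rightarrow> real) \<Rightarrow> 'b::real_vector set \<Rightarrow> ('b \<Rightarrow> real)
     \<Rightarrow> 'a set \<Rightarrow> ('a \<Rightarrow> 'b) \<Rightarrow> bool" where
  "Ck_map_on n X NX Y NY U f \<longleftrightarrow>
     (\<exists>D :: nat \<Rightarrow> 'a \<Rightarrow> 'a list \<Rightarrow> 'b.
        (\<forall>x\<in>U. D 0 x [] = f x) \<and>
        (\<forall>j\<le>n. \<forall>x\<in>U. bounded_multilinear_map j X NX Y NY (D j x)) \<and>
        (\<forall>j<n. \<forall>x\<in>U. \<forall>e>0. \<exists>d>0. \<forall>h\<in>X. NX h < d \<and> x + h \<in> U \<longrightarrow>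
           (\<forall>hs. length hs = j \<and> set hs \<subseteq> X \<and> (\<forall>g\<in>set hs. NX g \<le> 1) \<longrightarrow>
              NY (D j (x + h) hs - D j x hs - D (Suc j) x (h # hs)) \<le> e * NX h)) \<and>
        (\<forall>x\<in>U. \<forall>e>0. \<exists>d>0. \<forall>y\<in>U. NX (y - x) < d \<longrightarrow>
           (\<forall>hs. length hs = n \<and> set hs \<subseteq> X \<and> (\<forall>g\<in>set hs. NX g \<le> 1) \<longrightarrow>
              NY (D n y hs - D n x hs) \<le> e)))"

text \<open>
  The analogue of \<^const>\<open>has_integral\<close> on a compact interval for functions with values in a
  seminormed space, and its oriented version \<open>\<integral>\<^sub>a\<^sup>b\<close> with \<open>a \<le> b\<close> or \<open>b \<le> a\<close>.
\<close>

definition seminorm_has_integral ::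
  "('a::real_vector \<Rightarrow> real) \<Rightarrow> (real \<Rightarrow> 'a) \<Rightarrow> real \<Rightarrow> real \<Rightarrow> 'a \<Rightarrow> bool" where
  "seminorm_has_integral N f a b J \<longleftrightarrow>
     (\<forall>e>0. \<exists>\<gamma>. gauge \<gamma> \<and>
        (\<forall>\<D>. \<D> tagged_division_of {a..b} \<and> \<gamma> fine \<D> \<longrightarrow>
           N ((\<Sum>(t, K)\<in>\<D>. measure lborel K *\<^sub>R f t) - J) < e))"

definition seminorm_has_oriented_integral ::
  "('a::real_vector \<Rightarrow> real) \<Rightarrow> (real \<Rightarrow> 'a) \<Rightarrow> real \<Rightarrow> real \<Rightarrow> 'a \<Rightarrow> bool" where
  "seminorm_has_oriented_integral N f a b J \<longleftrightarrow>
     (if a \<le> b then seminorm_has_integral N f a b J else seminorm_has_integral N f b a (- J))"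


section \<open>The Sierpinski gasket, its measure and its Laplacian\<close>

definition equilateral :: "(nat \<Rightarrow> real^2) \<Rightarrow> bool" where
  "equilateral p \<longleftrightarrow> (\<forall>i<3. \<forall>j<3. i \<noteq> j \<longrightarrow> dist (p i) (p j) = 1)"

definition contraction :: "(nat \<Rightarrow> real^2) \<Rightarrow> nat \<Rightarrow> real^2 \<Rightarrow> real^2" where
  "contraction p i x = (1/2) *\<^sub>R (x - p i) + p i"

fun cell_map :: "(nat \<Rightarrow> real^2) \<Rightarrow> nat list \<Rightarrow> real^2 \<Rightarrow> real^2" where
  "cell_map p [] = id"
| "cell_map p (i # w) = contraction p i \<circ> cell_map p w"

definition words :: "nat \<Rightarrow> nat list set" where
  "words m = {w. length w = m \<and> set w \<subseteq> {0, 1, 2}}"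

definition SG :: "(nat \<Rightarrow> real^2) \<Rightarrow> (real^2) set" where
  "SG p = (THE K. compact K \<and> K \<noteq> {} \<and> K = contraction p 0 ` K \<union> contraction p 1 ` K \<union> contraction p 2 ` K)"

text \<open>
  The values on the cells determine the measure. The underlying space is \<open>SG p\<close> itself, so the
  values of functions outside the gasket play no role in what follows.
\<close>

definition gasket_measure :: "(nat \<Rightarrow> real^2) \<Rightarrow> (real^2) measure \<Rightarrow> bool" where
  "gasket_measure p \<nu> \<longleftrightarrow>
     sets \<nu> = sets (restrict_space borel (SG p)) \<and>
     (\<forall>m. \<forall>w\<in>words m. emeasure \<nu> (cell_map p w ` SG p) = ennreal ((1/3) ^ m))"

definition L2 :: "(real^2) measure \<Rightarrow> (real^2 \<Rightarrow> complex) set" where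
  "L2 \<nu> = {f \<in> borel_measurable \<nu>. integrable \<nu> (\<lambda>x. (cmod (f x))\<^sup>2)}"

definition L2_inner :: "(real^2) measure \<Rightarrow> (real^2 \<Rightarrow> complex) \<Rightarrow> (real^2 \<Rightarrow> complex) \<Rightarrow> complex" where
  "L2_inner \<nu> f g = (LINT x|\<nu>. f x * cnj (g x))"

definition L2_norm :: "(real^2) measure \<Rightarrow> (real^2 \<Rightarrow> complex) \<Rightarrow> real" where
  "L2_norm \<nu> f = sqrt (LINT x|\<nu>. (cmod (f x))\<^sup>2)"

definition V0 :: "(nat \<Rightarrow> real^2) \<Rightarrow> (real^2) set" where
  "V0 p = {p 0, p 1, p 2}"

definition adj :: "(nat \<Rightarrow> real^2) \<Rightarrow> nat \<Rightarrow> real^2 \<Rightarrow> real^2 \<Rightarrow> bool" where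
  "adj p m x y \<longleftrightarrow> x \<noteq> y \<and> (\<exists>w\<in>words m. x \<in> cell_map p w ` V0 p \<and> y \<in> cell_map p w ` V0 p)"

text \<open>
  The sum runs over ordered pairs, so each edge is counted twice. The energy of \<open>u\<close> is
  \<open>energy p u u\<close>; the form is sesquilinear, as obtained by polarization for complex functions.
\<close>

definition graph_energy ::
  "(nat \<Rightarrow> real^2) \<Rightarrow> nat \<Rightarrow> (real^2 \<Rightarrow> complex) \<Rightarrow> (real^2 \<Rightarrow> complex) \<Rightarrow> complex" where
  "graph_energy p m u v =
     (1/2) * (\<Sum>(x, y)\<in>{(x, y). adj p m x y}. (u y - u x) * cnj (v y - v x))"

definition energy ::
  "(nat \<Rightarrow> real^2) \<Rightarrow> (real^2 \<Rightarrow> complex) \<Rightarrow> (real^2 \<Rightarrow> complex) \<Rightarrow> complex" where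
  "energy p u v = lim (\<lambda>m. (5/3) ^ m * graph_energy p m u v)"

text \<open>
  The renormalized graph energies of \<open>u\<close> are nonnegative and nondecreasing in \<open>m\<close>, hence the energy
  is finite iff they converge.
\<close>

definition energy_domain :: "(nat \<Rightarrow> real^2) \<Rightarrow> (real^2 \<Rightarrow> complex) set" where
  "energy_domain p =
     {u. continuous_on (SG p) u \<and> convergent (\<lambda>m. (5/3) ^ m * graph_energy p m u u)}"

text \<open>\<open>neg_laplacian p \<nu> u f\<close> means \<open>- \<Delta> u = f\<close>, where \<open>u\<close> is the continuous representative.\<close>

definition neg_laplacian ::
  "(nat \<Rightarrow> real^2) \<Rightarrow> (real^2) measure \<Rightarrow> (real^2 \<Rightarrow> complex) \<Rightarrow> (real^2 \<Rightarrow> complex) \<Rightarrow> bool" where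
  "neg_laplacian p \<nu> u f \<longleftrightarrow>
     u \<in> energy_domain p \<and> f \<in> L2 \<nu> \<and> (\<forall>v\<in>energy_domain p. energy p u v = L2_inner \<nu> f v)"

text \<open>\<open>u = \<Sum>\<^sub>n c\<^sub>n \<phi>\<^sub>n\<close> with convergence in \<open>L\<^sup>2\<close>.\<close>

definition L2_expansion ::
  "(real^2) measure \<Rightarrow> (nat \<Rightarrow> real^2 \<Rightarrow> complex) \<Rightarrow> (nat \<Rightarrow> complex) \<Rightarrow> (real^2 \<Rightarrow> complex) \<Rightarrow> bool" where
  "L2_expansion \<nu> \<phi> c u \<longleftrightarrow>
     u \<in> L2 \<nu> \<and> (\<lambda>N. L2_norm \<nu> (u - (\<Sum>n<N. (\<lambda>x. c n * \<phi> n x)))) \<longlonglongrightarrow> 0"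

definition eigenbasis ::
  "(nat \<Rightarrow> real^2) \<Rightarrow> (real^2) measure \<Rightarrow> (nat \<Rightarrow> real^2 \<Rightarrow> complex) \<Rightarrow> (nat \<Rightarrow> real) \<Rightarrow> bool" where
  "eigenbasis p \<nu> \<phi> lam \<longleftrightarrow>
     (\<forall>n. neg_laplacian p \<nu> (\<phi> n) (\<lambda>x. complex_of_real (lam n) * \<phi> n x)) \<and>
     (\<forall>n m. L2_inner \<nu> (\<phi> n) (\<phi> m) = (if n = m then 1 else 0)) \<and>
     (\<forall>u\<in>L2 \<nu>. L2_expansion \<nu> \<phi> (\<lambda>n. L2_inner \<nu> u (\<phi> n)) u)"


section \<open>Functional calculus and Sobolev spaces\<close>

text \<open>
  For a bounded multiplier \<open>g\<close>, a representative of
  \<open>g(- \<Delta>) u = \<Sum>\<^sub>n g(\<lambda>\<^sub>n) \<langle>u, \<phi>\<^sub>n\<rangle> \<phi>\<^sub>n\<close>, which is unique up to null sets.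
\<close>

definition spectral_op ::
  "(real^2) measure \<Rightarrow> (nat \<Rightarrow> real^2 \<Rightarrow> complex) \<Rightarrow> (nat \<Rightarrow> real) \<Rightarrow> (real \<Rightarrow> complex)
     \<Rightarrow> (real^2 \<Rightarrow> complex) \<Rightarrow> real^2 \<Rightarrow> complex" where
  "spectral_op \<nu> \<phi> lam g u =
     (SOME w. L2_expansion \<nu> \<phi> (\<lambda>n. g (lam n) * L2_inner \<nu> u (\<phi> n)) w)"

definition propagator ::
  "(real^2) measure \<Rightarrow> (nat \<Rightarrow> real^2 \<Rightarrow> complex) \<Rightarrow> (nat \<Rightarrow> real) \<Rightarrow> real
     \<Rightarrow> (real^2 \<Rightarrow> complex) \<Rightarrow> real^2 \<Rightarrow> complex" where
  "propagator \<nu> \<phi> lam t = spectral_op \<nu> \<phi> lam (\<lambda>l. exp (- \<i> * complex_of_real t * complex_of_real l))"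

definition Hs ::
  "(real^2) measure \<Rightarrow> (nat \<Rightarrow> real^2 \<Rightarrow> complex) \<Rightarrow> (nat \<Rightarrow> real) \<Rightarrow> real
     \<Rightarrow> (real^2 \<Rightarrow> complex) set" where
  "Hs \<nu> \<phi> lam s =
     {u \<in> L2 \<nu>. \<exists>v\<in>L2 \<nu>. AE x in \<nu>.
        u x = spectral_op \<nu> \<phi> lam (\<lambda>l. complex_of_real ((1 + l) powr (- s / 2))) v x}"

definition Hs_norm ::
  "(real^2) measure \<Rightarrow> (nat \<Rightarrow> real^2 \<Rightarrow> complex) \<Rightarrow> (nat \<Rightarrow> real) \<Rightarrow> real
     \<Rightarrow> (real^2 \<Rightarrow> complex) \<Rightarrow> real" where
  "Hs_norm \<nu> \<phi> lam s u =
     sqrt (\<Sum>n. (1 + lam n) powr s * (cmod (L2_inner \<nu> u (\<phi> n)))\<^sup>2)"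

text \<open>The space \<open>C([-T,T]; H\<^sup>s)\<close>. Times outside \<open>[-T,T]\<close> play no role.\<close>

definition C_Hs ::
  "(real^2) measure \<Rightarrow> (nat \<Rightarrow> real^2 \<Rightarrow> complex) \<Rightarrow> (nat \<Rightarrow> real) \<Rightarrow> real \<Rightarrow> real
     \<Rightarrow> (real \<Rightarrow> real^2 \<Rightarrow> complex) set" where
  "C_Hs \<nu> \<phi> lam s T =
     {u. (\<forall>t\<in>{-T..T}. u t \<in> Hs \<nu> \<phi> lam s) \<and>
         (\<forall>t\<in>{-T..T}. ((\<lambda>t'. Hs_norm \<nu> \<phi> lam s (u t' - u t)) \<longlongrightarrow> 0) (at t within {-T..T}))}"

definition C_Hs_norm ::
  "(real^2) measure \<Rightarrow> (nat \<Rightarrow> real^2 \<Rightarrow> complex) \<Rightarrow> (nat \<Rightarrow> real) \<Rightarrow> real \<Rightarrow> real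
     \<Rightarrow> (real \<Rightarrow> real^2 \<Rightarrow> complex) \<Rightarrow> real" where
  "C_Hs_norm \<nu> \<phi> lam s T u = (SUP t\<in>{-T..T}. Hs_norm \<nu> \<phi> lam s (u t))"


section \<open>The nonlinear Schroedinger equation\<close>

text \<open>
  Duhamel's formula on \<open>[-T,T]\<close> for the nonlinearity \<open>\<mu> \<bar>u\<bar>\<^sup>2\<^sup>k u\<close>, as an identity in \<open>L\<^sup>2\<close>;
  \<open>J\<close> is the \<open>L\<^sup>2\<close>-valued integral.
\<close>

definition nls_solution ::
  "(real^2) measure \<Rightarrow> (nat \<Rightarrow> real^2 \<Rightarrow> complex) \<Rightarrow> (nat \<Rightarrow> real) \<Rightarrow> real \<Rightarrow> nat \<Rightarrow> real
     \<Rightarrow> (real^2 \<Rightarrow> complex) \<Rightarrow> (real \<Rightarrow> real^2 \<Rightarrow> complex) \<Rightarrow> bool" where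
  "nls_solution \<nu> \<phi> lam \<mu> k T u0 u \<longleftrightarrow>
     (\<forall>t\<in>{-T..T}. \<exists>J\<in>L2 \<nu>.
        seminorm_has_oriented_integral (L2_norm \<nu>)
          (\<lambda>\<tau>. propagator \<nu> \<phi> lam (t - \<tau>) (\<lambda>x. complex_of_real (cmod (u \<tau> x) ^ (2 * k)) * u \<tau> x)) 0 t J \<and>
        (AE x in \<nu>. u t x = propagator \<nu> \<phi> lam t u0 x - \<i> * complex_of_real \<mu> * J x))"

definition H1_solution ::
  "(real^2) measure \<Rightarrow> (nat \<Rightarrow> real^2 \<Rightarrow> complex) \<Rightarrow> (nat \<Rightarrow> real) \<Rightarrow> real \<Rightarrow> nat \<Rightarrow> real
     \<Rightarrow> (real^2 \<Rightarrow> complex) \<Rightarrow> (real \<Rightarrow> real^2 \<Rightarrow> complex) \<Rightarrow> bool" where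
  "H1_solution \<nu> \<phi> lam \<mu> k T u0 u \<longleftrightarrow>
     u \<in> C_Hs \<nu> \<phi> lam 1 T \<and> nls_solution \<nu> \<phi> lam \<mu> k T u0 u"

text \<open>
  \<open>\<Phi>\<close> is the flow map near the origin: on an \<open>H\<^sup>1\<close>-neighbourhood of \<open>0\<close> it gives the
  \<open>H\<^sup>1\<close>-solution on \<open>[-T,T]\<close>.
\<close>

definition extends_H1_flow ::
  "(real^2) measure \<Rightarrow> (nat \<Rightarrow> real^2 \<Rightarrow> complex) \<Rightarrow> (nat \<Rightarrow> real) \<Rightarrow> real \<Rightarrow> nat \<Rightarrow> real
     \<Rightarrow> (real^2 \<Rightarrow> complex) set \<Rightarrow> ((real^2 \<Rightarrow> complex) \<Rightarrow> real \<Rightarrow> real^2 \<Rightarrow> complex) \<Rightarrow> bool" where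
  "extends_H1_flow \<nu> \<phi> lam \<mu> k T U \<Phi> \<longleftrightarrow>
     (\<exists>V\<subseteq>U. seminorm_open (Hs \<nu> \<phi> lam 1) (Hs_norm \<nu> \<phi> lam 1) V \<and> 0 \<in> V \<and>
        (\<forall>u0\<in>V. \<exists>u. H1_solution \<nu> \<phi> lam \<mu> k T u0 u \<and>
           (\<forall>t\<in>{-T..T}. AE x in \<nu>. \<Phi> u0 t x = u t x)))"

definition nls_ill_posed ::
  "(real^2) measure \<Rightarrow> (nat \<Rightarrow> real^2 \<Rightarrow> complex) \<Rightarrow> (nat \<Rightarrow> real) \<Rightarrow> real \<Rightarrow> nat \<Rightarrow> real
     \<Rightarrow> nat \<Rightarrow> bool" where
  "nls_ill_posed \<nu> \<phi> lam \<mu> k s n \<longleftrightarrow>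
     (\<forall>T>0. \<forall>U \<Phi>.
        seminorm_open (Hs \<nu> \<phi> lam s) (Hs_norm \<nu> \<phi> lam s) U \<and> 0 \<in> U \<and>
        extends_H1_flow \<nu> \<phi> lam \<mu> k T U \<Phi> \<longrightarrow>
        \<not> Ck_map_on n (Hs \<nu> \<phi> lam s) (Hs_norm \<nu> \<phi> lam s)
            (C_Hs \<nu> \<phi> lam s T) (C_Hs_norm \<nu> \<phi> lam s T) U \<Phi>)"

end

(*
  Let f be an eigenfunction with eigenvalue l and let u be the H^1-solution with datum e f. In H^1 the
  equation is a small perturbation of the linear one, so u - e S_t f is O(e^(2k+1)) uniformly, and
  Duhamel's formula paired with f gives
    <u(T), f> = e exp(-iTl) |f|_2^2 - i mu T e^(2k+1) exp(-iTl) |f|_(2k+2)^(2k+2) + O(e^(4k+1)).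
  If the flow map were C^(2k+1) on H^s, its derivative of order 2k+1 at 0 would therefore give
    T |f|_(2k+2)^(2k+2) <= C |f|_(H^s)^(2k+1) |f|_(H^-s) = C (1 + l)^(sk) |f|_2^(2k+2).
  This fails for localized eigenfunctions: antisymmetrizing a Neumann eigenfunction under the symmetric
  group of the triangle makes it vanish at the three corners, so that it can be copied into the cell
  F_0^m(SG) and extended by zero. The copy has eigenvalue 5^m l while all integrals of its powers are
  multiplied by 3^(-m), so the inequality would give 3^(mk) = O(5^(smk)).
*)

theory Submission
  imports Defs "HOL-Combinatorics.Permutations"
begin

section \<open>The gasket as a self-similar set\<close>

text \<open>The copy extended by zero must satisfy the weak equation against every \<open>v\<close>
  in the form domain, whatever the values of \<open>v\<close> at the corners of the cell. A function
  that is an eigenfunction only in the Dirichlet sense would leave normal derivatives there, that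
  is, point masses on the right-hand side. A Neumann eigenfunction that happens to vanish at the
  corners leaves none: energy and inner product both restrict to the cell, with factors 5/3 and 1/3,
  whose quotient is the eigenvalue factor 5.

  The equation is perturbative in H^1 because the oscillation of a function is bounded by the square
  root of its energy: restriction to a cell multiplies the energy by at most 3/5.

  The rest is shaped by what is given. The measure is known on cells only, so integrals of
  continuous functions are reached through Riemann sums over cells. Duhamel integrals exist in L^2
  only, so H^1 bounds pass through them finitely many coefficients at a time. Smoothness is used
  only along a line and after pairing with f at time T, which reduces it to Maclaurin's formula for
  a real function.\<close>

lemma less_3_cases: "(i::nat) < 3 \<longleftrightarrow> i = 0 \<or> i = 1 \<or> i = 2"
  by auto

lemma sum_less_3: fixes f :: "nat \<Rightarrow> 'a::comm_monoid_add" shows "(\<Sum>i<3. f i) = f 0 + f 1 + f 2"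
  by (simp add: eval_nat_numeral add.assoc)

lemma contraction_eq: "contraction p i x = (1/2) *\<^sub>R x + (1/2) *\<^sub>R p i"
  by (simp add: vec_eq_iff contraction_def field_simps)

lemma contraction_fixed [simp]: "contraction p i (p i) = p i"
  by (simp add: contraction_def)

lemma contraction_commute: "contraction p i (p j) = contraction p j (p i)"
  by (simp add: contraction_eq add.commute)

lemma inj_contraction: "inj (contraction p i)"
  by (rule injI) (simp add: contraction_def)

lemma contraction_eq_iff [simp]: "contraction p i x = contraction p i y \<longleftrightarrow> x = y"
  by (simp add: contraction_def)

lemma dist_contraction: "dist (contraction p i x) (contraction p i y) = dist x y / 2"
proof -
  have "dist (contraction p i x) (contraction p i y) = norm ((1/2) *\<^sub>R (x - y))"
    unfolding contraction_def dist_norm by (simp add: algebra_simps)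
  then show ?thesis by (simp add: dist_norm)
qed

lemma continuous_contraction [continuous_intros]:
  "continuous_on S f \<Longrightarrow> continuous_on S (\<lambda>x. contraction p i (f x))"
  unfolding contraction_def by (intro continuous_intros)

lemma dist_cell_map: "dist (cell_map p w x) (cell_map p w y) = dist x y / 2 ^ length w"
  by (induction w arbitrary: x y) (simp_all add: dist_contraction)

lemma words_0 [simp]: "words 0 = {[]}"
  by (auto simp: words_def)

lemma words_Suc: "words (Suc m) = (\<lambda>(i, w). i # w) ` ({..<3} \<times> words m)"
proof (intro set_eqI iffI)
  fix v assume "v \<in> words (Suc m)"
  then obtain i w where "v = i # w" "w \<in> words m" "i < 3"
    by (cases v) (auto simp: words_def)
  then show "v \<in> (\<lambda>(i, w). i # w) ` ({..<3} \<times> words m)" by auto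
qed (auto simp: words_def)

lemma finite_words [simp]: "finite (words m)"
  by (induction m) (auto simp: words_Suc)

lemma card_words: "card (words m) = 3 ^ m"
proof (induction m)
  case (Suc m)
  have "inj_on (\<lambda>(i, w). i # w) ({..<3} \<times> words m)"
    by (auto simp: inj_on_def)
  then show ?case
    by (simp add: words_Suc card_image card_cartesian_product Suc)
qed simp

lemma sum_words_Suc: "(\<Sum>w\<in>words (Suc m). f w) = (\<Sum>i<3. \<Sum>w\<in>words m. f (i # w))"
proof -
  have "inj_on (\<lambda>(i, w). i # w) ({..<3} \<times> words m)"
    by (auto simp: inj_on_def)
  then show ?thesis
    by (simp add: words_Suc sum.reindex sum.cartesian_product case_prod_unfold)
qed

lemma UN_words_Suc: "(\<Union>w\<in>words (Suc m). f w) = (\<Union>i<3. \<Union>w\<in>words m. f (i # w))"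
  by (auto simp: words_Suc)

lemma UN_less_3: "(\<Union>i<3. f i) = f 0 \<union> f 1 \<union> f (2::nat)"
  by (auto simp: less_3_cases)

section \<open>The Hutchinson operator and the uniqueness of its compact fixed set\<close>

definition gasket_step :: "(nat \<Rightarrow> real^2) \<Rightarrow> (real^2) set \<Rightarrow> (real^2) set" where
  "gasket_step p K = (\<Union>i<3. contraction p i ` K)"

lemma gasket_stepI: "i < 3 \<Longrightarrow> y \<in> K \<Longrightarrow> contraction p i y \<in> gasket_step p K"
  by (auto simp: gasket_step_def)

lemma gasket_step_mono: "K \<subseteq> L \<Longrightarrow> gasket_step p K \<subseteq> gasket_step p L"
  by (auto simp: gasket_step_def)

lemma gasket_step_cells:
  assumes "K = gasket_step p K"
  shows "K = (\<Union>w\<in>words m. cell_map p w ` K)"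
proof (induction m)
  case (Suc m)
  have "K = (\<Union>i<3. contraction p i ` K)"
    using assms by (simp add: gasket_step_def)
  also have "\<dots> = (\<Union>i<3. contraction p i ` (\<Union>w\<in>words m. cell_map p w ` K))"
    using Suc by simp
  also have "\<dots> = (\<Union>w\<in>words (Suc m). cell_map p w ` K)"
    by (simp add: UN_words_Suc image_UN image_comp)
  finally show ?case .
qed simp

text \<open>Every point of \<open>K\<close> has an address of each length \<open>m\<close>. The same
  cell map applied to a fixed \<open>z\<close> in \<open>L\<close> lands in \<open>L\<close> at
  distance at most \<open>B / 2 ^ m\<close>, and \<open>L\<close> is closed.\<close>

lemma gasket_step_unique_subset:
  assumes K: "compact K" "K = gasket_step p K" and L: "compact L" "L = gasket_step p L" "L \<noteq> {}"
  shows "K \<subseteq> L"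
proof
  fix x assume "x \<in> K"
  obtain z where z: "z \<in> L" using L by auto
  obtain B where B: "\<And>y. y \<in> K \<Longrightarrow> dist y z \<le> B"
    using K(1) bounded_any_center[of K z] compact_imp_bounded by (metis dist_commute)
  have "x \<in> closure L"
    unfolding closure_approachable
  proof (intro allI impI)
    fix e :: real assume "e > 0"
    obtain m where m: "B / e < 2 ^ m"
      using real_arch_pow[of 2 "B / e"] by auto
    obtain w y where w: "w \<in> words m" "y \<in> K" "x = cell_map p w y"
      using \<open>x \<in> K\<close> equalityD1[OF gasket_step_cells[OF K(2), of m]] by blast
    have "cell_map p w z \<in> L"
      using equalityD2[OF gasket_step_cells[OF L(2), of m]] w z by blast
    moreover have "dist (cell_map p w z) x = dist y z / 2 ^ m"
      using w by (simp add: dist_cell_map words_def dist_commute)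
    moreover have "dist y z / 2 ^ m \<le> B / 2 ^ m"
      using B[OF w(2)] by (simp add: divide_right_mono)
    moreover have "B / 2 ^ m < e"
      using m \<open>e > 0\<close> by (simp add: field_simps)
    ultimately show "\<exists>y\<in>L. dist y x < e" by (metis order_le_less_trans)
  qed
  then show "x \<in> L" using L(1) by (simp add: compact_imp_closed)
qed

lemma gasket_step_fixed_unique:
  assumes "compact K" "K = gasket_step p K" "K \<noteq> {}" "compact L" "L = gasket_step p L" "L \<noteq> {}"
  shows "K = L"
  using gasket_step_unique_subset[OF assms(1,2,4,5,6)] gasket_step_unique_subset[OF assms(4,5,1,2,3)]
  by auto

section \<open>Barycentric coordinates of the triangle\<close>

locale triangle =
  fixes p :: "nat \<Rightarrow> real^2"
  assumes equilateral: "equilateral p"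
begin

abbreviation F :: "nat \<Rightarrow> real^2 \<Rightarrow> real^2" where "F \<equiv> contraction p"

abbreviation Fw :: "nat list \<Rightarrow> real^2 \<Rightarrow> real^2" where "Fw \<equiv> cell_map p"

definition centre :: "real^2" where
  "centre = (1/3) *\<^sub>R (p 0 + p 1 + p 2)"

text \<open>In a unit equilateral triangle the vectors from the centre to the vertices have squared
  length 1/3 and mutual inner products -1/6. The constants 1/3 and 2 therefore give the value 1 at
  \<open>p i\<close> and 0 at the other two vertices.\<close>

definition bary :: "nat \<Rightarrow> real^2 \<Rightarrow> real" where
  "bary i x = 1/3 + 2 * inner (p i - centre) (x - centre)"

lemma inner_diff: "i < 3 \<Longrightarrow> j < 3 \<Longrightarrow> i \<noteq> j \<Longrightarrow>
    inner (p i) (p i) - 2 * inner (p i) (p j) + inner (p j) (p j) = 1"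
proof -
  assume "i < 3" "j < 3" "i \<noteq> j"
  then have "norm (p i - p j) ^ 2 = 1"
    using equilateral by (simp add: equilateral_def dist_norm)
  then have "inner (p i - p j) (p i - p j) = 1"
    by (simp add: power2_norm_eq_inner)
  then show ?thesis
    by (simp add: inner_diff_left inner_diff_right inner_commute algebra_simps)
qed

lemma bary_vertex: "i < 3 \<Longrightarrow> j < 3 \<Longrightarrow> bary i (p j) = (if i = j then 1 else 0)"
  using inner_diff[of 0 1] inner_diff[of 1 2] inner_diff[of 0 2]
  unfolding less_3_cases
  by (elim disjE)
    (simp_all add: bary_def centre_def inner_diff_left inner_diff_right inner_add_left inner_add_right inner_commute
      algebra_simps)

lemma bary_sum: "(\<Sum>i<3. bary i x) = 1"
proof -
  have "(\<Sum>i<3. bary i x) = 1 + 2 * inner (p 0 + p 1 + p 2 - 3 *\<^sub>R centre) (x - centre)"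
    unfolding sum_less_3 bary_def by (simp add: inner_diff_left inner_add_left algebra_simps)
  also have "p 0 + p 1 + p 2 - 3 *\<^sub>R centre = 0"
    by (simp add: centre_def)
  finally show ?thesis by simp
qed

lemma bary_half_add: "bary i ((1/2) *\<^sub>R x + (1/2) *\<^sub>R y) = (bary i x + bary i y) / 2"
  unfolding bary_def by (simp add: inner_diff_right inner_add_right field_simps)

lemma bary_contraction: "i < 3 \<Longrightarrow> j < 3 \<Longrightarrow> bary i (F j x) = (bary i x + (if i = j then 1 else 0)) / 2"
  by (simp only: contraction_eq bary_half_add bary_vertex)

lemma bary_combination:
  assumes "i < 3" "(\<Sum>j<3. a j) = 1"
  shows "bary i (\<Sum>j<3. a j *\<^sub>R p j) = a i"
proof -
  have "(\<Sum>j<3. a j *\<^sub>R p j) - centre = (\<Sum>j<3. a j *\<^sub>R p j) - (\<Sum>j<3. a j) *\<^sub>R centre"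
    using assms by simp
  also have "\<dots> = (\<Sum>j<3. a j *\<^sub>R (p j - centre))"
    by (simp add: scaleR_sum_left scaleR_right_diff_distrib sum_subtractf)
  finally have "bary i (\<Sum>j<3. a j *\<^sub>R p j) = 1/3 + 2 * (\<Sum>j<3. a j * inner (p i - centre) (p j - centre))"
    unfolding bary_def by (simp add: inner_sum_right)
  also have "(\<lambda>j. a j * inner (p i - centre) (p j - centre)) = (\<lambda>j. a j * ((bary i (p j) - 1/3) / 2))"
    by (simp add: bary_def)
  also have "1/3 + 2 * (\<Sum>j<3. a j * ((bary i (p j) - 1/3) / 2)) = 1/3 + (\<Sum>j<3. a j * bary i (p j)) - (\<Sum>j<3. a j) / 3"
    by (simp add: sum_less_3 field_simps)
  also have "(\<Sum>j<3. a j * bary i (p j)) = a i"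
    using assms(1) by (auto simp: bary_vertex sum_less_3 less_3_cases)
  finally show ?thesis using assms by simp
qed

lemma continuous_bary [continuous_intros]: "continuous_on S f \<Longrightarrow> continuous_on S (\<lambda>x. bary i (f x))"
  unfolding bary_def by (intro continuous_intros)

text \<open>Reconstruction from the coordinates is part of the definition, so that a point of
  \<open>tri\<close> is determined by its coordinates without an argument about affine
  spans.\<close>

definition tri :: "(real^2) set" where
  "tri = {x. (\<forall>i<3. 0 \<le> bary i x) \<and> x = (\<Sum>i<3. bary i x *\<^sub>R p i)}"

lemma triD: "x \<in> tri \<Longrightarrow> i < 3 \<Longrightarrow> 0 \<le> bary i x" "x \<in> tri \<Longrightarrow> (\<Sum>i<3. bary i x *\<^sub>R p i) = x"
  by (auto simp: tri_def)

lemma tri_eqI: "x \<in> tri \<Longrightarrow> y \<in> tri \<Longrightarrow> (\<And>i. i < 3 \<Longrightarrow> bary i x = bary i y) \<Longrightarrow> x = y"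
  by (metis (no_types, lifting) lessThan_iff sum.cong triD(2))

lemma bary_le_1: "x \<in> tri \<Longrightarrow> i < 3 \<Longrightarrow> bary i x \<le> 1"
  using bary_sum[of x] triD(1)[of x 0] triD(1)[of x 1] triD(1)[of x 2]
  by (auto simp: sum_less_3 less_3_cases)

lemma vertex_in_tri: "j < 3 \<Longrightarrow> p j \<in> tri"
  by (auto simp: tri_def bary_vertex sum_less_3 less_3_cases)

lemma compact_tri: "compact tri"
proof -
  have "tri = (\<Inter>i\<in>{..<3}. {x. 0 \<le> bary i x}) \<inter> {x. x = (\<Sum>i<3. bary i x *\<^sub>R p i)}"
    by (auto simp: tri_def)
  moreover have "closed {x. x = (\<Sum>i<3. bary i x *\<^sub>R p i)}"
    by (intro closed_Collect_eq continuous_intros)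
  moreover have "closed {x. 0 \<le> bary i x}" for i
    by (intro closed_Collect_le continuous_intros)
  ultimately have "closed tri" by (metis (no_types, lifting) closed_INT closed_Int)
  moreover have "bounded tri"
    unfolding bounded_iff
  proof (intro exI ballI)
    fix x assume x: "x \<in> tri"
    have "norm x = norm (\<Sum>i<3. bary i x *\<^sub>R p i)" using triD(2)[OF x] by simp
    also have "\<dots> \<le> (\<Sum>i<3. norm (p i))"
      using bary_le_1[OF x] triD(1)[OF x]
      by (intro sum_norm_le) (auto intro!: mult_left_le_one_le)
    finally show "norm x \<le> (\<Sum>i<3. norm (p i))" .
  qed
  ultimately show ?thesis by (simp add: compact_eq_bounded_closed)
qed

lemma contraction_tri: "x \<in> tri \<Longrightarrow> j < 3 \<Longrightarrow> F j x \<in> tri"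
proof -
  assume x: "x \<in> tri" and j: "j < 3"
  have "(\<Sum>i<3. bary i (F j x) *\<^sub>R p i)
      = (\<Sum>i<3. ((bary i x + (if i = j then 1 else 0)) / 2) *\<^sub>R p i)"
    using j by (intro sum.cong) (simp_all add: bary_contraction)
  also have "\<dots> = (\<Sum>i<3. (1/2) *\<^sub>R (bary i x *\<^sub>R p i) + (1/2) *\<^sub>R (if i = j then p i else 0))"
    by (intro sum.cong) (simp_all add: scaleR_left_distrib add_divide_distrib)
  also have "\<dots> = (1/2) *\<^sub>R (\<Sum>i<3. bary i x *\<^sub>R p i) + (1/2) *\<^sub>R (\<Sum>i<3. (if i = j then p i else 0))"
    by (simp only: sum.distrib scaleR_sum_right)
  also have "\<dots> = F j x"
    using j by (simp only: triD(2)[OF x] contraction_eq sum.delta finite_lessThan lessThan_iff if_True)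
  finally show ?thesis
    using j triD(1)[OF x] by (auto simp: tri_def bary_contraction)
qed

lemma gasket_step_tri: "gasket_step p tri \<subseteq> tri"
  by (auto simp: gasket_step_def contraction_tri)

section \<open>Existence of the gasket\<close>

lemma compact_gasket_step: "compact K \<Longrightarrow> compact (gasket_step p K)"
  unfolding gasket_step_def by (intro compact_UN compact_continuous_image continuous_intros) auto

text \<open>The fixed set is the intersection of the decreasing iterates of the triangle, nonempty
  because it contains the fixed point \<open>p 0\<close>. For the inclusion into
  \<open>gasket_step p K\<close> injectivity matters: \<open>x\<close> has at most one preimage
  under each map, and a preimage outside \<open>K\<close> has left the iterates from some index on.
  The sum of the three indices serves as a common one.\<close>

lemma exists_fixed: "\<exists>K. compact K \<and> K \<noteq> {} \<and> K = gasket_step p K \<and> K \<subseteq> tri"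
proof -
  define S where "S n = (gasket_step p ^^ n) tri" for n
  define K where "K = (\<Inter>n. S n)"
  have S0: "S 0 = tri" and SS: "S (Suc n) = gasket_step p (S n)" for n
    by (simp_all add: S_def)
  have comp: "compact (S n)" for n
    by (induction n) (simp_all add: S0 SS compact_tri compact_gasket_step)
  have dec: "S (Suc n) \<subseteq> S n" for n
  proof (induction n)
    case 0
    show ?case using gasket_step_tri by (simp only: S0 SS)
  next
    case (Suc n)
    then show ?case using gasket_step_mono by (simp only: SS)
  qed
  have anti: "m \<le> n \<Longrightarrow> S n \<subseteq> S m" for m n
    by (rule lift_Suc_antimono_le[of S]) (use dec in auto)
  have p0: "p 0 \<in> S n" for n
  proof (induction n)
    case (Suc n)
    then have "F 0 (p 0) \<in> gasket_step p (S n)"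
      by (intro gasket_stepI) simp
    then show ?case by (simp add: SS)
  qed (simp add: S0 vertex_in_tri)
  have "compact K"
    unfolding K_def using comp by (intro compact_Inter) auto
  moreover have "K \<noteq> {}" using p0 by (auto simp: K_def)
  moreover have "gasket_step p K \<subseteq> K"
  proof -
    have "gasket_step p K \<subseteq> S n" for n
    proof -
      have "gasket_step p K \<subseteq> gasket_step p (S n)"
        by (intro gasket_step_mono) (auto simp: K_def)
      then show ?thesis using dec[of n] by (simp add: SS)
    qed
    then show ?thesis by (auto simp: K_def)
  qed
  moreover have "K \<subseteq> gasket_step p K"
  proof
    fix x assume x: "x \<in> K"
    show "x \<in> gasket_step p K"
    proof (rule ccontr)
      assume neg: "x \<notin> gasket_step p K"
      have "\<forall>i<3. \<exists>n. \<forall>y. x = F i y \<longrightarrow> y \<notin> S n"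
      proof (intro allI impI)
        fix i :: nat assume i: "i < 3"
        show "\<exists>n. \<forall>y. x = F i y \<longrightarrow> y \<notin> S n"
        proof (cases "\<exists>y. x = F i y")
          case True
          then obtain y where y: "x = F i y" by auto
          then have "y \<notin> K" using neg i by (auto simp: gasket_step_def)
          then obtain n where "y \<notin> S n" by (auto simp: K_def)
          then show ?thesis using y by auto
        qed auto
      qed
      then obtain N where N: "\<And>i y. i < 3 \<Longrightarrow> x = F i y \<Longrightarrow> y \<notin> S (N i)"
        by metis
      have "x \<in> S (Suc (N 0 + N 1 + N 2))" using x by (auto simp: K_def)
      then obtain i y where iy: "i < 3" "x = F i y" "y \<in> S (N 0 + N 1 + N 2)"
        by (auto simp: SS gasket_step_def)
      have "N i \<le> N 0 + N 1 + N 2" using iy(1) by (auto simp: less_3_cases)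
      then show False using N[OF iy(1,2)] iy(3) anti by blast
    qed
  qed
  moreover have "K \<subseteq> tri" using S0 by (auto simp: K_def)
  ultimately show ?thesis by blast
qed

abbreviation G :: "(real^2) set" where "G \<equiv> SG p"

lemma SG_props: "compact G" "G \<noteq> {}" "G = gasket_step p G" "G \<subseteq> tri"
proof -
  obtain K where K: "compact K" "K \<noteq> {}" "K = gasket_step p K" "K \<subseteq> tri"
    using exists_fixed by blast
  have "G = K"
    unfolding SG_def
  proof (rule the_equality)
    show "compact K \<and> K \<noteq> {} \<and> K = F 0 ` K \<union> F 1 ` K \<union> F 2 ` K"
      using K by (simp add: gasket_step_def UN_less_3)
    fix L assume "compact L \<and> L \<noteq> {} \<and> L = F 0 ` L \<union> F 1 ` L \<union> F 2 ` L"
    then have "compact L" "L = gasket_step p L" "L \<noteq> {}" by (simp_all add: gasket_step_def UN_less_3)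
    then show "L = K" using gasket_step_fixed_unique K by metis
  qed
  then show "compact G" "G \<noteq> {}" "G = gasket_step p G" "G \<subseteq> tri" using K by auto
qed

lemma SG_unique: "compact K \<Longrightarrow> K \<noteq> {} \<Longrightarrow> K = gasket_step p K \<Longrightarrow> K = G"
  using gasket_step_fixed_unique SG_props by metis

lemma contraction_SG [simp, intro]: "x \<in> G \<Longrightarrow> i < 3 \<Longrightarrow> F i x \<in> G"
  using equalityD2[OF SG_props(3)] unfolding gasket_step_def by blast

text \<open>Iterating \<open>F i\<close> from any point of the gasket converges to the fixed point
  \<open>p i\<close>, and the gasket is closed.\<close>

lemma vertex_SG [simp, intro]: "i < 3 \<Longrightarrow> p i \<in> G"
proof -
  assume i: "i < 3"
  obtain z where z: "z \<in> G" using SG_props by auto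
  have it: "((F i ^^ n) z) \<in> G" for n
    by (induction n) (auto simp: z i)
  have "(F i ^^ n) z = p i + (1/2)^n *\<^sub>R (z - p i)" for n
  proof (induction n)
    case (Suc n)
    then show ?case by (simp add: contraction_def)
  qed simp
  moreover have "(\<lambda>n. p i + (1/2)^n *\<^sub>R (z - p i)) \<longlonglongrightarrow> p i + 0 *\<^sub>R (z - p i)"
    by (intro tendsto_intros LIMSEQ_realpow_zero) auto
  ultimately have "(\<lambda>n. (F i ^^ n) z) \<longlonglongrightarrow> p i" by simp
  then show ?thesis
    by (rule closed_sequentially[OF compact_imp_closed[OF SG_props(1)] it])
qed

lemma cell_map_SG [simp, intro]: "w \<in> words m \<Longrightarrow> x \<in> G \<Longrightarrow> Fw w x \<in> G"
  by (induction m arbitrary: w) (auto simp: words_Suc)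

lemma SG_cells: "G = (\<Union>w\<in>words m. Fw w ` G)"
  by (rule gasket_step_cells) (rule SG_props)

text \<open>Comparing the \<open>j\<close>-th coordinates gives
  \<open>bary j x = 1 + bary j y\<close>, while coordinates on the triangle lie between 0 and 1. Two
  cells of the first level thus meet at most in a junction point; the splitting of energies and the
  extension by zero both rest on this.\<close>

lemma cells_meet:
  assumes "i < 3" "j < 3" "i \<noteq> j" "x \<in> G" "y \<in> G" "F i x = F j y"
  shows "x = p j"
proof -
  have x: "x \<in> tri" and y: "y \<in> tri" using SG_props assms by auto
  have *: "(bary l x + (if l = i then 1 else 0)) / 2 = (bary l y + (if l = j then 1 else 0)) / 2" if "l < 3" for l
    using assms bary_contraction[of l i x] bary_contraction[of l j y] that by simp
  have "bary j x = 1 + bary j y"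
    using *[of j] assms by simp
  then have "bary j x = 1" using bary_le_1[OF x, of j] triD(1)[OF y, of j] assms by simp
  then have "bary l x = (if l = j then 1 else 0)" if "l < 3" for l
    using bary_sum[of x] triD(1)[OF x, of 0] triD(1)[OF x, of 1] triD(1)[OF x, of 2] that assms(2)
    by (auto simp: sum_less_3 less_3_cases)
  then show ?thesis
    using assms x by (intro tri_eqI) (auto simp: vertex_in_tri bary_vertex)
qed

lemma vertex_eq_iff: "i < 3 \<Longrightarrow> j < 3 \<Longrightarrow> p i = p j \<longleftrightarrow> i = j"
  using bary_vertex by (metis zero_neq_one)

section \<open>Symmetries of the gasket\<close>

definition perm_map :: "(nat \<Rightarrow> nat) \<Rightarrow> real^2 \<Rightarrow> real^2" where
  "perm_map \<sigma> x = (\<Sum>i<3. bary i x *\<^sub>R p (\<sigma> i))"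

lemma perm_map_vertex: "i < 3 \<Longrightarrow> perm_map \<sigma> (p i) = p (\<sigma> i)"
proof -
  assume i: "i < 3"
  have "perm_map \<sigma> (p i) = (\<Sum>j<3. (if j = i then p (\<sigma> j) else 0))"
    unfolding perm_map_def using i by (intro sum.cong) (auto simp: bary_vertex)
  then show ?thesis using i by simp
qed

lemma continuous_perm_map [continuous_intros]: "continuous_on S f \<Longrightarrow> continuous_on S (\<lambda>x. perm_map \<sigma> (f x))"
  unfolding perm_map_def by (intro continuous_intros)

lemma permutes_less_3 [simp]: "\<sigma> permutes {..<3} \<Longrightarrow> \<sigma> i < 3 \<longleftrightarrow> i < (3::nat)"
  using permutes_in_image by fastforce

lemma perm_map_alt: 
  assumes "\<sigma> permutes {..<3}"
  shows "perm_map \<sigma> x = (\<Sum>i<3. bary (inv \<sigma> i) x *\<^sub>R p i)"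
proof -
  have "perm_map \<sigma> x = (\<Sum>i\<in>{..<3}. bary (inv \<sigma> (\<sigma> i)) x *\<^sub>R p (\<sigma> i))"
    unfolding perm_map_def using assms by (simp add: permutes_inverses)
  also have "\<dots> = (\<Sum>i<3. bary (inv \<sigma> i) x *\<^sub>R p i)"
    using sum.permute[OF assms, of "\<lambda>i. bary (inv \<sigma> i) x *\<^sub>R p i"] by (simp add: o_def)
  finally show ?thesis .
qed

lemma bary_perm_map:
  assumes "\<sigma> permutes {..<3}" "i < 3"
  shows "bary i (perm_map \<sigma> x) = bary (inv \<sigma> i) x"
proof -
  have "(\<Sum>i<3. bary (inv \<sigma> i) x) = (\<Sum>i<3. bary i x)"
    using sum.permute[OF permutes_inv[OF assms(1)], of "\<lambda>i. bary i x"] by (simp add: o_def)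
  then show ?thesis
    unfolding perm_map_alt[OF assms(1)] using assms(2) by (intro bary_combination) (simp_all add: bary_sum)
qed

lemma perm_map_compose:
  assumes "\<sigma> permutes {..<3}" "\<tau> permutes {..<3}"
  shows "perm_map \<sigma> (perm_map \<tau> x) = perm_map (\<sigma> \<circ> \<tau>) x"
proof -
  have "perm_map \<sigma> (perm_map \<tau> x) = (\<Sum>i<3. bary (inv \<tau> i) x *\<^sub>R p (\<sigma> i))"
    unfolding perm_map_def[of \<sigma>] using assms by (intro sum.cong) (simp_all add: bary_perm_map)
  also have "\<dots> = (\<Sum>i<3. bary (inv \<tau> (\<tau> i)) x *\<^sub>R p (\<sigma> (\<tau> i)))"
    using sum.permute[OF assms(2), of "\<lambda>i. bary (inv \<tau> i) x *\<^sub>R p (\<sigma> i)"] by (simp add: o_def)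
  also have "\<dots> = perm_map (\<sigma> \<circ> \<tau>) x"
    unfolding perm_map_def using assms by (simp add: permutes_inverses)
  finally show ?thesis .
qed

lemma perm_map_id: "x \<in> tri \<Longrightarrow> perm_map id x = x"
  by (simp add: perm_map_def triD)

lemma perm_map_inv:
  assumes "\<sigma> permutes {..<3}" "x \<in> tri"
  shows "perm_map (inv \<sigma>) (perm_map \<sigma> x) = x" "perm_map \<sigma> (perm_map (inv \<sigma>) x) = x"
  using assms by (simp_all add: perm_map_compose permutes_inv perm_map_id permutes_inv_o)

lemma perm_map_contraction:
  assumes "\<sigma> permutes {..<3}" "j < 3"
  shows "perm_map \<sigma> (F j x) = F (\<sigma> j) (perm_map \<sigma> x)"
proof -
  have "perm_map \<sigma> (F j x) = (\<Sum>i<3. ((bary i x + (if i = j then 1 else 0)) / 2) *\<^sub>R p (\<sigma> i))"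
    unfolding perm_map_def using assms by (intro sum.cong) (simp_all add: bary_contraction)
  also have "\<dots> = (\<Sum>i<3. (1/2) *\<^sub>R (bary i x *\<^sub>R p (\<sigma> i)) + (1/2) *\<^sub>R (if i = j then p (\<sigma> i) else 0))"
    by (intro sum.cong) (simp_all add: scaleR_left_distrib add_divide_distrib)
  also have "\<dots> = (1/2) *\<^sub>R perm_map \<sigma> x + (1/2) *\<^sub>R (\<Sum>i<3. (if i = j then p (\<sigma> i) else 0))"
    by (simp only: sum.distrib scaleR_sum_right perm_map_def)
  also have "(\<Sum>i<3. (if i = j then p (\<sigma> i) else 0)) = p (\<sigma> j)"
    using assms(2) by simp
  finally show ?thesis by (simp only: contraction_eq)
qed

lemma perm_map_cell_map:
  assumes "\<sigma> permutes {..<3}" "w \<in> words m"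
  shows "perm_map \<sigma> (Fw w x) = Fw (map \<sigma> w) (perm_map \<sigma> x)"
  using assms by (induction m arbitrary: w) (auto simp: words_Suc perm_map_contraction)

text \<open>A symmetry intertwines \<open>F j\<close> with \<open>F (\<sigma> j)\<close>, so the
  image of the gasket is again a fixed set of \<open>gasket_step\<close> and uniqueness
  applies.\<close>

lemma perm_map_SG_image:
  assumes "\<sigma> permutes {..<3}"
  shows "perm_map \<sigma> ` G = G"
proof (rule SG_unique)
  show "compact (perm_map \<sigma> ` G)"
    using SG_props by (intro compact_continuous_image continuous_intros)
  show "perm_map \<sigma> ` G \<noteq> {}" using SG_props by simp
  have "perm_map \<sigma> ` G = perm_map \<sigma> ` gasket_step p G" using SG_props(3) by simp
  also have "\<dots> = (\<Union>i<3. F (\<sigma> i) ` perm_map \<sigma> ` G)"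
    unfolding gasket_step_def image_UN image_image using assms
    by (intro SUP_cong image_cong) (simp_all add: perm_map_contraction)
  also have "\<dots> = (\<Union>i\<in>\<sigma> ` {..<3}. F i ` perm_map \<sigma> ` G)"
    by (simp add: image_image)
  also have "\<sigma> ` {..<3} = {..<3}" using assms by (rule permutes_image)
  finally show "perm_map \<sigma> ` G = gasket_step p (perm_map \<sigma> ` G)"
    by (simp add: gasket_step_def)
qed

lemma perm_map_SG [simp, intro]: "\<sigma> permutes {..<3} \<Longrightarrow> x \<in> G \<Longrightarrow> perm_map \<sigma> x \<in> G"
  using perm_map_SG_image by blast

lemma SG_tri: "x \<in> G \<Longrightarrow> x \<in> tri"
  using SG_props by auto

end

section \<open>The energy form\<close>

context triangle
begin

section \<open>Self-similarity and monotonicity of the graph energies\<close>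

definition edges :: "nat \<Rightarrow> ((real^2) \<times> (real^2)) set" where
  "edges m = {(x, y). adj p m x y}"

lemma graph_energy_eq: "graph_energy p m u v = (1/2) * (\<Sum>(x, y)\<in>edges m. (u y - u x) * cnj (v y - v x))"
  by (simp add: graph_energy_def edges_def)

lemma words_iff: "w \<in> words m \<longleftrightarrow> length w = m \<and> (\<forall>i\<in>set w. i < 3)"
  by (auto simp: words_def less_3_cases subset_iff)

lemma V0_eq: "V0 p = p ` {..<3}"
  by (auto simp: V0_def less_3_cases)

lemma edges_0: "edges 0 = {(p 0, p 1), (p 0, p 2), (p 1, p 0), (p 1, p 2), (p 2, p 0), (p 2, p 1)}"
  using vertex_eq_iff[of 0 1] vertex_eq_iff[of 0 2] vertex_eq_iff[of 1 2]
  by (auto simp: edges_def adj_def V0_def)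

lemma edges_Suc: "edges (Suc m) = (\<Union>i<3. map_prod (F i) (F i) ` edges m)"
proof (intro set_eqI iffI)
  fix e assume "e \<in> edges (Suc m)"
  then obtain x y w where e: "e = (x, y)" "x \<noteq> y" "w \<in> words (Suc m)" "x \<in> Fw w ` V0 p" "y \<in> Fw w ` V0 p"
    by (auto simp: edges_def adj_def)
  then obtain i v where w: "w = i # v" "i < 3" "v \<in> words m" by (auto simp: words_Suc)
  obtain x' y' where "x = F i x'" "y = F i y'" "x' \<in> Fw v ` V0 p" "y' \<in> Fw v ` V0 p"
    using e w by auto
  then show "e \<in> (\<Union>i<3. map_prod (F i) (F i) ` edges m)"
    using e w by (intro UN_I[of i] image_eqI[of _ _ "(x', y')"]) (auto simp: edges_def adj_def)
next
  fix e assume "e \<in> (\<Union>i<3. map_prod (F i) (F i) ` edges m)"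
  then obtain i x y w where e: "i < 3" "e = (F i x, F i y)" "x \<noteq> y" "w \<in> words m"
    "x \<in> Fw w ` V0 p" "y \<in> Fw w ` V0 p"
    by (auto simp: edges_def adj_def)
  then have "i # w \<in> words (Suc m)" by (auto simp: words_Suc)
  then show "e \<in> edges (Suc m)"
    using e by (auto simp: edges_def adj_def intro!: bexI[of _ "i # w"])
qed

lemma finite_edges [simp]: "finite (edges m)"
  by (induction m) (simp add: edges_0, simp only: edges_Suc, auto)

lemma edges_SG: "(x, y) \<in> edges m \<Longrightarrow> x \<in> G \<and> y \<in> G \<and> x \<noteq> y"
  by (auto simp: edges_def adj_def V0_eq)

lemma sum_map_prod_contraction:
  "(\<Sum>e\<in>map_prod (F i) (F i) ` S. f e)
     = (\<Sum>e\<in>S. f (map_prod (F i) (F i) e))"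
proof -
  have "inj_on (map_prod (F i) (F i)) S"
    by (rule inj_on_subset[OF prod.inj_map[OF inj_contraction inj_contraction]]) simp
  then show ?thesis using sum.reindex[of _ S f] by (simp only: o_def)
qed

text \<open>In the coordinates of cell \<open>i\<close>, both endpoints of a common edge would be
  the single corner \<open>p j\<close>, but the endpoints of an edge are distinct.\<close>

lemma cell_edges_disjoint:
  assumes "i < 3" "j < 3" "i \<noteq> j"
  shows "map_prod (F i) (F i) ` edges m
      \<inter> map_prod (F j) (F j) ` edges m = {}"
proof (rule equals0I)
  fix q assume "q \<in> map_prod (F i) (F i) ` edges m
      \<inter> map_prod (F j) (F j) ` edges m"
  note q = IntD1[OF this] IntD2[OF this]
    obtain a b where e1: "(a, b) \<in> edges m" "q = (F i a, F i b)"
      using q(1) by auto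
    obtain c d where e2: "(c, d) \<in> edges m" "q = (F j c, F j d)"
      using q(2) by auto
    have G: "a \<in> G" "b \<in> G" "c \<in> G" "d \<in> G" "a \<noteq> b"
      using edges_SG[OF e1(1)] edges_SG[OF e2(1)] by simp_all
    have "F i a = F j c" "F i b = F j d"
      using e1(2) e2(2) by simp_all
    then have "a = p j" "b = p j"
      using cells_meet[of i j a c] cells_meet[of i j b d] assms G by simp_all
    then show False using G by simp
qed

lemma graph_energy_Suc:
  "graph_energy p (Suc m) u v
     = (\<Sum>i<3. graph_energy p m (\<lambda>x. u (F i x)) (\<lambda>x. v (F i x)))"
proof -
  define f where "f = (\<lambda>(x, y). (u y - u x) * cnj (v y - v x))"
  define A where "A i = map_prod (F i) (F i) ` edges m" for i
  have "sum f (edges (Suc m)) = sum f (\<Union>i\<in>{..<3}. A i)"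
    by (simp only: edges_Suc A_def)
  also have "\<dots> = (\<Sum>i<3. sum f (A i))"
  proof (rule sum.UNION_disjoint)
    show "\<forall>i\<in>{..<3}. \<forall>j\<in>{..<3}. i \<noteq> j \<longrightarrow> A i \<inter> A j = {}"
      by (intro ballI impI) (simp only: A_def, rule cell_edges_disjoint, auto)
  qed (simp_all add: A_def)
  also have "\<dots> = (\<Sum>i<3. \<Sum>e\<in>edges m. f (map_prod (F i) (F i) e))"
    by (simp only: A_def sum_map_prod_contraction)
  finally show ?thesis
    unfolding graph_energy_eq f_def by (simp add: sum_distrib_left case_prod_unfold)
qed

lemma graph_energy_cong:
  assumes "\<And>x. x \<in> G \<Longrightarrow> u x = u' x" "\<And>x. x \<in> G \<Longrightarrow> v x = v' x"
  shows "graph_energy p m u v = graph_energy p m u' v'"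
  unfolding graph_energy_eq using edges_SG
  by (intro arg_cong2[of _ _ _ _ "(*)"] sum.cong) (auto simp: assms)

definition en :: "nat \<Rightarrow> (real^2 \<Rightarrow> complex) \<Rightarrow> (real^2 \<Rightarrow> complex) \<Rightarrow> complex" where
  "en m u v = (5/3) ^ m * graph_energy p m u v"

text \<open>The diagonal of the complex-valued \<open>en\<close> as a real number, so that order
  arguments apply.\<close>

definition enr :: "nat \<Rightarrow> (real^2 \<Rightarrow> complex) \<Rightarrow> real" where
  "enr m u = (5/3) ^ m * ((1/2) * (\<Sum>(x, y)\<in>edges m. (cmod (u y - u x))\<^sup>2))"

lemma en_self: "en m u u = of_real (enr m u)"
proof -
  have "(\<Sum>(x, y)\<in>edges m. (u y - u x) * cnj (u y - u x)) = of_real (\<Sum>(x, y)\<in>edges m. (cmod (u y - u x))\<^sup>2)"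
    unfolding of_real_sum case_prod_unfold by (intro sum.cong refl) (simp only: complex_norm_square)
  then show ?thesis unfolding en_def enr_def graph_energy_eq by simp
qed

lemma enr_nonneg: "0 \<le> enr m u"
  unfolding enr_def by (intro mult_nonneg_nonneg sum_nonneg) auto

lemma en_cong: "(\<And>x. x \<in> G \<Longrightarrow> u x = u' x) \<Longrightarrow> (\<And>x. x \<in> G \<Longrightarrow> v x = v' x) \<Longrightarrow> en m u v = en m u' v'"
  unfolding en_def using graph_energy_cong[of u u' v v' m] by simp

lemma en_cnj: "en m v u = cnj (en m u v)"
  unfolding en_def graph_energy_eq by (simp add: case_prod_unfold mult.commute)

lemma en_add_left: "en m (\<lambda>x. u x + u' x) v = en m u v + en m u' v"
proof -
  have "(\<Sum>(x, y)\<in>edges m. (u y + u' y - (u x + u' x)) * cnj (v y - v x))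
     = (\<Sum>(x, y)\<in>edges m. (u y - u x) * cnj (v y - v x)) + (\<Sum>(x, y)\<in>edges m. (u' y - u' x) * cnj (v y - v x))"
    unfolding sum.distrib[symmetric] case_prod_unfold by (intro sum.cong) (simp_all add: algebra_simps)
  then show ?thesis
    unfolding en_def graph_energy_eq by (simp add: distrib_left)
qed

lemma en_scale_left: "en m (\<lambda>x. c * u x) v = c * en m u v"
proof -
  have "(\<Sum>(x, y)\<in>edges m. (c * u y - c * u x) * cnj (v y - v x))
     = c * (\<Sum>(x, y)\<in>edges m. (u y - u x) * cnj (v y - v x))"
    unfolding sum_distrib_left case_prod_unfold by (intro sum.cong) (simp_all add: algebra_simps)
  then show ?thesis
    unfolding en_def graph_energy_eq by simp
qed

lemma en_add_right: "en m v (\<lambda>x. u x + u' x) = en m v u + en m v u'"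
  using en_add_left[of m u u' v] by (metis en_cnj complex_cnj_add)

lemma en_scale_right: "en m v (\<lambda>x. c * u x) = cnj c * en m v u"
  using en_scale_left[of m c u v] by (metis en_cnj complex_cnj_mult)

lemma enr_scale: "enr m (\<lambda>x. c * u x) = (cmod c)\<^sup>2 * enr m u"
proof -
  have "complex_of_real (enr m (\<lambda>x. c * u x)) = c * cnj c * enr m u"
    by (simp add: en_self[symmetric] en_scale_left en_scale_right)
  then have "complex_of_real (enr m (\<lambda>x. c * u x)) = complex_of_real ((cmod c)\<^sup>2 * enr m u)"
    by (simp add: complex_norm_square[symmetric])
  then show ?thesis by (simp only: of_real_eq_iff)
qed

lemma enr_parallelogram: "enr m (\<lambda>x. u x + v x) + enr m (\<lambda>x. u x + (-1) * v x) = 2 * enr m u + 2 * enr m v"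
proof -
  have "complex_of_real (enr m (\<lambda>x. u x + v x) + enr m (\<lambda>x. u x + (-1) * v x)) = complex_of_real (2 * enr m u + 2 * enr m v)"
    unfolding of_real_add of_real_mult en_self[symmetric] en_add_left en_add_right en_scale_left en_scale_right
    by simp
  then show ?thesis by (simp only: of_real_eq_iff)
qed

lemma enr_add_le: "enr m (\<lambda>x. u x + v x) \<le> 2 * enr m u + 2 * enr m v"
  using enr_parallelogram[of m u v] enr_nonneg[of m "\<lambda>x. u x + (-1) * v x"] by linarith

lemma enr_Suc: "enr (Suc m) u = (5/3) * (\<Sum>i<3. enr m (\<lambda>x. u (F i x)))"
proof -
  have "complex_of_real (enr (Suc m) u) = complex_of_real ((5/3) * (\<Sum>i<3. enr m (\<lambda>x. u (F i x))))"
    by (simp add: en_self[symmetric] en_def graph_energy_Suc sum_distrib_left mult.assoc)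
  then show ?thesis by (simp only: of_real_eq_iff)
qed

lemma enr_0: "enr 0 u = (cmod (u (p 1) - u (p 0)))\<^sup>2 + (cmod (u (p 2) - u (p 0)))\<^sup>2 + (cmod (u (p 2) - u (p 1)))\<^sup>2"
proof -
  have "p 0 \<noteq> p 1" "p 0 \<noteq> p 2" "p 1 \<noteq> p 2"
    using vertex_eq_iff[of 0 1] vertex_eq_iff[of 0 2] vertex_eq_iff[of 1 2] by auto
  then have "(\<Sum>(x, y)\<in>edges 0. (cmod (u y - u x))\<^sup>2) =
    (cmod (u (p 1) - u (p 0)))\<^sup>2 + (cmod (u (p 2) - u (p 0)))\<^sup>2 + (cmod (u (p 0) - u (p 1)))\<^sup>2
    + (cmod (u (p 2) - u (p 1)))\<^sup>2 + (cmod (u (p 0) - u (p 2)))\<^sup>2 + (cmod (u (p 1) - u (p 2)))\<^sup>2"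
    unfolding edges_0 by (simp add: eq_commute)
  then show ?thesis
    unfolding enr_def by (simp add: norm_minus_commute)
qed

text \<open>
  The sum of squares comes from the minimizing values
  \<open>x = (2a + 2b + c)/5\<close>, \<open>y = (a + 2b + 2c)/5\<close>, \<open>z = (2a + b + 2c)/5\<close>.
\<close>

lemma harmonic_extension_real:
  fixes a b c x y z :: real
  shows "(b - a)\<^sup>2 + (c - a)\<^sup>2 + (c - b)\<^sup>2 \<le> (5/3) * (((x - a)\<^sup>2 + (z - a)\<^sup>2 + (z - x)\<^sup>2)
     + ((b - x)\<^sup>2 + (y - x)\<^sup>2 + (y - b)\<^sup>2) + ((y - z)\<^sup>2 + (c - z)\<^sup>2 + (c - y)\<^sup>2))"
proof -
  define X Y Z where "X = 5 * x - (2*a + 2*b + c)" and "Y = 5 * y - (a + 2*b + 2*c)" and "Z = 5 * z - (2*a + b + 2*c)"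
  have "25 * (((x - a)\<^sup>2 + (z - a)\<^sup>2 + (z - x)\<^sup>2)
     + ((b - x)\<^sup>2 + (y - x)\<^sup>2 + (y - b)\<^sup>2) + ((y - z)\<^sup>2 + (c - z)\<^sup>2 + (c - y)\<^sup>2))
     = 15 * ((b - a)\<^sup>2 + (c - a)\<^sup>2 + (c - b)\<^sup>2)
       + ((X - Y)\<^sup>2 + (Y - Z)\<^sup>2 + (Z - X)\<^sup>2 + 2 * (X\<^sup>2 + Y\<^sup>2 + Z\<^sup>2))"
    unfolding X_def Y_def Z_def by algebra
  moreover have "0 \<le> (X - Y)\<^sup>2 + (Y - Z)\<^sup>2 + (Z - X)\<^sup>2 + 2 * (X\<^sup>2 + Y\<^sup>2 + Z\<^sup>2)" by simp
  moreover have "T \<le> (5/3) * S" if "25 * S = 15 * T + Q" "0 \<le> Q" for S T Q :: real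
    using that by simp
  ultimately show ?thesis by blast
qed

text \<open>The squared modulus splits into real and imaginary parts. Equality at the minimizing
  values is what fixes the renormalization factor 5/3.\<close>

lemma harmonic_extension:
  fixes a b c x y z :: complex
  shows "(cmod (b - a))\<^sup>2 + (cmod (c - a))\<^sup>2 + (cmod (c - b))\<^sup>2
     \<le> (5/3) * (((cmod (x - a))\<^sup>2 + (cmod (z - a))\<^sup>2 + (cmod (z - x))\<^sup>2)
     + ((cmod (b - x))\<^sup>2 + (cmod (y - x))\<^sup>2 + (cmod (y - b))\<^sup>2)
     + ((cmod (y - z))\<^sup>2 + (cmod (c - z))\<^sup>2 + (cmod (c - y))\<^sup>2))"
  using harmonic_extension_real[of "Re b" "Re a" "Re c" "Re x" "Re z" "Re y"]
    harmonic_extension_real[of "Im b" "Im a" "Im c" "Im x" "Im z" "Im y"]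
  by (simp add: cmod_power2)

text \<open>Self-similarity at both levels reduces the comparison to one subdivision of one
  triangle, which is \<open>harmonic_extension\<close>.\<close>

lemma enr_mono_Suc: "enr m u \<le> enr (Suc m) u"
proof (induction m arbitrary: u)
  case 0
  \<comment> \<open>Midpoints are shared by two cells, so the nine corners of the three cells reduce
    to the six values in \<open>harmonic_extension\<close>.\<close>
  note c = contraction_commute[of p 1 0] contraction_commute[of p 2 0] contraction_commute[of p 2 1]
  show ?case
    unfolding enr_Suc sum_less_3 enr_0 contraction_fixed c by (rule harmonic_extension)
next
  case (Suc m)
  show ?case
    unfolding enr_Suc[of "Suc m" u] enr_Suc[of m u] by (intro mult_left_mono sum_mono Suc) auto
qed

lemma incseq_enr: "incseq (\<lambda>m. enr m u)"
  by (intro incseq_SucI enr_mono_Suc)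

section \<open>The form domain and the sesquilinear energy\<close>

abbreviation dom :: "(real^2 \<Rightarrow> complex) set" where "dom \<equiv> energy_domain p"

lemma dom_iff: "u \<in> dom \<longleftrightarrow> continuous_on G u \<and> (\<exists>B. \<forall>m. enr m u \<le> B)"
proof -
  have "convergent (\<lambda>m. en m u u) \<longleftrightarrow> (\<exists>B. \<forall>m. enr m u \<le> B)"
  proof
    assume "convergent (\<lambda>m. en m u u)"
    then obtain l where "(\<lambda>m. en m u u) \<longlonglongrightarrow> l" by (auto simp: convergent_def)
    then have "(\<lambda>m. enr m u) \<longlonglongrightarrow> Re l" using tendsto_Re[of "\<lambda>m. en m u u"] by (simp add: en_self)
    then show "\<exists>B. \<forall>m. enr m u \<le> B" using incseq_le[OF incseq_enr] by blast
  next
    assume "\<exists>B. \<forall>m. enr m u \<le> B"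
    then obtain l where "(\<lambda>m. enr m u) \<longlonglongrightarrow> l" using incseq_convergent[OF incseq_enr] by blast
    then show "convergent (\<lambda>m. en m u u)"
      unfolding en_self convergent_def using tendsto_of_real by blast
  qed
  then show ?thesis by (simp add: energy_domain_def en_def)
qed

lemma domI: "continuous_on G u \<Longrightarrow> (\<And>m. enr m u \<le> B) \<Longrightarrow> u \<in> dom"
  by (auto simp: dom_iff)

lemma dom_continuous: "u \<in> dom \<Longrightarrow> continuous_on G u"
  by (simp add: dom_iff)

lemma dom_add: "u \<in> dom \<Longrightarrow> v \<in> dom \<Longrightarrow> (\<lambda>x. u x + v x) \<in> dom"
proof -
  assume u: "u \<in> dom" and v: "v \<in> dom"
  then obtain B C where BC: "\<And>m. enr m u \<le> B" "\<And>m. enr m v \<le> C" by (auto simp: dom_iff)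
  have "enr m (\<lambda>x. u x + v x) \<le> 2 * B + 2 * C" for m
    using enr_add_le[of m u v] BC[of m] by linarith
  then show ?thesis using u v by (auto simp: dom_iff intro!: continuous_intros)
qed

lemma dom_scale: "u \<in> dom \<Longrightarrow> (\<lambda>x. c * u x) \<in> dom"
proof -
  assume u: "u \<in> dom"
  then obtain B where "\<And>m. enr m u \<le> B" by (auto simp: dom_iff)
  then show ?thesis
    using u by (intro domI[of _ "(cmod c)\<^sup>2 * B"]) (auto simp: enr_scale dom_iff intro!: continuous_intros mult_left_mono)
qed

lemma dom_0: "(\<lambda>x. 0) \<in> dom"
  by (auto simp: dom_iff enr_def)

lemma dom_sum: "(\<And>i. i \<in> I \<Longrightarrow> f i \<in> dom) \<Longrightarrow> (\<lambda>x. \<Sum>i\<in>I. f i x) \<in> dom"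
proof (induction I rule: infinite_finite_induct)
  case (insert i I)
  then show ?case using dom_add[of "f i" "\<lambda>x. \<Sum>i\<in>I. f i x"] by simp
qed (simp_all add: dom_0)

text \<open>\<open>energy\<close> is a \<open>lim\<close> and carries information only once
  convergence is known. The definition of the domain gives convergence on the diagonal; polarization
  extends it to pairs.\<close>

lemma energy_tendsto:
  assumes "u \<in> dom" "v \<in> dom"
  shows "(\<lambda>m. en m u v) \<longlonglongrightarrow> energy p u v"
proof -
  have conv: "convergent (\<lambda>m. en m f f)" if "f \<in> dom" for f
    using that by (simp add: energy_domain_def en_def)
  have pol: "en m u v = (1/4) * (en m (\<lambda>x. u x + 1 * v x) (\<lambda>x. u x + 1 * v x) - en m (\<lambda>x. u x + (-1) * v x) (\<lambda>x. u x + (-1) * v x)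
      + (\<i> * en m (\<lambda>x. u x + \<i> * v x) (\<lambda>x. u x + \<i> * v x)
      - \<i> * en m (\<lambda>x. u x + (-\<i>) * v x) (\<lambda>x. u x + (-\<i>) * v x)))" for m
    unfolding en_add_left en_add_right en_scale_left en_scale_right by (simp add: algebra_simps)
  have "convergent (\<lambda>m. en m u v)"
    unfolding pol using assms
    by (intro convergent_mult convergent_add convergent_diff convergent_const conv dom_add dom_scale)
  then show ?thesis
    unfolding energy_def en_def by (simp add: convergent_LIMSEQ_iff)
qed

lemma energy_add_left:
  assumes "u \<in> dom" "u' \<in> dom" "v \<in> dom"
  shows "energy p (\<lambda>x. u x + u' x) v = energy p u v + energy p u' v"
proof (rule LIMSEQ_unique)
  show "(\<lambda>m. en m (\<lambda>x. u x + u' x) v) \<longlonglongrightarrow> energy p (\<lambda>x. u x + u' x) v"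
    using assms by (intro energy_tendsto dom_add)
  show "(\<lambda>m. en m (\<lambda>x. u x + u' x) v) \<longlonglongrightarrow> energy p u v + energy p u' v"
    unfolding en_add_left using assms by (intro tendsto_intros energy_tendsto)
qed

lemma energy_scale_left:
  assumes "u \<in> dom" "v \<in> dom"
  shows "energy p (\<lambda>x. c * u x) v = c * energy p u v"
proof (rule LIMSEQ_unique)
  show "(\<lambda>m. en m (\<lambda>x. c * u x) v) \<longlonglongrightarrow> energy p (\<lambda>x. c * u x) v"
    using assms by (intro energy_tendsto dom_scale)
  show "(\<lambda>m. en m (\<lambda>x. c * u x) v) \<longlonglongrightarrow> c * energy p u v"
    unfolding en_scale_left using assms by (intro tendsto_intros energy_tendsto)
qed

lemma energy_cnj:
  assumes "u \<in> dom" "v \<in> dom"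
  shows "energy p v u = cnj (energy p u v)"
proof (rule LIMSEQ_unique)
  show "(\<lambda>m. en m v u) \<longlonglongrightarrow> energy p v u" using assms by (intro energy_tendsto)
  show "(\<lambda>m. en m v u) \<longlonglongrightarrow> cnj (energy p u v)"
    unfolding en_cnj[of _ v u] using assms by (intro tendsto_intros energy_tendsto)
qed

lemma energy_sum_left:
  assumes "\<And>i. i \<in> I \<Longrightarrow> f i \<in> dom" "v \<in> dom"
  shows "energy p (\<lambda>x. \<Sum>i\<in>I. f i x) v = (\<Sum>i\<in>I. energy p (f i) v)"
  using assms(1)
proof (induction I rule: infinite_finite_induct)
  case (insert i I)
  then show ?case using energy_add_left[of "f i" "\<lambda>x. \<Sum>i\<in>I. f i x" v] dom_sum[of I f] assms by simp
qed (use energy_scale_left[of "\<lambda>x. 0" v 0] dom_0 assms in \<open>simp_all\<close>)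

lemma energy_sum_right:
  assumes "\<And>i. i \<in> I \<Longrightarrow> f i \<in> dom" "v \<in> dom"
  shows "energy p v (\<lambda>x. \<Sum>i\<in>I. f i x) = (\<Sum>i\<in>I. energy p v (f i))"
proof -
  have "energy p v (\<lambda>x. \<Sum>i\<in>I. f i x) = cnj (energy p (\<lambda>x. \<Sum>i\<in>I. f i x) v)"
    using assms by (intro energy_cnj dom_sum)
  also have "\<dots> = (\<Sum>i\<in>I. cnj (energy p (f i) v))"
    using assms by (simp add: energy_sum_left)
  also have "\<dots> = (\<Sum>i\<in>I. energy p v (f i))"
    using assms by (intro sum.cong refl energy_cnj[symmetric])
  finally show ?thesis .
qed

lemma energy_scale_right: "u \<in> dom \<Longrightarrow> v \<in> dom \<Longrightarrow> energy p v (\<lambda>x. c * u x) = cnj c * energy p v u"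
  using energy_scale_left[of u v c] energy_cnj[of "\<lambda>x. c * u x" v] energy_cnj[of u v] dom_scale[of u c] by simp

lemma enr_tendsto: "u \<in> dom \<Longrightarrow> (\<lambda>m. enr m u) \<longlonglongrightarrow> Re (energy p u u)"
  using tendsto_Re[OF energy_tendsto, of u u] by (simp add: en_self)

lemma enr_le_energy: "u \<in> dom \<Longrightarrow> enr m u \<le> Re (energy p u u)"
  using incseq_le[OF incseq_enr enr_tendsto] by blast

lemma energy_nonneg: "u \<in> dom \<Longrightarrow> 0 \<le> Re (energy p u u)"
  using enr_le_energy[of u 0] enr_nonneg[of 0 u] by linarith

lemma energy_le: "u \<in> dom \<Longrightarrow> (\<And>m. enr m u \<le> B) \<Longrightarrow> Re (energy p u u) \<le> B"
  by (rule LIMSEQ_le_const2[OF enr_tendsto]) auto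

text \<open>Graph energies see only differences of values. This carries energy bounds through the
  nonlinearity, which is Lipschitz on bounded sets.\<close>

lemma enr_lipschitz:
  assumes "\<And>x y. x \<in> G \<Longrightarrow> y \<in> G \<Longrightarrow> cmod (f x - f y) \<le> L * cmod (u x - u y)"
  shows "enr m f \<le> L\<^sup>2 * enr m u"
proof -
  have "(\<Sum>(x, y)\<in>edges m. (cmod (f y - f x))\<^sup>2) \<le> (\<Sum>(x, y)\<in>edges m. L\<^sup>2 * (cmod (u y - u x))\<^sup>2)"
  proof (rule sum_mono, clarify)
    fix x y assume "(x, y) \<in> edges m"
    then have "x \<in> G" "y \<in> G" using edges_SG[of x y m] by auto
    then have "(cmod (f y - f x))\<^sup>2 \<le> (L * cmod (u y - u x))\<^sup>2"
      using assms by (intro power_mono) auto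
    then show "(cmod (f y - f x))\<^sup>2 \<le> L\<^sup>2 * (cmod (u y - u x))\<^sup>2" by (simp add: power_mult_distrib)
  qed
  also have "\<dots> = L\<^sup>2 * (\<Sum>(x, y)\<in>edges m. (cmod (u y - u x))\<^sup>2)"
    by (simp add: sum_distrib_left case_prod_unfold)
  finally show ?thesis
    unfolding enr_def by (simp add: field_simps)
qed

section \<open>Oscillation of functions of finite energy\<close>

lemma enr_contraction_le: "i < 3 \<Longrightarrow> enr m (\<lambda>x. u (F i x)) \<le> (3/5) * enr (Suc m) u"
  using member_le_sum[of i "{..<3}" "\<lambda>i. enr m (\<lambda>x. u (F i x))"] enr_nonneg
  by (simp add: enr_Suc)

lemma dom_contraction: "u \<in> dom \<Longrightarrow> i < 3 \<Longrightarrow> (\<lambda>x. u (F i x)) \<in> dom"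
proof -
  assume u: "u \<in> dom" and i: "i < 3"
  obtain B where B: "\<And>m. enr m u \<le> B" using u by (auto simp: dom_iff)
  have "enr m (\<lambda>x. u (F i x)) \<le> (3/5) * B" for m
    using enr_contraction_le[OF i, of m u] B[of "Suc m"] by linarith
  moreover have "continuous_on G (\<lambda>x. u (F i x))"
    using i by (intro continuous_on_compose2[OF dom_continuous[OF u]] continuous_intros) auto
  ultimately show ?thesis by (rule domI[rotated])
qed

lemma enr_0_edge_le:
  assumes "i < 3" "j < 3" shows "(cmod (u (p i) - u (p j)))\<^sup>2 \<le> enr 0 u"
  using assms unfolding less_3_cases by (elim disjE) (auto simp: enr_0 norm_minus_commute)

text \<open>
  Restriction to a cell multiplies the square root of the energy by at most
  \<open>sqrt (3/5) < 31/40\<close>, and \<open>10 * (31/40) + 1 \<le> 10\<close> closes the recursion.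
\<close>

lemma osc_vertices:
  assumes "0 \<le> B" "\<And>m. enr m u \<le> B\<^sup>2" "i < 3" "j < 3" "w \<in> words m"
  shows "cmod (u (Fw w (p j)) - u (p i)) \<le> 10 * B"
  using assms
proof (induction m arbitrary: u B w i)
  case 0
  then have "(cmod (u (p j) - u (p i)))\<^sup>2 \<le> B\<^sup>2"
    using enr_0_edge_le[of j i u] by (metis order_trans)
  then have "cmod (u (p j) - u (p i)) \<le> B" using 0(1) by (rule power2_le_imp_le)
  then show ?case using 0 by auto
next
  case (Suc m)
  obtain l v where w: "w = l # v" "l < 3" "v \<in> words m" using Suc.prems by (auto simp: words_Suc)
  have "enr m' (\<lambda>x. u (F l x)) \<le> ((31/40) * B)\<^sup>2" for m'
  proof -
    have "((31/40) * B)\<^sup>2 = (961/1600) * B\<^sup>2" by (simp add: power2_eq_square)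
    then show ?thesis
      using enr_contraction_le[OF w(2), of m' u] Suc.prems(2)[of "Suc m'"] zero_le_power2[of B] by linarith
  qed
  \<comment> \<open>\<open>p l\<close> is fixed by \<open>F l\<close>, so it is a corner both of the
    cell and of the whole triangle: the path runs inside the cell to \<open>p l\<close> and then
    along one edge to \<open>p i\<close>.\<close>
  then have 1: "cmod (u (F l (Fw v (p j))) - u (F l (p l))) \<le> 10 * ((31/40) * B)"
    using Suc.prems w by (intro Suc.IH[of "(31/40) * B" "\<lambda>x. u (F l x)"]) auto
  have "(cmod (u (p l) - u (p i)))\<^sup>2 \<le> B\<^sup>2"
    using enr_0_edge_le[of l i u] Suc.prems w by (metis order_trans)
  then have 2: "cmod (u (p l) - u (p i)) \<le> B" using Suc.prems(1) by (rule power2_le_imp_le)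
  have "cmod (u (Fw w (p j)) - u (p i)) \<le> cmod (u (Fw w (p j)) - u (p l)) + cmod (u (p l) - u (p i))"
    using norm_triangle_ineq[of "u (Fw w (p j)) - u (p l)" "u (p l) - u (p i)"] by simp
  then show ?case using 1 2 w Suc.prems(1) by simp
qed

text \<open>Corners of ever smaller cells containing \<open>x\<close> converge to \<open>x\<close>,
  and \<open>osc_vertices\<close> bounds the values there independently of the depth. On the gasket
  the energy thus controls the oscillation, as in dimension one.\<close>

lemma osc_SG:
  assumes "continuous_on G u" "0 \<le> B" "\<And>m. enr m u \<le> B\<^sup>2" "x \<in> G"
  shows "cmod (u x - u (p 0)) \<le> 10 * B"
proof -
  have "\<forall>m. \<exists>w\<in>words m. x \<in> Fw w ` G" using SG_cells assms(4) by blast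
  then obtain W where W: "\<And>m. W m \<in> words m" "\<And>m. x \<in> Fw (W m) ` G" by metis
  define y where "y m = Fw (W m) (p 0)" for m
  obtain D where D: "\<And>a b. a \<in> G \<Longrightarrow> b \<in> G \<Longrightarrow> dist a b \<le> D"
    using compact_imp_bounded[OF SG_props(1)] unfolding bounded_two_points by auto
  have yG: "y m \<in> G" for m using W(1)[of m] by (auto simp: y_def)
  have d1: "dist (y m) x \<le> D / 2 ^ m" for m
  proof -
    obtain a where a: "a \<in> G" "x = Fw (W m) a" using W(2)[of m] by auto
    have "dist (y m) x = dist (p 0) a / 2 ^ m"
      using W(1)[of m] by (simp add: y_def a dist_cell_map words_def)
    then show ?thesis using D[of "p 0" a] a by (simp add: divide_right_mono)
  qed
  have d2: "(\<lambda>m. D / 2 ^ m) \<longlonglongrightarrow> 0"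
    using tendsto_mult[OF tendsto_const LIMSEQ_realpow_zero[of "1/2"], of D] by (simp add: power_divide)
  have "(\<lambda>m. dist (y m) x) \<longlonglongrightarrow> 0"
    by (rule tendsto_sandwich[OF _ _ tendsto_const d2]) (simp_all add: d1)
  then have "y \<longlonglongrightarrow> x" by (simp only: tendsto_dist_iff[of y x])
  then have "(\<lambda>m. u (y m)) \<longlonglongrightarrow> u x"
    by (intro continuous_on_tendsto_compose[OF assms(1)]) (auto simp: assms yG)
  then have "(\<lambda>m. cmod (u (y m) - u (p 0))) \<longlonglongrightarrow> cmod (u x - u (p 0))"
    by (intro tendsto_intros)
  moreover have "cmod (u (y m) - u (p 0)) \<le> 10 * B" for m
    unfolding y_def using assms(2,3) W(1) by (intro osc_vertices) simp_all
  ultimately show ?thesis by (intro LIMSEQ_le_const2) blast+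
qed

section \<open>Invariance of the energy under the symmetries\<close>

lemma edges_perm:
  assumes "\<sigma> permutes {..<3}" "(x, y) \<in> edges m"
  shows "(perm_map \<sigma> x, perm_map \<sigma> y) \<in> edges m"
proof -
  obtain w i j where w: "w \<in> words m" "x = Fw w (p i)" "y = Fw w (p j)" "i < 3" "j < 3" "x \<noteq> y"
    using assms(2) by (auto simp: edges_def adj_def V0_eq)
  have "x \<in> tri" "y \<in> tri" using edges_SG[OF assms(2)] by (auto intro: SG_tri)
  then have "perm_map \<sigma> x \<noteq> perm_map \<sigma> y" using perm_map_inv(1)[OF assms(1)] w(6) by metis
  moreover have "map \<sigma> w \<in> words m"
    using w(1) permutes_less_3[OF assms(1)] by (simp add: words_iff)
  moreover have "perm_map \<sigma> x = Fw (map \<sigma> w) (p (\<sigma> i))" "perm_map \<sigma> y = Fw (map \<sigma> w) (p (\<sigma> j))"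
    using w assms(1) by (simp_all add: perm_map_cell_map perm_map_vertex)
  moreover have "\<sigma> i < 3" "\<sigma> j < 3" using w assms by auto
  ultimately show ?thesis by (auto simp: edges_def adj_def V0_eq)
qed

lemma en_perm:
  assumes "\<sigma> permutes {..<3}"
  shows "en m (\<lambda>x. u (perm_map \<sigma> x)) v = en m u (\<lambda>x. v (perm_map (inv \<sigma>) x))"
proof -
  have inv: "inv \<sigma> permutes {..<3}" using assms by (rule permutes_inv)
  have tri: "x \<in> tri" "y \<in> tri" if "(x, y) \<in> edges m" for x y
    using edges_SG[OF that] SG_tri by auto
  have "(\<Sum>(x, y)\<in>edges m. (u (perm_map \<sigma> y) - u (perm_map \<sigma> x)) * cnj (v y - v x))
    = (\<Sum>(x, y)\<in>edges m. (u y - u x) * cnj (v (perm_map (inv \<sigma>) y) - v (perm_map (inv \<sigma>) x)))"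
    by (rule sum.reindex_bij_witness[where i = "map_prod (perm_map (inv \<sigma>)) (perm_map (inv \<sigma>))"
          and j = "map_prod (perm_map \<sigma>) (perm_map \<sigma>)"])
      (use tri edges_perm[OF assms] edges_perm[OF inv] perm_map_inv[OF assms] in force)+
  then show ?thesis by (simp add: en_def graph_energy_eq)
qed

lemma enr_perm: "\<sigma> permutes {..<3} \<Longrightarrow> enr m (\<lambda>x. u (perm_map \<sigma> x)) = enr m u"
proof -
  assume \<sigma>: "\<sigma> permutes {..<3}"
  have "en m (\<lambda>x. u (perm_map \<sigma> x)) (\<lambda>x. u (perm_map \<sigma> x)) = en m u (\<lambda>x. u (perm_map \<sigma> (perm_map (inv \<sigma>) x)))"
    using \<sigma> by (rule en_perm)
  also have "\<dots> = en m u u" by (intro en_cong) (auto simp: perm_map_inv[OF \<sigma>] SG_tri)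
  finally show ?thesis by (simp add: en_self)
qed

lemma dom_perm: "\<sigma> permutes {..<3} \<Longrightarrow> u \<in> dom \<Longrightarrow> (\<lambda>x. u (perm_map \<sigma> x)) \<in> dom"
  unfolding dom_iff by (auto simp: enr_perm intro!: continuous_intros continuous_on_compose2[of G u])

lemma energy_perm:
  assumes "\<sigma> permutes {..<3}"
  shows "energy p (\<lambda>x. u (perm_map \<sigma> x)) v = energy p u (\<lambda>x. v (perm_map (inv \<sigma>) x))"
  unfolding energy_def using en_perm[OF assms, of _ u v] by (simp add: en_def)

end

section \<open>The self-similar measure\<close>

locale gasket = triangle p for p :: "nat \<Rightarrow> real^2" +
  fixes \<nu> :: "(real^2) measure"
  assumes gasket_measure: "gasket_measure p \<nu>"
begin

lemma sets_nu: "sets \<nu> = sets (restrict_space borel G)"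
  using gasket_measure by (simp add: gasket_measure_def)

lemma space_nu [simp]: "space \<nu> = G"
  using sets_eq_imp_space_eq[OF sets_nu] by (simp add: space_restrict_space)

lemma emeasure_cell: "w \<in> words m \<Longrightarrow> emeasure \<nu> (Fw w ` G) = ennreal ((1/3) ^ m)"
  using gasket_measure by (simp add: gasket_measure_def)

lemma measure_cell: "w \<in> words m \<Longrightarrow> measure \<nu> (Fw w ` G) = (1/3) ^ m"
  using emeasure_cell[of w m] by (simp add: measure_def)

lemma emeasure_space_nu: "emeasure \<nu> G = 1"
  using emeasure_cell[of "[]" 0] by simp

sublocale nu: finite_measure \<nu>
  by standard (simp add: emeasure_space_nu)

lemma measure_space_nu [simp]: "measure \<nu> G = 1"
  by (simp add: measure_def emeasure_space_nu)

lemma continuous_cell_map: "continuous_on S (Fw w)"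
proof -
  have "dist (Fw w x) (Fw w y) \<le> 1 * dist x y" for x y
    using mult_left_mono[of 1 "2 ^ length w" "dist x y"]
    by (simp add: dist_cell_map divide_le_eq)
  then have "1-lipschitz_on S (Fw w)"
    by (intro lipschitz_onI) auto
  then show ?thesis by (rule lipschitz_on_continuous_on)
qed

lemma cell_subset: "w \<in> words m \<Longrightarrow> Fw w ` G \<subseteq> G"
  by auto

lemma cell_measurable [measurable]: "w \<in> words m \<Longrightarrow> Fw w ` G \<in> sets \<nu>"
proof -
  assume w: "w \<in> words m"
  have "compact (Fw w ` G)"
    by (intro compact_continuous_image continuous_cell_map SG_props)
  then have "Fw w ` G \<in> sets borel"
    by (intro borel_closed compact_imp_closed)
  then show ?thesis
    using cell_subset[OF w] unfolding sets_nu sets_restrict_space by (auto simp: image_iff Int_absorb1)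
qed

section \<open>Integrals of continuous functions as limits of cell sums\<close>

lemma continuous_measurable:
  fixes f :: "real^2 \<Rightarrow> 'b::topological_space"
  shows "continuous_on G f \<Longrightarrow> f \<in> borel_measurable \<nu>"
  using borel_measurable_continuous_on_restrict[of G f] measurable_cong_sets[OF sets_nu refl] by blast

lemma continuous_bounded:
  fixes f :: "real^2 \<Rightarrow> 'b::real_normed_vector"
  assumes "continuous_on G f" obtains B where "0 < B" "\<And>x. x \<in> G \<Longrightarrow> norm (f x) \<le> B"
proof -
  have "bounded (f ` G)" using assms SG_props by (intro compact_imp_bounded compact_continuous_image)
  then show ?thesis using that by (auto simp: bounded_pos)
qed

lemma continuous_integrable:
  fixes f :: "real^2 \<Rightarrow> 'b::{banach, second_countable_topology}"
  assumes "continuous_on G f" shows "integrable \<nu> f"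
proof -
  obtain B where "\<And>x. x \<in> G \<Longrightarrow> norm (f x) \<le> B" using continuous_bounded[OF assms] by metis
  then show ?thesis
    using continuous_measurable[OF assms] by (intro nu.integrable_const_bound[of _ B] AE_I2) auto
qed

text \<open>The counting function is at least 1 because the cells cover the gasket, and its integral
  is \<open>3 ^ m\<close> times \<open>(1/3) ^ m\<close>, which is the total mass. Hence it equals 1
  almost everywhere, and overlaps of cells are null.\<close>

lemma cells_cover_once: "AE x in \<nu>. (\<Sum>w\<in>words m. indicat_real (Fw w ` G) x) = 1"
proof -
  define c where "c x = (\<Sum>w\<in>words m. indicat_real (Fw w ` G) x)" for x
  have int: "integrable \<nu> c"
    unfolding c_def by (intro Bochner_Integration.integrable_sum integrable_real_indicator) (auto simp: emeasure_cell)
  have "integral\<^sup>L \<nu> c = (\<Sum>w\<in>words m. measure \<nu> (Fw w ` G))"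
    unfolding c_def
    by (subst Bochner_Integration.integral_sum)
      (auto intro!: integrable_real_indicator sum.cong simp: emeasure_cell cell_subset Int_absorb2)
  also have "\<dots> = 1" by (simp add: measure_cell card_words power_divide)
  finally have "(LINT x|\<nu>. c x - 1) = 0" using int by simp
  moreover have "1 \<le> c x" if x: "x \<in> G" for x
  proof -
    obtain w where "w \<in> words m" "x \<in> Fw w ` G" using equalityD1[OF SG_cells[of m]] x by blast
    then show ?thesis
      unfolding c_def using member_le_sum[of w "words m" "\<lambda>w. indicat_real (Fw w ` G) x"] by simp
  qed
  ultimately have "AE x in \<nu>. c x - 1 = 0"
    using int by (subst integral_nonneg_eq_0_iff_AE[symmetric]) (auto intro!: AE_I2)
  then show ?thesis unfolding c_def by simp
qed

text \<open>The measure is prescribed on cells only, and this is how integrals are computed from it.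
  The sample point \<open>q\<close> is left free because a symmetry moves it.\<close>

lemma riemann_sum:
  fixes f :: "real^2 \<Rightarrow> 'b::{banach, second_countable_topology}"
  assumes f: "continuous_on G f" and q: "q \<in> G"
  shows "(\<lambda>m. (1/3) ^ m *\<^sub>R (\<Sum>w\<in>words m. f (Fw w q))) \<longlonglongrightarrow> integral\<^sup>L \<nu> f"
proof (rule LIMSEQ_I)
  let ?I = "\<lambda>w. indicat_real (Fw w ` G)"
  fix e :: real assume e: "e > 0"
  have "uniformly_continuous_on G f"
    using f SG_props by (intro compact_uniformly_continuous)
  then obtain d where d: "d > 0" "\<And>x y. x \<in> G \<Longrightarrow> y \<in> G \<Longrightarrow> dist x y < d \<Longrightarrow> dist (f x) (f y) < e/2"
    unfolding uniformly_continuous_on_def using e by (meson half_gt_zero dist_commute)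
  obtain D where D: "\<And>a b. a \<in> G \<Longrightarrow> b \<in> G \<Longrightarrow> dist a b \<le> D"
    using compact_imp_bounded[OF SG_props(1)] unfolding bounded_two_points by auto
  obtain N where N: "D / d < 2 ^ N" using real_arch_pow[of 2 "D / d"] by auto
  have "norm ((1/3) ^ m *\<^sub>R (\<Sum>w\<in>words m. f (Fw w q)) - integral\<^sup>L \<nu> f) < e" if "m \<ge> N" for m
  proof -
    have osc: "norm (f x - f (Fw w q)) \<le> e/2" if w: "w \<in> words m" and x: "x \<in> Fw w ` G" for w x
    proof -
      obtain y where y: "y \<in> G" "x = Fw w y" using x by auto
      have "dist x (Fw w q) = dist y q / 2 ^ m"
        using w by (simp add: y dist_cell_map words_def)
      also have "\<dots> \<le> D / 2 ^ m" using D[OF y(1) q] by (simp add: divide_right_mono)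
      also have "\<dots> < d"
      proof -
        have "(2::real) ^ N \<le> 2 ^ m" using \<open>m \<ge> N\<close> by (intro power_increasing) auto
        then have "D / d < 2 ^ m" using N by linarith
        then show ?thesis using d(1) by (simp add: field_simps)
      qed
      finally show ?thesis
        using d(2)[of x "Fw w q"] w q y(1) unfolding y(2) dist_norm by (auto intro!: less_imp_le)
    qed
    have i1: "integrable \<nu> (\<lambda>x. ?I w x *\<^sub>R f x)" if "w \<in> words m" for w
      using continuous_integrable[OF f] that by (intro integrable_mult_indicator) auto
    have i2: "integrable \<nu> (\<lambda>x. ?I w x *\<^sub>R f (Fw w q))" if "w \<in> words m" for w
      using that by (intro integrable_scaleR_left integrable_real_indicator) (auto simp: emeasure_cell)
    have "integral\<^sup>L \<nu> f = (LINT x|\<nu>. (\<Sum>w\<in>words m. ?I w x *\<^sub>R f x))"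
    proof (rule integral_cong_AE)
      show "AE x in \<nu>. f x = (\<Sum>w\<in>words m. ?I w x *\<^sub>R f x)"
        using cells_cover_once[of m] by eventually_elim (simp add: scaleR_sum_left[symmetric])
      show "(\<lambda>x. \<Sum>w\<in>words m. ?I w x *\<^sub>R f x) \<in> borel_measurable \<nu>"
        by (intro borel_measurable_sum borel_measurable_integrable[OF i1])
    qed (rule continuous_measurable[OF f])
    also have "\<dots> = (\<Sum>w\<in>words m. LINT x|\<nu>. ?I w x *\<^sub>R f x)"
      using i1 by (intro Bochner_Integration.integral_sum)
    finally have 1: "integral\<^sup>L \<nu> f = (\<Sum>w\<in>words m. LINT x|\<nu>. ?I w x *\<^sub>R f x)" .
    have 2: "(1/3) ^ m *\<^sub>R (\<Sum>w\<in>words m. f (Fw w q))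
      = (\<Sum>w\<in>words m. LINT x|\<nu>. ?I w x *\<^sub>R f (Fw w q))"
      unfolding scaleR_sum_right
    proof (rule sum.cong[OF refl])
      fix w assume w: "w \<in> words m"
      have "(LINT x|\<nu>. ?I w x *\<^sub>R f (Fw w q))
        = (LINT x|\<nu>. ?I w x) *\<^sub>R f (Fw w q)"
        using w by (intro integral_scaleR_left integrable_real_indicator) (auto simp: emeasure_cell)
      then show "(1/3) ^ m *\<^sub>R f (Fw w q) = (LINT x|\<nu>. ?I w x *\<^sub>R f (Fw w q))"
        using w cell_subset[OF w] by (simp add: measure_cell Int_absorb2)
    qed
    have "norm ((LINT x|\<nu>. ?I w x *\<^sub>R f (Fw w q))
        - (LINT x|\<nu>. ?I w x *\<^sub>R f x)) \<le> (1/3) ^ m * (e/2)" if w: "w \<in> words m" for w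
    proof -
      have "norm ((LINT x|\<nu>. ?I w x *\<^sub>R f (Fw w q))
        - (LINT x|\<nu>. ?I w x *\<^sub>R f x))
        = norm (LINT x|\<nu>. ?I w x *\<^sub>R f (Fw w q) - ?I w x *\<^sub>R f x)"
        using i1[OF w] i2[OF w] by simp
      also have "\<dots> \<le> (LINT x|\<nu>. ?I w x * (e/2))"
      proof (rule Bochner_Integration.integral_norm_bound_integral)
        show "integrable \<nu> (\<lambda>x. ?I w x *\<^sub>R f (Fw w q) - ?I w x *\<^sub>R f x)"
          using i1[OF w] i2[OF w] by simp
        show "integrable \<nu> (\<lambda>x. ?I w x * (e / 2))"
          using w by (intro integrable_mult_left integrable_real_indicator) (auto simp: emeasure_cell)
        show "norm (?I w x *\<^sub>R f (Fw w q) - ?I w x *\<^sub>R f x)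
            \<le> ?I w x * (e / 2)" for x
          using osc[OF w, of x] by (cases "x \<in> Fw w ` G") (simp_all add: norm_minus_commute)
      qed
      also have "\<dots> = (LINT x|\<nu>. ?I w x) * (e/2)"
        by (rule integral_mult_left_zero)
      also have "\<dots> = (1/3) ^ m * (e/2)"
        using w cell_subset[OF w] by (simp add: measure_cell Int_absorb2)
      finally show ?thesis .
    qed
    then have "norm ((1/3) ^ m *\<^sub>R (\<Sum>w\<in>words m. f (Fw w q)) - integral\<^sup>L \<nu> f) \<le> (\<Sum>w\<in>words m. (1/3) ^ m * (e/2))"
      unfolding 1 2 sum_subtractf[symmetric] by (intro sum_norm_le)
    also have "\<dots> = e/2" by (simp add: card_words power_divide)
    also have "\<dots> < e" using e by simp
    finally show ?thesis .
  qed
  then show "\<exists>N. \<forall>m\<ge>N. norm ((1/3) ^ m *\<^sub>R (\<Sum>w\<in>words m. f (Fw w q)) - integral\<^sup>L \<nu> f) < e"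
    by blast
qed

text \<open>Splitting off the first letter of each word regroups the sum at level
  \<open>m + 1\<close> into three sums at level \<open>m\<close>.\<close>

lemma integral_self_similar:
  fixes f :: "real^2 \<Rightarrow> 'b::{banach, second_countable_topology}"
  assumes f: "continuous_on G f"
  shows "integral\<^sup>L \<nu> f = (1/3) *\<^sub>R (\<Sum>i<3. LINT x|\<nu>. f (F i x))"
proof (rule LIMSEQ_unique)
  show "(\<lambda>m. (1/3) ^ Suc m *\<^sub>R (\<Sum>w\<in>words (Suc m). f (Fw w (p 0)))) \<longlonglongrightarrow> integral\<^sup>L \<nu> f"
    using riemann_sum[OF f vertex_SG[of 0]] by (intro LIMSEQ_Suc) auto
  have "(\<lambda>m. (1/3) *\<^sub>R (\<Sum>i<3. (1/3) ^ m *\<^sub>R (\<Sum>w\<in>words m. f (F i (Fw w (p 0))))))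
     \<longlonglongrightarrow> (1/3) *\<^sub>R (\<Sum>i<3. LINT x|\<nu>. f (F i x))"
    by (intro tendsto_intros riemann_sum continuous_on_compose2[OF f] continuous_intros) auto
  then show "(\<lambda>m. (1/3) ^ Suc m *\<^sub>R (\<Sum>w\<in>words (Suc m). f (Fw w (p 0))))
     \<longlonglongrightarrow> (1/3) *\<^sub>R (\<Sum>i<3. LINT x|\<nu>. f (F i x))"
    by (simp add: sum_words_Suc scaleR_sum_right)
qed

text \<open>A symmetry permutes the words of length \<open>m\<close> and moves the sample point
  \<open>p 0\<close> to \<open>p (\<sigma> 0)\<close>; the limit is the same for both sample
  points.\<close>

lemma integral_perm:
  fixes f :: "real^2 \<Rightarrow> 'b::{banach, second_countable_topology}"
  assumes f: "continuous_on G f" and \<sigma>: "\<sigma> permutes {..<3}"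
  shows "(LINT x|\<nu>. f (perm_map \<sigma> x)) = integral\<^sup>L \<nu> f"
proof (rule LIMSEQ_unique)
  have "(\<lambda>m. (1/3) ^ m *\<^sub>R (\<Sum>w\<in>words m. f (perm_map \<sigma> (Fw w (p 0)))))
     \<longlonglongrightarrow> (LINT x|\<nu>. f (perm_map \<sigma> x))"
    using \<sigma> by (intro riemann_sum continuous_on_compose2[OF f] continuous_intros) auto
  moreover have "(\<Sum>w\<in>words m. f (perm_map \<sigma> (Fw w (p 0)))) = (\<Sum>w\<in>words m. f (Fw w (p (\<sigma> 0))))" for m
  proof (rule sum.reindex_bij_witness[where i = "map (inv \<sigma>)" and j = "map \<sigma>"])
    show "map \<sigma> w \<in> words m" if "w \<in> words m" for w
      using that permutes_less_3[OF \<sigma>] by (simp add: words_iff)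
    show "map (inv \<sigma>) w \<in> words m" if "w \<in> words m" for w
      using that permutes_less_3[OF permutes_inv[OF \<sigma>]] by (simp add: words_iff)
    show "f (Fw (map \<sigma> w) (p (\<sigma> 0))) = f (perm_map \<sigma> (Fw w (p 0)))" if "w \<in> words m" for w
      using that by (simp add: perm_map_cell_map[OF \<sigma>] perm_map_vertex)
  qed (simp_all add: permutes_inv_o[OF \<sigma>])
  ultimately show "(\<lambda>m. (1/3) ^ m *\<^sub>R (\<Sum>w\<in>words m. f (Fw w (p (\<sigma> 0))))) \<longlonglongrightarrow> (LINT x|\<nu>. f (perm_map \<sigma> x))"
    by simp
  show "(\<lambda>m. (1/3) ^ m *\<^sub>R (\<Sum>w\<in>words m. f (Fw w (p (\<sigma> 0))))) \<longlonglongrightarrow> integral\<^sup>L \<nu> f"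
    using \<sigma> by (intro riemann_sum f) auto
qed

text \<open>The measure has full support: a small cell around a point where \<open>f\<close> is
  nonzero has positive mass.\<close>

lemma continuous_AE_zero:
  fixes f :: "real^2 \<Rightarrow> 'b::real_normed_vector"
  assumes f: "continuous_on G f" and ae: "AE x in \<nu>. f x = 0" and x: "x \<in> G"
  shows "f x = 0"
proof (rule ccontr)
  assume "f x \<noteq> 0"
  then obtain d where d: "d > 0" "\<And>y. y \<in> G \<Longrightarrow> dist y x < d \<Longrightarrow> dist (f y) (f x) < norm (f x)"
    using f x unfolding continuous_on_iff by (metis zero_less_norm_iff)
  obtain D where D: "\<And>a b. a \<in> G \<Longrightarrow> b \<in> G \<Longrightarrow> dist a b \<le> D"
    using compact_imp_bounded[OF SG_props(1)] unfolding bounded_two_points by auto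
  obtain m where m: "D / d < 2 ^ m" using real_arch_pow[of 2 "D / d"] by auto
  obtain w z where w: "w \<in> words m" "z \<in> G" "x = Fw w z" using equalityD1[OF SG_cells[of m]] x by blast
  have nz: "f y \<noteq> 0" if y: "y \<in> Fw w ` G" for y
  proof -
    obtain z' where z': "z' \<in> G" "y = Fw w z'" using y by auto
    have "dist y x = dist z' z / 2 ^ m" using w by (simp add: z' dist_cell_map words_def)
    also have "\<dots> \<le> D / 2 ^ m" using D[OF z'(1) w(2)] by (simp add: divide_right_mono)
    also have "\<dots> < d" using m d(1) by (simp add: field_simps)
    finally have "dist (f y) (f x) < norm (f x)" using d(2)[of y] w(1) z' by blast
    then show ?thesis by auto
  qed
  have "AE y in \<nu>. y \<notin> Fw w ` G"
    using ae by eventually_elim (use nz in blast)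
  then have "emeasure \<nu> (Fw w ` G) = 0"
    using cell_measurable[OF w(1)] by (simp add: AE_iff_measurable[OF _ refl] Collect_conj_eq) 
      (metis AE_iff_null_sets null_setsD1 cell_measurable[OF w(1)])
  then show False using emeasure_cell[OF w(1)] by simp
qed

end

section \<open>The Hilbert space of square-integrable functions\<close>

lemma sum_fun_apply: "(\<Sum>n\<in>A. f n) x = (\<Sum>n\<in>A. f n x)"
  by (induction A rule: infinite_finite_induct) auto

lemma borel_measurable_cnj [measurable (raw)]:
  "f \<in> borel_measurable M \<Longrightarrow> (\<lambda>x. cnj (f x)) \<in> borel_measurable M"
  by (rule measurable_compose[OF _ borel_measurable_continuous_onI[OF linear_continuous_on[OF bounded_linear_cnj]]])

context
  fixes M :: "(real^2) measure"
begin

lemma L2_measurable: "f \<in> L2 M \<Longrightarrow> f \<in> borel_measurable M"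
  by (simp add: L2_def)

lemma L2_integrable: "f \<in> L2 M \<Longrightarrow> integrable M (\<lambda>x. (cmod (f x))\<^sup>2)"
  by (simp add: L2_def)

lemma L2_bound:
  assumes "f \<in> borel_measurable M" "integrable M g" "\<And>x. x \<in> space M \<Longrightarrow> (cmod (f x))\<^sup>2 \<le> g x"
  shows "f \<in> L2 M"
  unfolding L2_def
proof (intro CollectI conjI assms)
  show "integrable M (\<lambda>x. (cmod (f x))\<^sup>2)"
  proof (rule Bochner_Integration.integrable_bound[OF assms(2)])
    show "(\<lambda>x. (cmod (f x))\<^sup>2) \<in> borel_measurable M" using assms(1) by measurable
    show "AE x in M. norm ((cmod (f x))\<^sup>2) \<le> norm (g x)"
      using assms(3) by (intro AE_I2) force
  qed
qed

lemma L2_add: assumes "f \<in> L2 M" "g \<in> L2 M" shows "(\<lambda>x. f x + g x) \<in> L2 M"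
proof (rule L2_bound)
  show "(\<lambda>x. f x + g x) \<in> borel_measurable M" using assms[THEN L2_measurable] by measurable
  show "integrable M (\<lambda>x. 2 * (cmod (f x))\<^sup>2 + 2 * (cmod (g x))\<^sup>2)"
    using assms[THEN L2_integrable] by simp
  show "(cmod (f x + g x))\<^sup>2 \<le> 2 * (cmod (f x))\<^sup>2 + 2 * (cmod (g x))\<^sup>2" for x
  proof -
    have "(cmod (f x + g x))\<^sup>2 \<le> (cmod (f x) + cmod (g x))\<^sup>2"
      by (intro power_mono norm_triangle_ineq) simp
    also have "\<dots> \<le> 2 * (cmod (f x))\<^sup>2 + 2 * (cmod (g x))\<^sup>2"
      using sum_squares_bound[of "cmod (f x)" "cmod (g x)"] by (simp add: power2_sum)
    finally show ?thesis .
  qed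
qed

lemma L2_scale: assumes "f \<in> L2 M" shows "(\<lambda>x. c * f x) \<in> L2 M"
  using assms unfolding L2_def by (auto simp: norm_mult power_mult_distrib)

lemma L2_zero: "(\<lambda>x. 0) \<in> L2 M"
  by (simp add: L2_def)

lemma L2_sum: "(\<And>i. i \<in> I \<Longrightarrow> f i \<in> L2 M) \<Longrightarrow> (\<lambda>x. \<Sum>i\<in>I. f i x) \<in> L2 M"
proof (induction I rule: infinite_finite_induct)
  case (insert i I)
  then show ?case using L2_add[of "f i" "\<lambda>x. \<Sum>i\<in>I. f i x"] by simp
qed (simp_all add: L2_zero)

lemma L2_diff: "f \<in> L2 M \<Longrightarrow> g \<in> L2 M \<Longrightarrow> (\<lambda>x. f x - g x) \<in> L2 M"
  using L2_add[of f "\<lambda>x. (-1) * g x"] L2_scale[of g "-1"] by simp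

lemma L2_cong_AE:
  assumes "f \<in> L2 M" "g \<in> borel_measurable M" "AE x in M. f x = g x" shows "g \<in> L2 M"
proof -
  have "integrable M (\<lambda>x. (cmod (g x))\<^sup>2)"
  proof (rule integrable_cong_AE_imp[OF L2_integrable[OF assms(1)]])
    show "(\<lambda>x. (cmod (g x))\<^sup>2) \<in> borel_measurable M" using assms(2) by measurable
    show "AE x in M. (cmod (f x))\<^sup>2 = (cmod (g x))\<^sup>2" using assms(3) by eventually_elim simp
  qed
  then show ?thesis using assms(2) by (simp add: L2_def)
qed

lemma L2_mult_integrable:
  assumes "f \<in> L2 M" "g \<in> L2 M" shows "integrable M (\<lambda>x. f x * cnj (g x))"
proof (rule Bochner_Integration.integrable_bound)
  show "integrable M (\<lambda>x. (cmod (f x))\<^sup>2 + (cmod (g x))\<^sup>2)"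
    using assms[THEN L2_integrable] by simp
  show "(\<lambda>x. f x * cnj (g x)) \<in> borel_measurable M"
    using assms[THEN L2_measurable] by measurable
  show "AE x in M. norm (f x * cnj (g x)) \<le> norm ((cmod (f x))\<^sup>2 + (cmod (g x))\<^sup>2)"
  proof (rule AE_I2)
    fix x
    have "0 \<le> cmod (f x) * cmod (g x)" by simp
    then have "cmod (f x) * cmod (g x) \<le> (cmod (f x))\<^sup>2 + (cmod (g x))\<^sup>2"
      using sum_squares_bound[of "cmod (f x)" "cmod (g x)"] unfolding mult.assoc by linarith
    then show "norm (f x * cnj (g x)) \<le> norm ((cmod (f x))\<^sup>2 + (cmod (g x))\<^sup>2)"
      by (simp add: norm_mult)
  qed
qed

lemma L2_inner_add_left:
  "f \<in> L2 M \<Longrightarrow> g \<in> L2 M \<Longrightarrow> h \<in> L2 M \<Longrightarrow> L2_inner M (\<lambda>x. f x + g x) h = L2_inner M f h + L2_inner M g h"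
  unfolding L2_inner_def by (simp add: distrib_right L2_mult_integrable)

lemma L2_inner_diff_left:
  "f \<in> L2 M \<Longrightarrow> g \<in> L2 M \<Longrightarrow> h \<in> L2 M \<Longrightarrow> L2_inner M (\<lambda>x. f x - g x) h = L2_inner M f h - L2_inner M g h"
  unfolding L2_inner_def by (simp add: left_diff_distrib L2_mult_integrable)

lemma L2_inner_scale_left: "L2_inner M (\<lambda>x. c * f x) h = c * L2_inner M f h"
  unfolding L2_inner_def by (simp add: mult.assoc)

lemma L2_inner_cnj: "L2_inner M g f = cnj (L2_inner M f g)"
proof -
  have "cnj (LINT x|M. f x * cnj (g x)) = (LINT x|M. cnj (f x * cnj (g x)))"
    by (rule Bochner_Integration.integral_cnj[symmetric])
  then show ?thesis unfolding L2_inner_def by (simp add: mult.commute)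
qed

lemma L2_inner_scale_right: "L2_inner M h (\<lambda>x. c * f x) = cnj c * L2_inner M h f"
  by (subst (1 2) L2_inner_cnj) (simp add: L2_inner_scale_left)

lemma L2_inner_zero_left [simp]: "L2_inner M (\<lambda>x. 0) h = 0"
  by (simp add: L2_inner_def)

lemma L2_inner_sum_left:
  "(\<And>i. i \<in> I \<Longrightarrow> f i \<in> L2 M) \<Longrightarrow> h \<in> L2 M \<Longrightarrow> L2_inner M (\<lambda>x. \<Sum>i\<in>I. f i x) h = (\<Sum>i\<in>I. L2_inner M (f i) h)"
proof (induction I rule: infinite_finite_induct)
  case (insert i I)
  then show ?case using L2_inner_add_left[of "f i" "\<lambda>x. \<Sum>i\<in>I. f i x" h] L2_sum[of I f] by simp
qed simp_all

lemma L2_inner_sum_right: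
  "(\<And>i. i \<in> I \<Longrightarrow> f i \<in> L2 M) \<Longrightarrow> h \<in> L2 M \<Longrightarrow> L2_inner M h (\<lambda>x. \<Sum>i\<in>I. f i x) = (\<Sum>i\<in>I. L2_inner M h (f i))"
  by (subst (1 2) L2_inner_cnj) (simp add: L2_inner_sum_left)

lemma L2_inner_cong_AE:
  assumes "f \<in> borel_measurable M" "f' \<in> borel_measurable M" "h \<in> borel_measurable M" "AE x in M. f x = f' x"
  shows "L2_inner M f h = L2_inner M f' h"
  unfolding L2_inner_def
proof (rule integral_cong_AE)
  show "(\<lambda>x. f x * cnj (h x)) \<in> borel_measurable M" "(\<lambda>x. f' x * cnj (h x)) \<in> borel_measurable M"
    using assms(1-3) by measurable
  show "AE x in M. f x * cnj (h x) = f' x * cnj (h x)" using assms(4) by eventually_elim simp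
qed

lemma L2_norm_nonneg [simp]: "0 \<le> L2_norm M f"
  by (simp add: L2_norm_def)

lemma L2_norm_power2: "(L2_norm M f)\<^sup>2 = (LINT x|M. (cmod (f x))\<^sup>2)"
  by (simp add: L2_norm_def)

lemma L2_inner_self: "L2_inner M f f = of_real ((L2_norm M f)\<^sup>2)"
proof -
  have "L2_inner M f f = (LINT x|M. complex_of_real ((cmod (f x))\<^sup>2))"
    unfolding L2_inner_def by (rule Bochner_Integration.integral_cong[OF refl]) (simp only: complex_norm_square)
  also have "\<dots> = of_real (LINT x|M. (cmod (f x))\<^sup>2)" by (rule integral_complex_of_real)
  finally show ?thesis by (simp add: L2_norm_power2)
qed

lemma L2_norm_zero_iff: "f \<in> L2 M \<Longrightarrow> L2_norm M f = 0 \<longleftrightarrow> (AE x in M. f x = 0)"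
  unfolding L2_norm_def using integral_nonneg_eq_0_iff_AE[OF L2_integrable[of f]] by simp

lemma L2_norm_scale: "L2_norm M (\<lambda>x. c * f x) = cmod c * L2_norm M f"
  unfolding L2_norm_def by (simp add: norm_mult power_mult_distrib real_sqrt_mult)

lemma L2_Cauchy_Schwarz_norm:
  assumes "f \<in> L2 M" "g \<in> L2 M"
  shows "(LINT x|M. cmod (f x) * cmod (g x)) \<le> L2_norm M f * L2_norm M g"
proof -
  have int: "integrable M (\<lambda>x. cmod (f x) * cmod (g x))"
    using integrable_norm[OF L2_mult_integrable[OF assms]] by (simp add: norm_mult)
  consider "L2_norm M f = 0" | "L2_norm M g = 0" | "L2_norm M f > 0" "L2_norm M g > 0"
    using L2_norm_nonneg[of f] L2_norm_nonneg[of g] by linarith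
  then show ?thesis
  proof cases
    case 1
    then have "AE x in M. f x = 0" using L2_norm_zero_iff assms by blast
    then have "AE x in M. cmod (f x) * cmod (g x) = 0" by eventually_elim simp
    then have "(LINT x|M. cmod (f x) * cmod (g x)) = 0" by (rule integral_eq_zero_AE)
    then show ?thesis by simp
  next
    case 2
    then have "AE x in M. g x = 0" using L2_norm_zero_iff assms by blast
    then have "AE x in M. cmod (f x) * cmod (g x) = 0" by eventually_elim simp
    then have "(LINT x|M. cmod (f x) * cmod (g x)) = 0" by (rule integral_eq_zero_AE)
    then show ?thesis by simp
  next
    case 3
    define a b where "a = L2_norm M f" and "b = L2_norm M g"
    have ab: "a > 0" "b > 0" using 3 by (simp_all add: a_def b_def)
    \<comment> \<open>Young's inequality with weights balanced so that each of the two terms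
      integrates to \<open>a * b / 2\<close>.\<close>
    have "(LINT x|M. cmod (f x) * cmod (g x)) \<le> (LINT x|M. (b / (2 * a)) * (cmod (f x))\<^sup>2 + (a / (2 * b)) * (cmod (g x))\<^sup>2)"
    proof (rule integral_mono[OF int])
      show "integrable M (\<lambda>x. (b / (2 * a)) * (cmod (f x))\<^sup>2 + (a / (2 * b)) * (cmod (g x))\<^sup>2)"
        using assms[THEN L2_integrable] by simp
      fix x
      have "2 * (b * cmod (f x)) * (a * cmod (g x)) \<le> (b * cmod (f x))\<^sup>2 + (a * cmod (g x))\<^sup>2"
        by (rule sum_squares_bound)
      then have "2 * (b * cmod (f x)) * (a * cmod (g x)) / (2 * a * b) \<le> ((b * cmod (f x))\<^sup>2 + (a * cmod (g x))\<^sup>2) / (2 * a * b)"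
        using ab by (intro divide_right_mono) auto
      then show "cmod (f x) * cmod (g x) \<le> (b / (2 * a)) * (cmod (f x))\<^sup>2 + (a / (2 * b)) * (cmod (g x))\<^sup>2"
        using ab by (simp add: power2_eq_square add_divide_distrib mult_ac)
    qed
    also have "\<dots> = (b / (2 * a)) * a\<^sup>2 + (a / (2 * b)) * b\<^sup>2"
      using assms[THEN L2_integrable] by (simp add: L2_norm_power2 a_def b_def)
    also have "\<dots> = a * b" using ab by (simp add: power2_eq_square)
    finally show ?thesis by (simp add: a_def b_def)
  qed
qed

lemma L2_Cauchy_Schwarz:
  assumes "f \<in> L2 M" "g \<in> L2 M"
  shows "cmod (L2_inner M f g) \<le> L2_norm M f * L2_norm M g"
proof -
  have "cmod (L2_inner M f g) \<le> (LINT x|M. cmod (f x * cnj (g x)))"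
    unfolding L2_inner_def by (rule integral_norm_bound)
  also have "\<dots> \<le> L2_norm M f * L2_norm M g"
    using L2_Cauchy_Schwarz_norm[OF assms] by (simp add: norm_mult)
  finally show ?thesis .
qed

end

section \<open>Orthonormal expansions and the Riesz-Fischer theorem\<close>

locale L2_basis =
  fixes M :: "(real^2) measure" and \<phi> :: "nat \<Rightarrow> real^2 \<Rightarrow> complex"
  assumes finite_measure_M: "finite_measure M"
    and basis_L2: "\<phi> n \<in> L2 M"
    and orthonormal: "L2_inner M (\<phi> n) (\<phi> m) = (if n = m then 1 else 0)"
    and complete: "u \<in> L2 M \<Longrightarrow> L2_expansion M \<phi> (\<lambda>n. L2_inner M u (\<phi> n)) u"
begin

text \<open>Indexed by sets rather than by a length, so that initial segments and the blocks between
  them share the same lemmas.\<close>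

definition psum :: "nat set \<Rightarrow> (nat \<Rightarrow> complex) \<Rightarrow> real^2 \<Rightarrow> complex" where
  "psum I c x = (\<Sum>n\<in>I. c n * \<phi> n x)"

lemma psum_L2: "psum I c \<in> L2 M"
  unfolding psum_def by (intro L2_sum L2_scale basis_L2)

lemma inner_psum: "finite I \<Longrightarrow> L2_inner M (psum I c) (\<phi> m) = (if m \<in> I then c m else 0)"
proof -
  assume I: "finite I"
  have "L2_inner M (psum I c) (\<phi> m) = (\<Sum>n\<in>I. c n * (if n = m then 1 else 0))"
    unfolding psum_def by (subst L2_inner_sum_left) (auto simp: L2_scale basis_L2 L2_inner_scale_left orthonormal)
  then show ?thesis using I by (simp add: if_distrib cong: if_cong)
qed

lemma inner_psum_right: "u \<in> L2 M \<Longrightarrow> L2_inner M u (psum I c) = (\<Sum>n\<in>I. cnj (c n) * L2_inner M u (\<phi> n))"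
  unfolding psum_def by (subst L2_inner_sum_right) (auto simp: L2_scale basis_L2 L2_inner_scale_right)

lemma norm_psum: "finite I \<Longrightarrow> (L2_norm M (psum I c))\<^sup>2 = (\<Sum>n\<in>I. (cmod (c n))\<^sup>2)"
proof -
  assume I: "finite I"
  have "complex_of_real ((L2_norm M (psum I c))\<^sup>2) = (\<Sum>n\<in>I. cnj (c n) * c n)"
    unfolding L2_inner_self[symmetric] inner_psum_right[OF psum_L2]
    using I by (intro sum.cong) (auto simp: inner_psum)
  also have "\<dots> = complex_of_real (\<Sum>n\<in>I. (cmod (c n))\<^sup>2)"
    unfolding of_real_sum by (intro sum.cong refl) (simp only: complex_norm_square mult.commute)
  finally show ?thesis by (simp only: of_real_eq_iff)
qed

lemma expansion_iff:
  "L2_expansion M \<phi> c u \<longleftrightarrow> u \<in> L2 M \<and> (\<lambda>N. L2_norm M (\<lambda>x. u x - psum {..<N} c x)) \<longlonglongrightarrow> 0"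
proof -
  have "u - (\<Sum>n<N. (\<lambda>x. c n * \<phi> n x)) = (\<lambda>x. u x - psum {..<N} c x)" for N
    by (rule ext) (simp add: psum_def sum_fun_apply)
  then show ?thesis by (simp add: L2_expansion_def)
qed

lemma inner_expansion_tendsto:
  assumes "L2_expansion M \<phi> c u" "v \<in> L2 M"
  shows "(\<lambda>N. L2_inner M (psum {..<N} c) v) \<longlonglongrightarrow> L2_inner M u v"
proof -
  have u: "u \<in> L2 M" and lim: "(\<lambda>N. L2_norm M (\<lambda>x. u x - psum {..<N} c x)) \<longlonglongrightarrow> 0"
    using assms(1) by (simp_all add: expansion_iff)
  have lim0: "(\<lambda>N. L2_norm M (\<lambda>x. u x - psum {..<N} c x) * L2_norm M v) \<longlonglongrightarrow> 0"
    using tendsto_mult_left_zero[OF lim] .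
  have bd: "norm (L2_inner M u v - L2_inner M (psum {..<N} c) v) \<le> L2_norm M (\<lambda>x. u x - psum {..<N} c x) * L2_norm M v" for N
    using L2_Cauchy_Schwarz[OF L2_diff[OF u psum_L2] assms(2)] u assms(2) psum_L2
    by (simp add: L2_inner_diff_left)
  have "(\<lambda>N. L2_inner M u v - L2_inner M (psum {..<N} c) v) \<longlonglongrightarrow> 0"
    by (rule Lim_null_comparison[OF always_eventually lim0]) (intro allI bd)
  then have "(\<lambda>N. L2_inner M u v - (L2_inner M u v - L2_inner M (psum {..<N} c) v)) \<longlonglongrightarrow> L2_inner M u v - 0"
    by (intro tendsto_intros)
  then show ?thesis by simp
qed

lemma expansion_coeff: "L2_expansion M \<phi> c u \<Longrightarrow> L2_inner M u (\<phi> n) = c n"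
proof -
  assume "L2_expansion M \<phi> c u"
  then have "(\<lambda>N. L2_inner M (psum {..<N} c) (\<phi> n)) \<longlonglongrightarrow> L2_inner M u (\<phi> n)"
    by (rule inner_expansion_tendsto) (rule basis_L2)
  moreover have "(\<lambda>N. L2_inner M (psum {..<N} c) (\<phi> n)) \<longlonglongrightarrow> c n"
    by (rule tendsto_eventually) (use eventually_gt_at_top[of n] in eventually_elim, simp add: inner_psum)
  ultimately show ?thesis by (rule LIMSEQ_unique)
qed

lemma inner_sums:
  assumes "u \<in> L2 M" "v \<in> L2 M"
  shows "(\<lambda>n. L2_inner M u (\<phi> n) * cnj (L2_inner M v (\<phi> n))) sums L2_inner M u v"
proof -
  have "L2_inner M (psum {..<N} (\<lambda>n. L2_inner M u (\<phi> n))) v = (\<Sum>n<N. L2_inner M u (\<phi> n) * cnj (L2_inner M v (\<phi> n)))" for N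
    by (subst L2_inner_cnj) (simp add: inner_psum_right assms)
  then show ?thesis
    using inner_expansion_tendsto[OF complete[OF assms(1)] assms(2)] by (simp add: sums_def)
qed

lemma Parseval:
  assumes "u \<in> L2 M" shows "(\<lambda>n. (cmod (L2_inner M u (\<phi> n)))\<^sup>2) sums (L2_norm M u)\<^sup>2"
proof -
  have "(\<lambda>n. complex_of_real ((cmod (L2_inner M u (\<phi> n)))\<^sup>2)) sums complex_of_real ((L2_norm M u)\<^sup>2)"
    using inner_sums[OF assms assms] by (simp only: complex_norm_square[of "L2_inner M u (\<phi> n)" for n] L2_inner_self)
  then show ?thesis by (simp only: sums_of_real_iff)
qed

lemma coeff_eq_AE:
  assumes "u \<in> L2 M" "v \<in> L2 M" "\<And>n. L2_inner M u (\<phi> n) = L2_inner M v (\<phi> n)"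
  shows "AE x in M. u x = v x"
proof -
  have d: "(\<lambda>x. u x - v x) \<in> L2 M" using assms by (intro L2_diff)
  have "(\<lambda>n. 0) sums (L2_norm M (\<lambda>x. u x - v x))\<^sup>2"
    using Parseval[OF d] assms basis_L2 by (simp add: L2_inner_diff_left)
  then have "(L2_norm M (\<lambda>x. u x - v x))\<^sup>2 = 0" using sums_unique2[OF _ sums_zero] by blast
  then have "AE x in M. u x - v x = 0" using L2_norm_zero_iff[OF d] by simp
  then show ?thesis by eventually_elim simp
qed

lemma norm_psum_diff:
  assumes "m \<le> n"
  shows "(L2_norm M (\<lambda>x. psum {..<n} c x - psum {..<m} c x))\<^sup>2 = (\<Sum>i\<in>{m..<n}. (cmod (c i))\<^sup>2)"
proof -
  have "(\<lambda>x. psum {..<n} c x - psum {..<m} c x) = psum {m..<n} c"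
  proof
    fix x
    have "{..<n} = {..<m} \<union> {m..<n}" using assms by auto
    moreover have "(\<Sum>i\<in>{..<m} \<union> {m..<n}. c i * \<phi> i x) = (\<Sum>i<m. c i * \<phi> i x) + (\<Sum>i=m..<n. c i * \<phi> i x)"
      by (rule sum.union_disjoint) auto
    ultimately show "psum {..<n} c x - psum {..<m} c x = psum {m..<n} c x" by (simp add: psum_def)
  qed
  then show ?thesis by (simp add: norm_psum)
qed

lemma L1_le_L2: "f \<in> L2 M \<Longrightarrow> integrable M (\<lambda>x. cmod (f x)) \<and> (LINT x|M. cmod (f x)) \<le> L2_norm M f * L2_norm M (\<lambda>x. 1)"
proof -
  assume f: "f \<in> L2 M"
  interpret finite_measure M by (rule finite_measure_M)
  have 1: "(\<lambda>x. 1) \<in> L2 M" by (simp add: L2_def)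
  have "integrable M (\<lambda>x. cmod (f x))"
    using integrable_norm[OF L2_mult_integrable[OF f 1]] by simp
  then show ?thesis using L2_Cauchy_Schwarz_norm[OF f 1] by simp
qed

text \<open>\<open>L2\<close> is a set of representatives, so a limit has to be constructed as a
  function. Along a subsequence whose tails are below \<open>(1/4) ^ j\<close> the increments have
  norm at most \<open>(1/2) ^ j\<close> in L^2, hence summable norms in L^1 since the measure is
  finite, and the partial sums converge almost everywhere. Fatou's lemma then estimates the distance
  to this limit.\<close>

lemma Riesz_Fischer:
  assumes sm: "summable (\<lambda>n. (cmod (c n))\<^sup>2)"
  shows "\<exists>w. L2_expansion M \<phi> c w"
proof -
  define a where "a n = (cmod (c n))\<^sup>2" for n
  define tl where "tl n = (\<Sum>i. a (i + n))" for n
  have sa: "summable a" using sm by (simp add: a_def[abs_def])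
  have a0: "0 \<le> a n" for n by (simp add: a_def)
  have tail: "(\<Sum>i\<in>{m..<n}. a i) \<le> tl m" for m n
  proof -
    have "(\<Sum>i\<in>{m..<n}. a i) = (\<Sum>i<n - m. a (i + m))"
    proof (cases "m \<le> n")
      case True
      then show ?thesis using sum.shift_bounds_nat_ivl[of a 0 m "n - m"] by (simp add: atLeast0LessThan)
    qed simp
    also have "\<dots> \<le> tl m"
      unfolding tl_def using sa a0 by (intro sum_le_suminf summable_ignore_initial_segment) auto
    finally show ?thesis .
  qed
  have tl0: "tl \<longlonglongrightarrow> 0"
    unfolding tl_def[abs_def] using suminf_exist_split2[OF sa] by simp
  have tln: "0 \<le> tl n" for n using tail[of n n] by simp
  have "\<exists>N. \<forall>n\<ge>N. tl n < (1/4) ^ j" for j :: nat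
    using LIMSEQ_D[OF tl0, of "(1/4) ^ j"] tln by fastforce
  then obtain N0 where N0: "\<And>j n. n \<ge> N0 j \<Longrightarrow> tl n < (1/4) ^ j" by metis
  \<comment> \<open>Cumulative sums make the indices increasing and at least \<open>N0 j\<close>;
    the added 1 forces \<open>N n \<ge> n\<close>, so every index is eventually passed.\<close>
  define N where "N j = (\<Sum>i\<le>j. N0 i + 1)" for j
  have Nmono: "N j \<le> N (Suc j)" for j by (simp add: N_def)
  have Nge: "N0 j \<le> N j" for j
    unfolding N_def using member_le_sum[of j "{..j}" "\<lambda>i. N0 i + 1"] by simp
  define S where "S n = psum {..<n} c" for n
  have S_L2: "S n \<in> L2 M" for n by (simp add: S_def psum_L2)
  define g where "g j x = S (N (Suc j)) x - S (N j) x" for j x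
  have g_L2: "g j \<in> L2 M" for j unfolding g_def[abs_def] by (intro L2_diff S_L2)
  have gn: "L2_norm M (g j) \<le> (1/2) ^ j" for j
  proof (rule power2_le_imp_le)
    have "(L2_norm M (g j))\<^sup>2 = (\<Sum>i\<in>{N j..<N (Suc j)}. a i)"
      unfolding g_def[abs_def] S_def a_def by (rule norm_psum_diff[OF Nmono])
    also have "\<dots> \<le> (1/4) ^ j" using tail[of "N j" "N (Suc j)"] N0[OF Nge, of j] by linarith
    also have "\<dots> = ((1/2) ^ j)\<^sup>2" by (simp add: power2_eq_square power_mult_distrib[symmetric])
    finally show "(L2_norm M (g j))\<^sup>2 \<le> ((1/2) ^ j)\<^sup>2" .
  qed simp
  define K where "K = L2_norm M (\<lambda>x. 1)"
  have "(\<integral>\<^sup>+x. (\<Sum>j. ennreal (cmod (g j x))) \<partial>M) = (\<Sum>j. \<integral>\<^sup>+x. ennreal (cmod (g j x)) \<partial>M)"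
    using L2_measurable[OF g_L2] by (intro nn_integral_suminf) measurable
  also have "\<dots> \<le> (\<Sum>j. ennreal ((1/2) ^ j * K))"
  proof (intro suminf_le allI)
    fix j
    have "(\<integral>\<^sup>+x. ennreal (cmod (g j x)) \<partial>M) = ennreal (LINT x|M. cmod (g j x))"
      using L1_le_L2[OF g_L2, of j] by (intro nn_integral_eq_integral) auto
    also have "\<dots> \<le> ennreal ((1/2) ^ j * K)"
      using L1_le_L2[OF g_L2, of j] mult_right_mono[OF gn[of j], of K]
      by (intro ennreal_leI) (simp add: K_def)
    finally show "(\<integral>\<^sup>+x. ennreal (cmod (g j x)) \<partial>M) \<le> ennreal ((1/2) ^ j * K)" .
  qed auto
  also have "\<dots> < top"
  proof -
    have "summable (\<lambda>j. (1/2::real) ^ j * K)"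
      by (intro summable_mult2 summable_geometric) simp
    then have "(\<Sum>j. ennreal ((1/2) ^ j * K)) = ennreal (\<Sum>j. (1/2) ^ j * K)"
      by (rule suminf_ennreal2[rotated]) (simp add: K_def)
    then show ?thesis by (simp only: ennreal_less_top)
  qed
  finally have "(\<integral>\<^sup>+x. (\<Sum>j. ennreal (cmod (g j x))) \<partial>M) \<noteq> \<infinity>" by simp
  then have "AE x in M. (\<Sum>j. ennreal (cmod (g j x))) \<noteq> \<infinity>"
    using L2_measurable[OF g_L2] by (intro nn_integral_PInf_AE) measurable
  then have conv: "AE x in M. convergent (\<lambda>J. S (N J) x)"
  proof eventually_elim
    fix x assume "(\<Sum>j. ennreal (cmod (g j x))) \<noteq> \<infinity>"
    then have "summable (\<lambda>j. cmod (g j x))"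
      by (intro summable_suminf_not_top) auto
    then have "summable (\<lambda>j. g j x)" by (rule summable_norm_cancel)
    then have "convergent (\<lambda>J. S (N 0) x + (\<Sum>j<J. g j x))"
      by (intro convergent_add convergent_const) (simp add: summable_iff_convergent)
    moreover have "S (N 0) x + (\<Sum>j<J. g j x) = S (N J) x" for J
      using sum_lessThan_telescope[of "\<lambda>j. S (N j) x" J] by (simp add: g_def)
    ultimately show "convergent (\<lambda>J. S (N J) x)" by simp
  qed
  define w where "w x = lim (\<lambda>J. S (N J) x)" for x
  have w_meas: "w \<in> borel_measurable M"
    unfolding w_def[abs_def] by (intro borel_measurable_lim_metric L2_measurable S_L2)
  have lim: "AE x in M. (\<lambda>J. S (N J) x) \<longlonglongrightarrow> w x"
    using conv by eventually_elim (simp add: w_def convergent_LIMSEQ_iff)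
  \<comment> \<open>Comparing \<open>w\<close> with an arbitrary \<open>S n\<close>, not only with
    members of the subsequence, yields convergence of the whole sequence.\<close>
  have key: "(\<integral>\<^sup>+x. ennreal ((cmod (w x - S n x))\<^sup>2) \<partial>M) \<le> ennreal (tl n)" if n: "\<exists>j. n \<le> N j" for n
  proof -
    have "(\<integral>\<^sup>+x. ennreal ((cmod (w x - S n x))\<^sup>2) \<partial>M)
        = (\<integral>\<^sup>+x. liminf (\<lambda>J. ennreal ((cmod (S (N J) x - S n x))\<^sup>2)) \<partial>M)"
    proof (rule nn_integral_cong_AE)
      show "AE x in M. ennreal ((cmod (w x - S n x))\<^sup>2) = liminf (\<lambda>J. ennreal ((cmod (S (N J) x - S n x))\<^sup>2))"
        using lim
      proof eventually_elim
        fix x assume "(\<lambda>J. S (N J) x) \<longlonglongrightarrow> w x"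
        then have "(\<lambda>J. ennreal ((cmod (S (N J) x - S n x))\<^sup>2)) \<longlonglongrightarrow> ennreal ((cmod (w x - S n x))\<^sup>2)"
          by (intro tendsto_intros)
        then show "ennreal ((cmod (w x - S n x))\<^sup>2) = liminf (\<lambda>J. ennreal ((cmod (S (N J) x - S n x))\<^sup>2))"
          by (intro lim_imp_Liminf[symmetric]) auto
      qed
    qed
    also have "\<dots> \<le> liminf (\<lambda>J. \<integral>\<^sup>+x. ennreal ((cmod (S (N J) x - S n x))\<^sup>2) \<partial>M)"
      using L2_measurable[OF S_L2] by (intro nn_integral_liminf) measurable
    also have "\<dots> \<le> liminf (\<lambda>J. ennreal (tl n))"
    proof (rule Liminf_mono)
      obtain j where j: "n \<le> N j" using n by auto
      have "(\<integral>\<^sup>+x. ennreal ((cmod (S (N J) x - S n x))\<^sup>2) \<partial>M) \<le> ennreal (tl n)" if "J \<ge> j" for J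
      proof -
        have "n \<le> N J" using lift_Suc_mono_le[of N, OF Nmono \<open>J \<ge> j\<close>] j by simp
        have "(\<integral>\<^sup>+x. ennreal ((cmod (S (N J) x - S n x))\<^sup>2) \<partial>M) = ennreal (LINT x|M. (cmod (S (N J) x - S n x))\<^sup>2)"
          by (intro nn_integral_eq_integral L2_integrable L2_diff S_L2) auto
        also have "(LINT x|M. (cmod (S (N J) x - S n x))\<^sup>2) = (\<Sum>i\<in>{n..<N J}. a i)"
          unfolding L2_norm_power2[symmetric] S_def a_def by (rule norm_psum_diff[OF \<open>n \<le> N J\<close>])
        finally show ?thesis using tail by (simp add: ennreal_leI)
      qed
      then show "\<forall>\<^sub>F J in sequentially. (\<integral>\<^sup>+x. ennreal ((cmod (S (N J) x - S n x))\<^sup>2) \<partial>M) \<le> ennreal (tl n)"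
        using eventually_sequentially by blast
    qed
    finally show ?thesis by (simp add: Liminf_const)
  qed
  have meas: "(\<lambda>x. w x - S n x) \<in> borel_measurable M" for n
    using w_meas L2_measurable[OF S_L2, of n] by measurable
  have diff_L2: "(\<lambda>x. w x - S n x) \<in> L2 M \<and> (L2_norm M (\<lambda>x. w x - S n x))\<^sup>2 \<le> tl n" if n: "\<exists>j. n \<le> N j" for n
  proof -
    have int: "integrable M (\<lambda>x. (cmod (w x - S n x))\<^sup>2)"
    proof (rule integrableI_nonneg)
      show "(\<lambda>x. (cmod (w x - S n x))\<^sup>2) \<in> borel_measurable M" using meas[of n] by measurable
      show "(\<integral>\<^sup>+x. ennreal ((cmod (w x - S n x))\<^sup>2) \<partial>M) < \<infinity>"
        using key[OF n] by (rule order_le_less_trans) simp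
    qed simp
    moreover have "ennreal (LINT x|M. (cmod (w x - S n x))\<^sup>2) \<le> ennreal (tl n)"
      using key[OF n] nn_integral_eq_integral[OF int] by simp
    ultimately show ?thesis
      using meas tln[of n] by (simp add: L2_def L2_norm_power2)
  qed
  have all: "\<exists>j. n \<le> N j" for n
  proof -
    have "n \<le> N n" by (induction n) (auto simp: N_def)
    then show ?thesis by blast
  qed
    have "(\<lambda>x. (w x - S 0 x) + S 0 x) \<in> L2 M"
      by (intro L2_add S_L2 diff_L2[OF all, THEN conjunct1])
    then have "w \<in> L2 M" by simp
    moreover have "(\<lambda>n. L2_norm M (\<lambda>x. w x - S n x)) \<longlonglongrightarrow> 0"
    proof (rule Lim_null_comparison)
      have "L2_norm M (\<lambda>x. w x - S n x) \<le> sqrt (tl n)" for n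
        using diff_L2[OF all, of n] by (intro real_le_rsqrt) simp
      then show "\<forall>\<^sub>F n in sequentially. norm (L2_norm M (\<lambda>x. w x - S n x)) \<le> sqrt (tl n)" by simp
      show "(\<lambda>n. sqrt (tl n)) \<longlonglongrightarrow> 0" using tendsto_real_sqrt[OF tl0] by simp
    qed
    ultimately show ?thesis by (auto simp: expansion_iff S_def)
qed

end

section \<open>Sobolev spaces\<close>

context gasket
begin

lemma continuous_L2:
  assumes "continuous_on G u" shows "u \<in> L2 \<nu>"
proof -
  have "integrable \<nu> (\<lambda>x. (cmod (u x))\<^sup>2)"
    using assms by (intro continuous_integrable continuous_intros)
  then show ?thesis using continuous_measurable[OF assms] by (simp add: L2_def)
qed

lemma dom_L2: "u \<in> dom \<Longrightarrow> u \<in> L2 \<nu>"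
  by (intro continuous_L2 dom_continuous)

lemma L2_norm_le_sup:
  assumes u: "continuous_on G u" and B: "0 \<le> B" "\<And>x. x \<in> G \<Longrightarrow> cmod (u x) \<le> B"
  shows "L2_norm \<nu> u \<le> B"
proof (rule power2_le_imp_le)
  have "(LINT x|\<nu>. (cmod (u x))\<^sup>2) \<le> (LINT x|\<nu>. B\<^sup>2)"
    using L2_integrable[OF continuous_L2[OF u]] B by (intro integral_mono) (auto intro!: power_mono)
  then show "(L2_norm \<nu> u)\<^sup>2 \<le> B\<^sup>2" by (simp add: L2_norm_power2)
qed (rule B)

text \<open>Two applications of \<open>osc_SG\<close>, through \<open>p 0\<close>, give
  \<open>|u x| \<le> |u y| + 20 * B\<close>. Squaring produces \<open>2 * 20 * 20 = 800\<close>, and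
  averaging over \<open>y\<close> against the probability measure turns the first term into the L^2
  norm.\<close>

lemma sup_bound:
  assumes u: "u \<in> dom" and x: "x \<in> G"
  shows "(cmod (u x))\<^sup>2 \<le> 800 * ((L2_norm \<nu> u)\<^sup>2 + Re (energy p u u))"
proof -
  define B where "B = sqrt (Re (energy p u u))"
  have B: "0 \<le> B" "B\<^sup>2 = Re (energy p u u)" using energy_nonneg[OF u] by (simp_all add: B_def)
  have osc: "cmod (u y - u (p 0)) \<le> 10 * B" if "y \<in> G" for y
    using osc_SG[OF dom_continuous[OF u] B(1) _ that] enr_le_energy[OF u] B(2) by simp
  have *: "(cmod (u x))\<^sup>2 \<le> 2 * (cmod (u y))\<^sup>2 + 800 * B\<^sup>2" if y: "y \<in> G" for y
  proof -
    have "cmod (u x) \<le> cmod (u y) + 20 * B"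
      using osc[OF x] osc[OF y] norm_triangle_ineq4[of "u x - u (p 0)" "u y - u (p 0)"]
        norm_triangle_sub[of "u x" "u y"] by simp
    then have "(cmod (u x))\<^sup>2 \<le> (cmod (u y) + 20 * B)\<^sup>2" by (intro power_mono) auto
    also have "\<dots> \<le> 2 * (cmod (u y))\<^sup>2 + 800 * B\<^sup>2"
      using sum_squares_bound[of "cmod (u y)" "20 * B"] by (simp add: power2_sum power_mult_distrib)
    finally show ?thesis .
  qed
  have "(LINT y|\<nu>. (cmod (u x))\<^sup>2) \<le> (LINT y|\<nu>. 2 * (cmod (u y))\<^sup>2 + 800 * B\<^sup>2)"
    using L2_integrable[OF dom_L2[OF u]] * by (intro integral_mono) auto
  also have "\<dots> = 2 * (L2_norm \<nu> u)\<^sup>2 + 800 * B\<^sup>2"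
    using L2_integrable[OF dom_L2[OF u]] by (simp add: L2_norm_power2)
  finally have "(cmod (u x))\<^sup>2 \<le> 2 * (L2_norm \<nu> u)\<^sup>2 + 800 * Re (energy p u u)"
    by (simp add: B(2))
  then show ?thesis using zero_le_power2[of "L2_norm \<nu> u"] unfolding distrib_left by linarith
qed

lemma L2_finite_measure: "finite_measure \<nu>"
  by unfold_locales

end

section \<open>Eigenfunctions and the spectral side of the energy\<close>

locale gasket_eigenbasis = gasket p \<nu> for p \<nu> +
  fixes \<phi> :: "nat \<Rightarrow> real^2 \<Rightarrow> complex" and lam :: "nat \<Rightarrow> real"
  assumes eigenbasis: "eigenbasis p \<nu> \<phi> lam"
begin

lemma eigenfunction_dom: "\<phi> n \<in> dom"
  using eigenbasis by (simp add: eigenbasis_def neg_laplacian_def)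

sublocale L2_basis \<nu> \<phi>
proof
  show "\<phi> n \<in> L2 \<nu>" for n by (intro dom_L2 eigenfunction_dom)
qed (use eigenbasis L2_finite_measure in \<open>auto simp: eigenbasis_def finite_measure_def\<close>)

lemma energy_eigenfunction: "v \<in> dom \<Longrightarrow> energy p (\<phi> n) v = of_real (lam n) * L2_inner \<nu> (\<phi> n) v"
  using eigenbasis by (simp add: eigenbasis_def neg_laplacian_def L2_inner_scale_left)

lemma lam_nonneg: "0 \<le> lam n"
  using energy_eigenfunction[OF eigenfunction_dom, of n n] energy_nonneg[OF eigenfunction_dom, of n]
  by (simp add: orthonormal)

abbreviation coef :: "(real^2 \<Rightarrow> complex) \<Rightarrow> nat \<Rightarrow> complex" where
  "coef u n \<equiv> L2_inner \<nu> u (\<phi> n)"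

lemma coef_cong_AE:
  "u \<in> L2 \<nu> \<Longrightarrow> v \<in> L2 \<nu> \<Longrightarrow> AE x in \<nu>. u x = v x \<Longrightarrow> coef u n = coef v n"
  by (intro L2_inner_cong_AE) (auto intro: L2_measurable basis_L2)

text \<open>Testing against the whole domain builds in the Neumann condition. The zero function
  qualifies, so nonvanishing is tracked separately through norms.\<close>

definition eigf :: "real \<Rightarrow> (real^2 \<Rightarrow> complex) \<Rightarrow> bool" where
  "eigf l u \<longleftrightarrow> u \<in> dom \<and> (\<forall>v\<in>dom. energy p u v = of_real l * L2_inner \<nu> u v)"

text \<open>Symmetry of the energy makes eigenfunctions of distinct eigenvalues orthogonal. An
  eigenfunction that is not a basis element therefore still has all its coefficients at frequency
  \<open>l\<close>, and every spectral multiplier acts on it as a scalar.\<close>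

lemma eigf_coef: "eigf l u \<Longrightarrow> coef u n \<noteq> 0 \<Longrightarrow> lam n = l"
proof -
  assume u: "eigf l u" and nz: "coef u n \<noteq> 0"
  have "of_real l * coef u n = energy p u (\<phi> n)"
    using u eigenfunction_dom by (simp add: eigf_def)
  also have "\<dots> = cnj (energy p (\<phi> n) u)"
    using u by (intro energy_cnj) (auto simp: eigf_def eigenfunction_dom)
  also have "\<dots> = of_real (lam n) * cnj (L2_inner \<nu> (\<phi> n) u)"
    using u by (simp add: eigf_def energy_eigenfunction)
  also have "cnj (L2_inner \<nu> (\<phi> n) u) = coef u n" by (rule L2_inner_cnj[symmetric])
  finally show ?thesis using nz by simp
qed

lemma psum_dom: "psum I c \<in> dom"
  unfolding psum_def by (intro dom_sum dom_scale eigenfunction_dom)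

lemma energy_psum_right:
  assumes "v \<in> dom" shows "energy p v (psum I c) = (\<Sum>n\<in>I. cnj (c n) * of_real (lam n) * coef v n)"
proof -
  have "energy p v (psum I c) = (\<Sum>n\<in>I. energy p v (\<lambda>x. c n * \<phi> n x))"
    unfolding psum_def using assms by (intro energy_sum_right dom_scale eigenfunction_dom)
  also have "\<dots> = (\<Sum>n\<in>I. cnj (c n) * of_real (lam n) * coef v n)"
  proof (rule sum.cong[OF refl])
    fix n
    have "energy p v (\<phi> n) = of_real (lam n) * coef v n"
      using energy_cnj[of "\<phi> n" v] energy_eigenfunction[OF assms, of n] L2_inner_cnj[of \<nu> v "\<phi> n"] assms eigenfunction_dom
      by simp
    then show "energy p v (\<lambda>x. c n * \<phi> n x) = cnj (c n) * of_real (lam n) * coef v n"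
      using energy_scale_right[OF eigenfunction_dom[of n] assms, of "c n"] by simp
  qed
  finally show ?thesis .
qed

lemma energy_psum: "finite I \<Longrightarrow> Re (energy p (psum I c) (psum I c)) = (\<Sum>n\<in>I. lam n * (cmod (c n))\<^sup>2)"
proof -
  assume I: "finite I"
  have "energy p (psum I c) (psum I c) = (\<Sum>n\<in>I. cnj (c n) * of_real (lam n) * c n)"
    using I by (simp add: energy_psum_right psum_dom inner_psum)
  also have "\<dots> = of_real (\<Sum>n\<in>I. lam n * (cmod (c n))\<^sup>2)"
    unfolding of_real_sum of_real_mult complex_norm_square by (intro sum.cong) simp_all
  finally show ?thesis by simp
qed

text \<open>The partial sum \<open>S\<close> is the energy-orthogonal projection of
  \<open>f\<close>, so the difference of the two sides is the energy of \<open>f - S\<close>, which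
  is nonnegative.\<close>

lemma energy_Bessel:
  assumes f: "f \<in> dom"
  shows "(\<Sum>n<N. lam n * (cmod (coef f n))\<^sup>2) \<le> Re (energy p f f)"
proof -
  define S where "S = psum {..<N} (coef f)"
  define T where "T = (\<Sum>n<N. lam n * (cmod (coef f n))\<^sup>2)"
  have S: "S \<in> dom" by (simp add: S_def psum_dom)
  have m1S: "(\<lambda>x. (-1) * S x) \<in> dom" by (intro dom_scale S)
  have "energy p f S = (\<Sum>n<N. cnj (coef f n) * of_real (lam n) * coef f n)"
    unfolding S_def by (rule energy_psum_right[OF f])
  also have "\<dots> = of_real T"
    unfolding T_def of_real_sum of_real_mult complex_norm_square by (intro sum.cong) simp_all
  finally have fS: "energy p f S = of_real T" .
  then have Sf: "energy p S f = of_real T" using energy_cnj[OF f S] by simp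
  have SS: "Re (energy p S S) = T" unfolding S_def T_def by (rule energy_psum) simp
  have d: "(\<lambda>x. f x + (-1) * S x) \<in> dom" by (intro dom_add f m1S)
  have "energy p (\<lambda>x. f x + (-1) * S x) (\<lambda>x. f x + (-1) * S x)
     = energy p f (\<lambda>x. f x + (-1) * S x) + (-1) * energy p S (\<lambda>x. f x + (-1) * S x)"
    by (simp only: energy_add_left[OF f m1S d] energy_scale_left[OF S d])
  also have "energy p f (\<lambda>x. f x + (-1) * S x) = cnj (energy p (\<lambda>x. f x + (-1) * S x) f)"
    by (rule energy_cnj[OF d f])
  also have "energy p S (\<lambda>x. f x + (-1) * S x) = cnj (energy p (\<lambda>x. f x + (-1) * S x) S)"
    by (rule energy_cnj[OF d S])
  finally have "energy p (\<lambda>x. f x + (-1) * S x) (\<lambda>x. f x + (-1) * S x)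
     = cnj (energy p f f + (-1) * energy p S f) + (-1) * cnj (energy p f S + (-1) * energy p S S)"
    by (simp only: energy_add_left[OF f m1S f] energy_scale_left[OF S f] energy_add_left[OF f m1S S] energy_scale_left[OF S S])
  then have "Re (energy p (\<lambda>x. f x + (-1) * S x) (\<lambda>x. f x + (-1) * S x)) = Re (energy p f f) - T"
    by (simp add: fS Sf SS)
  then show ?thesis using energy_nonneg[OF d] by (simp add: T_def)
qed

section \<open>Sobolev norms as weighted sums of coefficients\<close>

definition wt :: "real \<Rightarrow> nat \<Rightarrow> real" where "wt s n = (1 + lam n) powr s"

lemma wt_pos [simp]: "0 < wt s n"
  using lam_nonneg[of n] by (simp add: wt_def)

lemma wt_half: "(wt (s/2) n)\<^sup>2 = wt s n"
  unfolding wt_def power2_eq_square powr_add[symmetric] by simp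

lemma wt_minus: "wt (- s) n * wt s n = 1"
  using lam_nonneg[of n] unfolding wt_def powr_add[symmetric] by simp

lemma wt_1: "wt 1 n = 1 + lam n"
  using lam_nonneg[of n] by (simp add: wt_def)

text \<open>\<open>Hs_norm\<close> contains a \<open>suminf\<close>, which has a default value for
  divergent series; finiteness is therefore carried by a predicate of its own.\<close>

definition hsummable :: "real \<Rightarrow> (real^2 \<Rightarrow> complex) \<Rightarrow> bool" where
  "hsummable s u \<longleftrightarrow> summable (\<lambda>n. wt s n * (cmod (coef u n))\<^sup>2)"

abbreviation nrm :: "real \<Rightarrow> (real^2 \<Rightarrow> complex) \<Rightarrow> real" where
  "nrm s u \<equiv> Hs_norm \<nu> \<phi> lam s u"

abbreviation H :: "real \<Rightarrow> (real^2 \<Rightarrow> complex) set" where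
  "H s \<equiv> Hs \<nu> \<phi> lam s"

lemma nrm_eq: "nrm s u = sqrt (\<Sum>n. wt s n * (cmod (coef u n))\<^sup>2)"
  by (simp add: Hs_norm_def wt_def)

text \<open>\<open>spectral_op\<close> is a choice, so everything rests on existence: a multiplier
  bounded by 1 keeps the coefficients square summable, and Riesz-Fischer supplies the function.
  Bessel potentials and the propagator are both of this kind.\<close>

lemma spectral_op_props:
  assumes f: "f \<in> L2 \<nu>" and g: "\<And>l. 0 \<le> l \<Longrightarrow> cmod (g l) \<le> 1"
  shows "spectral_op \<nu> \<phi> lam g f \<in> L2 \<nu>" "coef (spectral_op \<nu> \<phi> lam g f) n = g (lam n) * coef f n"
proof -
  have "summable (\<lambda>n. (cmod (g (lam n) * coef f n))\<^sup>2)"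
  proof (rule summable_comparison_test')
    show "summable (\<lambda>n. (cmod (coef f n))\<^sup>2)" using Parseval[OF f] by (rule sums_summable)
    show "norm ((cmod (g (lam n) * coef f n))\<^sup>2) \<le> (cmod (coef f n))\<^sup>2" if "0 \<le> n" for n
      using g[OF lam_nonneg, of n] by (simp add: norm_mult power_mult_distrib mult_left_le_one_le power_le_one)
  qed
  then have "\<exists>w. L2_expansion \<nu> \<phi> (\<lambda>n. g (lam n) * coef f n) w" by (rule Riesz_Fischer)
  then have ex: "L2_expansion \<nu> \<phi> (\<lambda>n. g (lam n) * coef f n) (spectral_op \<nu> \<phi> lam g f)"
    unfolding spectral_op_def by (rule someI_ex)
  then show "spectral_op \<nu> \<phi> lam g f \<in> L2 \<nu>" by (simp add: expansion_iff)
  show "coef (spectral_op \<nu> \<phi> lam g f) n = g (lam n) * coef f n" by (rule expansion_coeff[OF ex])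
qed

text \<open>Multiplying or dividing coefficients by \<open>wt (s/2)\<close> translates between
  Bessel potentials of L^2 functions and weighted summability; Riesz-Fischer produces the function
  \<open>v\<close> whose potential is \<open>u\<close>.\<close>

lemma Hs_iff:
  assumes s: "0 \<le> s"
  shows "u \<in> H s \<longleftrightarrow> u \<in> L2 \<nu> \<and> hsummable s u"
proof -
  define g where "g l = complex_of_real ((1 + l) powr (- s / 2))" for l
  have g1: "cmod (g l) \<le> 1" if "0 \<le> l" for l
  proof -
    have "(1 + l) powr (- s / 2) \<le> (1 + l) powr 0" using that s by (intro powr_mono) auto
    then show ?thesis using that by (simp add: g_def)
  qed
  have gw: "g (lam n) = of_real (wt (- (s / 2)) n)" for n by (simp add: g_def wt_def)
  note sp = spectral_op_props[where g = g, OF _ g1]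
  show ?thesis
  proof
    assume "u \<in> H s"
    then obtain v where v: "u \<in> L2 \<nu>" "v \<in> L2 \<nu>" "AE x in \<nu>. u x = spectral_op \<nu> \<phi> lam g v x"
      unfolding Hs_def g_def by auto
    have "coef u n = g (lam n) * coef v n" for n
      using coef_cong_AE[OF v(1) sp(1)[OF v(2)] v(3)] sp(2)[OF v(2)] by simp
    then have "wt s n * (cmod (coef u n))\<^sup>2 = (wt (- (s/2)) n * wt (s/2) n)\<^sup>2 * (cmod (coef v n))\<^sup>2" for n
      by (simp add: gw norm_mult power_mult_distrib wt_half)
    then have "wt s n * (cmod (coef u n))\<^sup>2 = (cmod (coef v n))\<^sup>2" for n
      by (simp add: wt_minus)
    then show "u \<in> L2 \<nu> \<and> hsummable s u"
      using v(1) sums_summable[OF Parseval[OF v(2)]] by (simp add: hsummable_def)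
  next
    assume u: "u \<in> L2 \<nu> \<and> hsummable s u"
    define c where "c n = of_real (wt (s/2) n) * coef u n" for n
    have "summable (\<lambda>n. (cmod (c n))\<^sup>2)"
      using u by (simp add: c_def hsummable_def norm_mult power_mult_distrib wt_half)
    then obtain v where v: "L2_expansion \<nu> \<phi> c v" using Riesz_Fischer by blast
    then have vL: "v \<in> L2 \<nu>" by (simp add: expansion_iff)
    have "AE x in \<nu>. u x = spectral_op \<nu> \<phi> lam g v x"
    proof (rule coeff_eq_AE)
      fix n
      have "g (lam n) * c n = of_real (wt (- (s/2)) n * wt (s/2) n) * coef u n" by (simp add: gw c_def)
      then show "coef u n = coef (spectral_op \<nu> \<phi> lam g v) n"
        by (simp only: sp(2)[OF vL] expansion_coeff[OF v] wt_minus) simp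
    qed (use u sp(1)[OF vL] in auto)
    then show "u \<in> H s" using u vL unfolding Hs_def g_def by auto
  qed
qed

text \<open>The norm restricted to finitely many coefficients. It is a seminorm on all of
  \<open>L2\<close>, dominated by a multiple of the L^2 norm, so bounds on it pass through
  L^2-convergent Riemann sums. Bounds uniform in \<open>N\<close> give back both
  \<open>hsummable\<close> and \<open>nrm\<close>.\<close>

definition hn :: "real \<Rightarrow> nat \<Rightarrow> (real^2 \<Rightarrow> complex) \<Rightarrow> real" where
  "hn s N u = L2_set (\<lambda>n. wt (s/2) n * cmod (coef u n)) {..<N}"

lemma hn_nonneg [simp]: "0 \<le> hn s N u"
  by (simp add: hn_def)

lemma hn_power2: "(hn s N u)\<^sup>2 = (\<Sum>n<N. wt s n * (cmod (coef u n))\<^sup>2)"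
  by (simp add: hn_def L2_set_def power_mult_distrib wt_half sum_nonneg less_imp_le)

lemma hn_le_nrm:
  assumes "hsummable s u" shows "hn s N u \<le> nrm s u"
proof -
  have "(\<Sum>n<N. wt s n * (cmod (coef u n))\<^sup>2) \<le> (\<Sum>n. wt s n * (cmod (coef u n))\<^sup>2)"
    using assms unfolding hsummable_def by (intro sum_le_suminf) (auto simp: less_imp_le)
  then show ?thesis unfolding nrm_eq hn_power2[symmetric] by (intro real_le_rsqrt)
qed

lemma nrm_nonneg [simp]: "0 \<le> nrm s u" if "hsummable s u"
  using hn_le_nrm[OF that, of 0] hn_nonneg[of s 0 u] by linarith

lemma nrm_le:
  assumes "0 \<le> B" "\<And>N. hn s N u \<le> B" shows "hsummable s u" "nrm s u \<le> B"
proof -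
  have bd: "(\<Sum>n<N. wt s n * (cmod (coef u n))\<^sup>2) \<le> B\<^sup>2" for N
    unfolding hn_power2[symmetric] using assms(2) by (intro power_mono) auto
  show h: "hsummable s u"
    unfolding hsummable_def
  proof (rule bounded_imp_summable)
    show "(\<Sum>k\<le>n. wt s k * (cmod (coef u k))\<^sup>2) \<le> B\<^sup>2" for n
      using bd[of "Suc n"] by (simp only: lessThan_Suc_atMost)
  qed (simp add: less_imp_le)
  have "(\<Sum>n. wt s n * (cmod (coef u n))\<^sup>2) \<le> B\<^sup>2"
    using h bd unfolding hsummable_def by (intro suminf_le_const)
  then show "nrm s u \<le> B" unfolding nrm_eq using assms(1) by (intro real_le_lsqrt) auto
qed

lemma hn_add: "u \<in> L2 \<nu> \<Longrightarrow> v \<in> L2 \<nu> \<Longrightarrow> hn s N (\<lambda>x. u x + v x) \<le> hn s N u + hn s N v"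
proof -
  assume "u \<in> L2 \<nu>" "v \<in> L2 \<nu>"
  then have c: "coef (\<lambda>x. u x + v x) n = coef u n + coef v n" for n
    by (simp add: L2_inner_add_left basis_L2)
  have "hn s N (\<lambda>x. u x + v x) \<le> L2_set (\<lambda>n. wt (s/2) n * cmod (coef u n) + wt (s/2) n * cmod (coef v n)) {..<N}"
    unfolding hn_def c distrib_left[symmetric]
    by (intro L2_set_mono mult_left_mono norm_triangle_ineq) (auto simp: less_imp_le)
  also have "\<dots> \<le> hn s N u + hn s N v" unfolding hn_def by (rule L2_set_triangle_ineq)
  finally show ?thesis .
qed

lemma hn_scale: "hn s N (\<lambda>x. c * u x) = cmod c * hn s N u"
  by (simp add: hn_def L2_inner_scale_left norm_mult L2_set_right_distrib mult.left_commute)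

lemma Hs_add:
  assumes "0 \<le> s" "u \<in> H s" "v \<in> H s"
  shows "(\<lambda>x. u x + v x) \<in> H s" "nrm s (\<lambda>x. u x + v x) \<le> nrm s u + nrm s v"
proof -
  have uv: "u \<in> L2 \<nu>" "v \<in> L2 \<nu>" "hsummable s u" "hsummable s v" using assms by (simp_all add: Hs_iff)
  have "hn s N (\<lambda>x. u x + v x) \<le> nrm s u + nrm s v" for N
    using hn_add[OF uv(1,2), of s N] hn_le_nrm[OF uv(3), of N] hn_le_nrm[OF uv(4), of N] by linarith
  note * = nrm_le[OF _ this]
  show "(\<lambda>x. u x + v x) \<in> H s" "nrm s (\<lambda>x. u x + v x) \<le> nrm s u + nrm s v"
    using * uv assms(1) by (auto simp: Hs_iff L2_add)
qed

text \<open>Without summability \<^const>\<open>suminf\<close> is a junk value, hence the hypothesis.\<close>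

lemma nrm_scale:
  assumes "hsummable s u" shows "nrm s (\<lambda>x. c * u x) = cmod c * nrm s u"
proof -
  have "(\<lambda>n. wt s n * (cmod (coef (\<lambda>x. c * u x) n))\<^sup>2) = (\<lambda>n. (cmod c)\<^sup>2 * (wt s n * (cmod (coef u n))\<^sup>2))"
    by (simp add: L2_inner_scale_left norm_mult power_mult_distrib mult_ac)
  then have "(\<Sum>n. wt s n * (cmod (coef (\<lambda>x. c * u x) n))\<^sup>2) = (cmod c)\<^sup>2 * (\<Sum>n. wt s n * (cmod (coef u n))\<^sup>2)"
    using assms by (simp only: suminf_mult hsummable_def)
  then show ?thesis by (simp add: nrm_eq real_sqrt_mult)
qed

lemma Hs_scale: "0 \<le> s \<Longrightarrow> u \<in> H s \<Longrightarrow> (\<lambda>x. c * u x) \<in> H s"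
proof -
  assume s: "0 \<le> s" and "u \<in> H s"
  then have u: "u \<in> L2 \<nu>" "hsummable s u" by (simp_all add: Hs_iff)
  have "summable (\<lambda>n. (cmod c)\<^sup>2 * (wt s n * (cmod (coef u n))\<^sup>2))"
    using u(2) unfolding hsummable_def by (rule summable_mult)
  then have "hsummable s (\<lambda>x. c * u x)"
    by (simp add: hsummable_def L2_inner_scale_left norm_mult power_mult_distrib mult_ac)
  then show ?thesis using s u(1) by (simp add: Hs_iff L2_scale)
qed

lemma Hs_diff:
  assumes "0 \<le> s" "u \<in> H s" "v \<in> H s"
  shows "(\<lambda>x. u x - v x) \<in> H s" "nrm s (\<lambda>x. u x - v x) \<le> nrm s u + nrm s v"
  using Hs_add[OF assms(1,2) Hs_scale[OF assms(1,3), of "-1"]] nrm_scale[of s v "-1"] assms by (simp_all add: Hs_iff)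

lemma nrm_cong_AE:
  assumes "u \<in> L2 \<nu>" "v \<in> L2 \<nu>" "AE x in \<nu>. u x = v x"
  shows "nrm s u = nrm s v"
  unfolding nrm_eq using coef_cong_AE[OF assms] by simp

lemma eigf_Hs:
  assumes u: "eigf l u" and s: "0 \<le> s"
  shows "u \<in> H s" "nrm s u = (1 + l) powr (s/2) * L2_norm \<nu> u"
proof -
  have uL: "u \<in> L2 \<nu>" using u by (auto simp: eigf_def intro: dom_L2)
  have eq: "wt s n * (cmod (coef u n))\<^sup>2 = (1 + l) powr s * (cmod (coef u n))\<^sup>2" for n
    using eigf_coef[OF u, of n] by (cases "coef u n = 0") (auto simp: wt_def)
  then have sm: "(\<lambda>n. wt s n * (cmod (coef u n))\<^sup>2) sums ((1 + l) powr s * (L2_norm \<nu> u)\<^sup>2)"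
    using sums_mult[OF Parseval[OF uL], of "(1 + l) powr s"] by (simp only: eq)
  then show "u \<in> H s" using s uL by (auto simp: Hs_iff hsummable_def intro: sums_summable)
  have "(1 + l) powr s * (L2_norm \<nu> u)\<^sup>2 = ((1 + l) powr (s/2) * L2_norm \<nu> u)\<^sup>2"
    unfolding power_mult_distrib power2_eq_square[of "(1 + l) powr (s/2)"] powr_add[symmetric] by simp
  then show "nrm s u = (1 + l) powr (s/2) * L2_norm \<nu> u"
    unfolding nrm_eq sums_unique[OF sm, symmetric] by (simp only: real_sqrt_unique) (simp add: real_sqrt_abs)
qed

text \<open>Duality between H^s and H^(-s): the weight is constant on the coefficients that
  \<open>u\<close> carries, so the negative-order norm of \<open>u\<close> is explicit.\<close>

lemma eigf_pairing:
  assumes u: "eigf l u" and l: "0 \<le> l" and s: "0 \<le> s" and y: "y \<in> H s"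
  shows "cmod (L2_inner \<nu> y u) \<le> (1 + l) powr (- (s/2)) * nrm s y * L2_norm \<nu> u"
proof -
  have uL: "u \<in> L2 \<nu>" using u by (auto simp: eigf_def intro: dom_L2)
  have yL: "y \<in> L2 \<nu>" "hsummable s y" using y s by (simp_all add: Hs_iff)
  have bd: "cmod (\<Sum>n<N. coef y n * cnj (coef u n)) \<le> (1 + l) powr (- (s/2)) * nrm s y * L2_norm \<nu> u" for N
  proof -
    have "cmod (\<Sum>n<N. coef y n * cnj (coef u n)) \<le> (\<Sum>n<N. (1 + l) powr (- (s/2)) * (\<bar>wt (s/2) n * cmod (coef y n)\<bar> * \<bar>cmod (coef u n)\<bar>))"
    proof (rule sum_norm_le)
      fix n
      show "cmod (coef y n * cnj (coef u n)) \<le> (1 + l) powr (- (s/2)) * (\<bar>wt (s/2) n * cmod (coef y n)\<bar> * \<bar>cmod (coef u n)\<bar>)"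
      proof (cases "coef u n = 0")
        case False
        then have "lam n = l" using eigf_coef[OF u] by blast
        then have "(1 + l) powr (- (s/2)) * wt (s/2) n = 1" using wt_minus[of "s/2" n] by (simp add: wt_def)
        then have "(1 + l) powr (- (s/2)) * (wt (s/2) n * cmod (coef y n) * cmod (coef u n)) = cmod (coef y n) * cmod (coef u n)"
          by (simp add: mult.assoc[symmetric])
        then have "(1 + l) powr (- (s/2)) * (\<bar>wt (s/2) n * cmod (coef y n)\<bar> * \<bar>cmod (coef u n)\<bar>) = cmod (coef y n) * cmod (coef u n)"
          by (simp only: abs_mult abs_norm_cancel abs_of_pos[OF wt_pos])
        then show ?thesis by (simp only: norm_mult complex_mod_cnj order_refl)
      qed simp
    qed
    also have "\<dots> = (1 + l) powr (- (s/2)) * (\<Sum>n<N. \<bar>wt (s/2) n * cmod (coef y n)\<bar> * \<bar>cmod (coef u n)\<bar>)"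
      by (simp add: sum_distrib_left)
    also have "\<dots> \<le> (1 + l) powr (- (s/2)) * (hn s N y * L2_set (\<lambda>n. cmod (coef u n)) {..<N})"
      unfolding hn_def by (intro mult_left_mono L2_set_mult_ineq) simp
    also have "\<dots> \<le> (1 + l) powr (- (s/2)) * (nrm s y * L2_norm \<nu> u)"
    proof (intro mult_left_mono mult_mono)
      show "L2_set (\<lambda>n. cmod (coef u n)) {..<N} \<le> L2_norm \<nu> u"
        unfolding L2_set_def using sum_le_suminf[OF sums_summable[OF Parseval[OF uL]], of "{..<N}"]
          sums_unique[OF Parseval[OF uL]] by (intro real_le_lsqrt) auto
    qed (use hn_le_nrm[OF yL(2)] nrm_nonneg[OF yL(2)] in auto)
    finally show ?thesis by (simp add: mult.assoc)
  qed
  have "(\<lambda>N. cmod (\<Sum>n<N. coef y n * cnj (coef u n))) \<longlonglongrightarrow> cmod (L2_inner \<nu> y u)"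
    using inner_sums[OF yL(1) uL] unfolding sums_def by (rule tendsto_norm)
  then show ?thesis using bd by (intro LIMSEQ_le_const2) blast+
qed

section \<open>Identification of H^1 with the form domain\<close>

lemma dom_Hs1:
  assumes f: "f \<in> dom"
  shows "f \<in> H 1" "(nrm 1 f)\<^sup>2 \<le> (L2_norm \<nu> f)\<^sup>2 + Re (energy p f f)"
proof -
  define B where "B = sqrt ((L2_norm \<nu> f)\<^sup>2 + Re (energy p f f))"
  have B2: "B\<^sup>2 = (L2_norm \<nu> f)\<^sup>2 + Re (energy p f f)" and B0: "0 \<le> B"
    using energy_nonneg[OF f] by (simp_all add: B_def)
  have "hn 1 N f \<le> B" for N
  proof (rule power2_le_imp_le[OF _ B0])
    have "(hn 1 N f)\<^sup>2 = (\<Sum>n<N. (cmod (coef f n))\<^sup>2) + (\<Sum>n<N. lam n * (cmod (coef f n))\<^sup>2)"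
      by (simp add: hn_power2 wt_1 distrib_right sum.distrib)
    moreover have "(\<Sum>n<N. (cmod (coef f n))\<^sup>2) \<le> (L2_norm \<nu> f)\<^sup>2"
      using sum_le_suminf[OF sums_summable[OF Parseval[OF dom_L2[OF f]]], of "{..<N}"]
        sums_unique[OF Parseval[OF dom_L2[OF f]]] by simp
    ultimately show "(hn 1 N f)\<^sup>2 \<le> B\<^sup>2" using energy_Bessel[OF f, of N] B2 by linarith
  qed
  note * = nrm_le[OF B0 this]
  show "f \<in> H 1" using *(1) dom_L2[OF f] by (simp add: Hs_iff)
  show "(nrm 1 f)\<^sup>2 \<le> (L2_norm \<nu> f)\<^sup>2 + Re (energy p f f)"
    using *(2) nrm_nonneg[OF *(1)] unfolding B2[symmetric] by (intro power_mono)
qed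

text \<open>Blocks of the eigenfunction series are small in the form norm, hence by
  \<open>sup_bound\<close> in the uniform norm. The partial sums converge uniformly on the gasket,
  and the limit is the continuous representative.\<close>

lemma H1_embedding:
  assumes u: "u \<in> H 1"
  shows "\<exists>v\<in>dom. (AE x in \<nu>. u x = v x) \<and> (\<forall>x\<in>G. cmod (v x) \<le> 30 * nrm 1 u) \<and> Re (energy p v v) \<le> (nrm 1 u)\<^sup>2"
proof -
  define c where "c = coef u"
  define f where "f N = psum {..<N} c" for N
  define a where "a n = wt 1 n * (cmod (c n))\<^sup>2" for n
  have uL: "u \<in> L2 \<nu>" and h: "hsummable 1 u" using u by (simp_all add: Hs_iff)
  have sa: "summable a" using h by (simp add: a_def[abs_def] hsummable_def c_def)
  have a0: "0 \<le> a n" for n by (simp add: a_def less_imp_le)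
  have fdom: "f N \<in> dom" for N by (simp add: f_def psum_dom)
  have sup: "(cmod (psum I c x))\<^sup>2 \<le> 800 * sum a I" if "finite I" "x \<in> G" for I x
    using sup_bound[OF psum_dom that(2), of I c] norm_psum[OF that(1), of c] energy_psum[OF that(1), of c]
    by (simp add: a_def wt_1 distrib_right sum.distrib)
  have suma: "sum a {..<N} \<le> (nrm 1 u)\<^sup>2" for N
    using power_mono[OF hn_le_nrm[OF h, of N], of 2] by (simp add: hn_power2 a_def c_def)
  have "uniformly_Cauchy_on G f"
    unfolding uniformly_Cauchy_on_def
  proof (intro allI impI)
    fix e :: real assume e: "e > 0"
    then have "e\<^sup>2 / 800 > 0" by simp
    then obtain N where N: "\<And>m n. m \<ge> N \<Longrightarrow> norm (sum a {m..<n}) < e\<^sup>2 / 800"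
      using sa unfolding summable_Cauchy by metis
    have *: "dist (f m x) (f n x) < e" if "x \<in> G" "N \<le> m" "m \<le> n" for x m n
    proof -
      have "{..<n} = {..<m} \<union> {m..<n}" using that by auto
      moreover have "psum ({..<m} \<union> {m..<n}) c x = psum {..<m} c x + psum {m..<n} c x"
        unfolding psum_def by (rule sum.union_disjoint) auto
      ultimately have "dist (f m x) (f n x) = cmod (psum {m..<n} c x)"
        by (simp add: f_def dist_norm)
      moreover have "(cmod (psum {m..<n} c x))\<^sup>2 < e\<^sup>2"
        using sup[of "{m..<n}" x] N[OF that(2), of n] that(1) by simp
      ultimately show ?thesis using e by (metis less_imp_le power2_less_imp_less)
    qed
    have "dist (f m x) (f n x) < e" if "x \<in> G" "N \<le> m" "N \<le> n" for x m n
      using *[OF that(1,2), of n] *[OF that(1,3), of m] by (cases "m \<le> n") (auto simp: dist_commute)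
    then show "\<exists>M. \<forall>x\<in>G. \<forall>m\<ge>M. \<forall>n\<ge>M. dist (f m x) (f n x) < e" by blast
  qed
  then have "uniformly_convergent_on G f" by (rule Cauchy_uniformly_convergent)
  then obtain v where v: "uniform_limit G f v sequentially" by (auto simp: uniformly_convergent_on_def)
  have vc: "continuous_on G v"
    by (rule uniform_limit_theorem[OF _ v]) (use fdom dom_continuous in auto)
  have ptw: "(\<lambda>N. f N x) \<longlonglongrightarrow> v x" if "x \<in> G" for x using tendsto_uniform_limitI[OF v that] .
  have enr_le: "enr m v \<le> (nrm 1 u)\<^sup>2" for m
  proof -
    \<comment> \<open>For fixed \<open>m\<close> this is a finite sum over edges, so pointwise
      convergence is enough; the bound is uniform in \<open>m\<close> and \<open>N\<close> and
      survives the limit.\<close>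
    have "(\<lambda>N. enr m (f N)) \<longlonglongrightarrow> enr m v"
      unfolding enr_def case_prod_unfold using edges_SG
      by (intro tendsto_intros ptw) auto
    moreover have "enr m (f N) \<le> (nrm 1 u)\<^sup>2" for N
    proof -
      have "(\<Sum>n<N. lam n * (cmod (c n))\<^sup>2) \<le> sum a {..<N}"
        by (intro sum_mono) (simp add: a_def wt_1 distrib_right)
      then show ?thesis
        using enr_le_energy[OF fdom, of m N] energy_psum[of "{..<N}" c] suma[of N] by (simp add: f_def)
    qed
    ultimately show ?thesis by (intro LIMSEQ_le_const2) blast+
  qed
  have vdom: "v \<in> dom" by (rule domI[OF vc enr_le])
  moreover have "AE x in \<nu>. u x = v x"
  proof (rule coeff_eq_AE[OF uL dom_L2[OF vdom]])
    have "L2_expansion \<nu> \<phi> c v"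
      unfolding expansion_iff
    proof (intro conjI dom_L2[OF vdom] LIMSEQ_I)
      fix e :: real assume e: "e > 0"
      then have "\<forall>\<^sub>F n in sequentially. \<forall>x\<in>G. dist (f n x) (v x) < e/2"
        using v unfolding uniform_limit_iff by (meson half_gt_zero)
      then obtain N where N: "\<And>n x. n \<ge> N \<Longrightarrow> x \<in> G \<Longrightarrow> dist (f n x) (v x) < e/2"
        by (auto simp: eventually_sequentially)
      have "L2_norm \<nu> (\<lambda>x. v x - psum {..<n} c x) \<le> e/2" if "n \<ge> N" for n
      proof (rule L2_norm_le_sup)
        show "continuous_on G (\<lambda>x. v x - psum {..<n} c x)"
          by (intro continuous_intros vc dom_continuous psum_dom)
        show "cmod (v x - psum {..<n} c x) \<le> e/2" if "x \<in> G" for x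
          using N[OF \<open>n \<ge> N\<close> that] by (simp add: f_def dist_norm norm_minus_commute)
      qed (use e in simp)
      then show "\<exists>N. \<forall>n\<ge>N. norm (L2_norm \<nu> (\<lambda>x. v x - psum {..<n} c x) - 0) < e"
        using e by (intro exI[of _ N]) (force simp: abs_of_nonneg)
    qed
    then show "coef u n = coef v n" for n using expansion_coeff by (simp add: c_def)
  qed
  moreover have "cmod (v x) \<le> 30 * nrm 1 u" if x: "x \<in> G" for x
  proof (rule LIMSEQ_le_const2[OF tendsto_norm[OF ptw[OF x]]])
    have "cmod (f N x) \<le> 30 * nrm 1 u" for N
    proof (rule power2_le_imp_le)
      have "(cmod (f N x))\<^sup>2 \<le> 800 * (nrm 1 u)\<^sup>2"
        using sup[of "{..<N}" x] suma[of N] x by (simp add: f_def)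
      \<comment> \<open>The constant 30 is chosen because its square, 900, exceeds the 800 of
        \<open>sup_bound\<close>.\<close>
      also have "\<dots> \<le> (30 * nrm 1 u)\<^sup>2" by (simp add: power_mult_distrib)
      finally show "(cmod (f N x))\<^sup>2 \<le> (30 * nrm 1 u)\<^sup>2" .
    qed (use nrm_nonneg[OF h] in simp)
    then show "\<exists>N. \<forall>n\<ge>N. cmod (f n x) \<le> 30 * nrm 1 u" by blast
  qed
  moreover have "Re (energy p v v) \<le> (nrm 1 u)\<^sup>2" by (rule energy_le[OF vdom enr_le])
  ultimately show ?thesis by blast
qed

end

section \<open>Localized eigenfunctions\<close>

context gasket
begin

lemma L2_inner_perm:
  assumes "continuous_on G u" "continuous_on G v" "\<sigma> permutes {..<3}"
  shows "L2_inner \<nu> (\<lambda>x. u (perm_map \<sigma> x)) v = L2_inner \<nu> u (\<lambda>x. v (perm_map (inv \<sigma>) x))"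
proof -
  have inv: "inv \<sigma> permutes {..<3}" using assms(3) by (rule permutes_inv)
  define f where "f x = u x * cnj (v (perm_map (inv \<sigma>) x))" for x
  have "continuous_on G f"
    unfolding f_def using perm_map_SG[OF inv]
    by (intro continuous_intros assms(1) continuous_on_compose2[OF assms(2)]) auto
  then have *: "(LINT x|\<nu>. f (perm_map \<sigma> x)) = integral\<^sup>L \<nu> f" using assms(3) by (rule integral_perm)
  have "L2_inner \<nu> (\<lambda>x. u (perm_map \<sigma> x)) v = (LINT x|\<nu>. f (perm_map \<sigma> x))"
    unfolding L2_inner_def
    by (rule Bochner_Integration.integral_cong) (simp_all add: f_def perm_map_inv[OF assms(3)] SG_tri)
  also have "\<dots> = L2_inner \<nu> u (\<lambda>x. v (perm_map (inv \<sigma>) x))"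
    unfolding * by (simp only: L2_inner_def f_def[abs_def])
  finally show ?thesis .
qed

section \<open>Antisymmetrization under the symmetric group of the triangle\<close>

definition antisym :: "(real^2 \<Rightarrow> complex) \<Rightarrow> real^2 \<Rightarrow> complex" where
  "antisym u x = (\<Sum>\<sigma> | \<sigma> permutes {..<3}. of_int (sign \<sigma>) * u (perm_map \<sigma> x))"

lemma antisym_dom: "u \<in> dom \<Longrightarrow> antisym u \<in> dom"
  unfolding antisym_def by (intro dom_sum dom_scale dom_perm) auto

text \<open>\<open>p i\<close> is fixed by the reflection \<open>\<tau>\<close> that exchanges the
  other two vertices. Composing with it flips every sign and leaves the evaluation points alone, so
  the sum equals its own negative.\<close>

lemma antisym_vertex:
  assumes "i < 3" shows "antisym u (p i) = 0"
proof -
  define S where "S = {\<sigma>. \<sigma> permutes {..<3::nat}}"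
  obtain j k where jk: "j < 3" "k < 3" "j \<noteq> k" "i \<noteq> j" "i \<noteq> k"
  proof -
    have "i = 0 \<or> i = 1 \<or> i = 2" using assms by auto
    then show ?thesis using that[of 1 2] that[of 0 2] that[of 0 1] by auto
  qed
  define \<tau> where "\<tau> = Transposition.transpose j k"
  have \<tau>: "\<tau> permutes {..<3}" unfolding \<tau>_def using jk by (intro permutes_swap_id) auto
  have \<tau>i: "\<tau> i = i" using jk by (simp add: \<tau>_def transpose_def)
  have s\<tau>: "sign \<tau> = - 1" using jk by (simp add: \<tau>_def sign_swap_id)
  have "(\<Sum>\<sigma>\<in>S. of_int (sign \<sigma>) * u (p (\<sigma> i))) = (\<Sum>\<sigma>\<in>S. of_int (sign (\<sigma> \<circ> \<tau>)) * u (p ((\<sigma> \<circ> \<tau>) i)))"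
    unfolding S_def by (rule sum_permutations_compose_right[OF \<tau>])
  also have "\<dots> = (\<Sum>\<sigma>\<in>S. - (of_int (sign \<sigma>) * u (p (\<sigma> i))))"
  proof (rule sum.cong[OF refl])
    fix \<sigma> assume "\<sigma> \<in> S"
    then have "permutation \<sigma>" "permutation \<tau>" using \<tau> unfolding S_def by (auto intro: permutation_permutes[THEN iffD2])
    then show "of_int (sign (\<sigma> \<circ> \<tau>)) * u (p ((\<sigma> \<circ> \<tau>) i)) = - (of_int (sign \<sigma>) * u (p (\<sigma> i)))"
      by (simp add: sign_compose s\<tau> \<tau>i)
  qed
  also have "\<dots> = - (\<Sum>\<sigma>\<in>S. of_int (sign \<sigma>) * u (p (\<sigma> i)))" by (rule sum_negf)
  finally have "(\<Sum>\<sigma>\<in>S. of_int (sign \<sigma>) * u (p (\<sigma> i))) = 0" by simp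
  moreover have "antisym u (p i) = (\<Sum>\<sigma>\<in>S. of_int (sign \<sigma>) * u (p (\<sigma> i)))"
    unfolding antisym_def S_def using assms by (simp add: perm_map_vertex)
  ultimately show ?thesis by simp
qed

text \<open>Moving the antisymmetrizer to the second argument serves twice: to test the eigenvalue
  equation, and to show that not every \<open>antisym (\<phi> n)\<close> vanishes.\<close>

lemma L2_inner_antisym:
  assumes u: "continuous_on G u" and v: "continuous_on G v"
  shows "L2_inner \<nu> (antisym u) v = (\<Sum>\<sigma> | \<sigma> permutes {..<3}. of_int (sign \<sigma>) * L2_inner \<nu> u (\<lambda>x. v (perm_map (inv \<sigma>) x)))"
proof -
  have "L2_inner \<nu> (antisym u) v = (\<Sum>\<sigma> | \<sigma> permutes {..<3}. L2_inner \<nu> (\<lambda>x. of_int (sign \<sigma>) * u (perm_map \<sigma> x)) v)"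
    unfolding antisym_def
    by (intro L2_inner_sum_left continuous_L2 v continuous_intros continuous_on_compose2[OF u]) auto
  then show ?thesis by (simp add: L2_inner_scale_left L2_inner_perm[OF u v])
qed

lemma energy_antisym:
  assumes u: "u \<in> dom" and v: "v \<in> dom"
  shows "energy p (antisym u) v = (\<Sum>\<sigma> | \<sigma> permutes {..<3}. of_int (sign \<sigma>) * energy p u (\<lambda>x. v (perm_map (inv \<sigma>) x)))"
proof -
  have "energy p (antisym u) v = (\<Sum>\<sigma> | \<sigma> permutes {..<3}. energy p (\<lambda>x. of_int (sign \<sigma>) * u (perm_map \<sigma> x)) v)"
    unfolding antisym_def using u v by (intro energy_sum_left dom_scale dom_perm) auto
  then show ?thesis using u v by (simp add: energy_scale_left dom_perm energy_perm)
qed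

section \<open>Copying a function into the cell at \<open>p 0\<close>\<close>

definition localize :: "(real^2 \<Rightarrow> complex) \<Rightarrow> real^2 \<Rightarrow> complex" where
  "localize u x = (if x \<in> F 0 ` G then u (2 *\<^sub>R x - p 0) else 0)"

lemma contraction_inverse: "2 *\<^sub>R F i y - p i = y"
  by (simp add: contraction_eq scaleR_right_distrib)

lemma localize_0 [simp]: "y \<in> G \<Longrightarrow> localize u (F 0 y) = u y"
proof -
  assume "y \<in> G"
  moreover have "2 *\<^sub>R F 0 y - p 0 = y" by (rule contraction_inverse)
  ultimately show ?thesis by (auto simp: localize_def)
qed

definition dirichlet :: "(real^2 \<Rightarrow> complex) \<Rightarrow> bool" where
  "dirichlet u \<longleftrightarrow> (\<forall>i<3. u (p i) = 0)"

text \<open>A point of another cell that also lies in cell 0 is the image of a corner, where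
  \<open>u\<close> vanishes, so the two branches of \<open>localize\<close> agree there.\<close>

lemma localize_other: 
  assumes u: "dirichlet u" and i: "0 < i" "i < 3" and y: "y \<in> G"
  shows "localize u (F i y) = 0"
proof (cases "F i y \<in> F 0 ` G")
  case True
  then obtain z where z: "z \<in> G" "F i y = F 0 z" by auto
  then have "z = p i" using cells_meet[of 0 i z y] i y by simp
  then show ?thesis using u i z by (simp add: dirichlet_def)
qed (simp add: localize_def)

lemma dirichlet_localize: 
  assumes u: "dirichlet u" shows "dirichlet (localize u)"
  unfolding dirichlet_def
proof (intro allI impI)
  fix i :: nat assume i: "i < 3"
  show "localize u (p i) = 0"
  proof (cases "i = 0")
    case True
    then show ?thesis using localize_0[of "p 0" u] u by (simp add: dirichlet_def)
  next
    case False
    then show ?thesis using localize_other[OF u _ i, of "p i"] i by simp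
  qed
qed

lemma continuous_localize:
  assumes u: "dirichlet u" "continuous_on G u" shows "continuous_on G (localize u)"
proof -
  define A B where "A = F 0 ` G" and "B = F 1 ` G \<union> F 2 ` G"
  have cl: "closed (F i ` G)" for i
    by (intro compact_imp_closed compact_continuous_image continuous_intros SG_props)
  have "continuous_on A (\<lambda>x. u (2 *\<^sub>R x - p 0))"
    by (intro continuous_on_compose2[OF u(2)] continuous_intros) (auto simp: A_def contraction_inverse)
  then have A: "continuous_on A (localize u)"
    by (rule continuous_on_cong[THEN iffD1, rotated 2]) (auto simp: A_def localize_def)
  have "continuous_on B (\<lambda>x. 0 :: complex)" by (intro continuous_intros)
  then have B: "continuous_on B (localize u)"
    by (rule continuous_on_cong[THEN iffD1, rotated 2])
      (auto simp: B_def localize_other[OF u(1), of 1] localize_other[OF u(1), of 2] simp del: One_nat_def)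
  have "G = A \<union> B"
    using SG_props(3) by (simp add: gasket_step_def UN_less_3 A_def B_def Un_assoc)
  then show ?thesis
    using continuous_on_closed_Un[OF _ _ A B] cl unfolding A_def B_def by (metis closed_Un)
qed

text \<open>Graph energies split over the three cells, and the copy vanishes on two of them, corners
  included. So \<open>v\<close> enters only through its restriction to cell 0, without boundary
  terms.\<close>

lemma en_localize:
  assumes u: "dirichlet u"
  shows "en (Suc m) (localize u) v = (5/3) * en m u (\<lambda>x. v (F 0 x))"
proof -
  have "graph_energy p m (\<lambda>x. localize u (F i x)) (\<lambda>x. v (F i x))
    = (if i = 0 then graph_energy p m u (\<lambda>x. v (F 0 x)) else 0)" if i: "i < 3" for i
  proof (cases "i = 0")
    case True
    then show ?thesis by (auto intro!: graph_energy_cong)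
  next
    case False
    then have "graph_energy p m (\<lambda>x. localize u (F i x)) (\<lambda>x. v (F i x))
      = graph_energy p m (\<lambda>x. 0) (\<lambda>x. v (F i x))"
      using i by (intro graph_energy_cong) (simp_all add: localize_other[OF u])
    then show ?thesis using False by (simp add: graph_energy_def)
  qed
  then show ?thesis by (simp add: en_def graph_energy_Suc)
qed

lemma localize_dom:
  assumes u: "dirichlet u" "u \<in> dom" shows "localize u \<in> dom"
proof (rule domI)
  show "continuous_on G (localize u)" using u by (intro continuous_localize dom_continuous)
  fix m
  have "enr (Suc m) (localize u) = (5/3) * enr m u"
  proof -
    have "en (Suc m) (localize u) (localize u) = (5/3) * en m u u"
      unfolding en_localize[OF u(1)] by (intro arg_cong[of _ _ "(*) (5/3)"] en_cong) auto
    then have "complex_of_real (enr (Suc m) (localize u)) = complex_of_real ((5/3) * enr m u)"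
      by (simp add: en_self)
    then show ?thesis by (simp only: of_real_eq_iff)
  qed
  then have "enr (Suc m) (localize u) \<le> (5/3) * Re (energy p u u)"
    using enr_le_energy[OF u(2), of m] by simp
  \<comment> \<open>The scaling identity speaks of levels \<open>Suc m\<close> only; monotonicity
    extends the bound to level 0.\<close>
  then show "enr m (localize u) \<le> (5/3) * Re (energy p u u)"
    using enr_mono_Suc[of m "localize u"] by linarith
qed

lemma energy_localize:
  assumes u: "dirichlet u" "u \<in> dom" and v: "v \<in> dom"
  shows "energy p (localize u) v = (5/3) * energy p u (\<lambda>x. v (F 0 x))"
proof (rule LIMSEQ_unique)
  show "(\<lambda>m. en (Suc m) (localize u) v) \<longlonglongrightarrow> energy p (localize u) v"
    by (intro LIMSEQ_Suc energy_tendsto localize_dom u v)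
  show "(\<lambda>m. en (Suc m) (localize u) v) \<longlonglongrightarrow> (5/3) * energy p u (\<lambda>x. v (F 0 x))"
    unfolding en_localize[OF u(1)] using v by (intro tendsto_intros energy_tendsto u dom_contraction) auto
qed

text \<open>The second argument of \<open>f\<close> lets one statement cover inner products with a
  test function and integrals of powers.\<close>

lemma integral_localize:
  fixes f :: "complex \<Rightarrow> real^2 \<Rightarrow> 'b::{banach, second_countable_topology}"
  assumes u: "dirichlet u" and f: "continuous_on G (\<lambda>x. f (localize u x) x)" "\<And>x. f 0 x = 0"
  shows "(LINT x|\<nu>. f (localize u x) x) = (1/3) *\<^sub>R (LINT x|\<nu>. f (u x) (F 0 x))"
proof -
  have "(LINT x|\<nu>. f (localize u (F i x)) (F i x))
    = (if i = 0 then (LINT x|\<nu>. f (u x) (F 0 x)) else 0)" if i: "i < 3" for i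
  proof (cases "i = 0")
    case True
    then show ?thesis by (auto intro!: Bochner_Integration.integral_cong)
  next
    case False
    then have "(LINT x|\<nu>. f (localize u (F i x)) (F i x)) = (LINT x|\<nu>. 0)"
      using i by (intro Bochner_Integration.integral_cong refl) (simp_all add: localize_other[OF u] f(2))
    then show ?thesis using False by simp
  qed
  then show ?thesis by (simp add: integral_self_similar[OF f(1)])
qed

lemma L2_inner_localize:
  assumes u: "dirichlet u" "continuous_on G u" and v: "continuous_on G v"
  shows "L2_inner \<nu> (localize u) v = (1/3) * L2_inner \<nu> u (\<lambda>x. v (F 0 x))"
  using integral_localize[OF u(1), of "\<lambda>z x. z * cnj (v x)"] continuous_localize[OF u] v
  by (simp add: L2_inner_def scaleR_conv_of_real continuous_on_mult continuous_on_cnj)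

lemma integral_power_localize:
  assumes u: "dirichlet u" "continuous_on G u"
  shows "(LINT x|\<nu>. cmod (localize u x) ^ Suc n) = (1/3) * (LINT x|\<nu>. cmod (u x) ^ Suc n)"
  using integral_localize[OF u(1), of "\<lambda>z x. cmod z ^ Suc n"] continuous_localize[OF u]
  by (simp add: continuous_on_mult continuous_on_power continuous_on_norm)

end

context gasket_eigenbasis
begin

text \<open>Each symmetry preserves the domain, the energy and the measure, so it can be shifted
  onto the test function in the weak equation.\<close>

lemma antisym_eigf:
  assumes u: "eigf l u" shows "eigf l (antisym u)"
proof -
  have dom: "u \<in> dom" using u by (simp add: eigf_def)
  have "energy p (antisym u) v = of_real l * L2_inner \<nu> (antisym u) v" if v: "v \<in> dom" for v
  proof -
    have "energy p u (\<lambda>x. v (perm_map (inv \<sigma>) x)) = of_real l * L2_inner \<nu> u (\<lambda>x. v (perm_map (inv \<sigma>) x))"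
      if "\<sigma> permutes {..<3}" for \<sigma>
      using u v that by (simp add: eigf_def dom_perm permutes_inv)
    then show ?thesis
      using v dom by (simp add: energy_antisym L2_inner_antisym dom_continuous sum_distrib_left mult.left_commute)
  qed
  then show ?thesis using dom by (simp add: eigf_def antisym_dom)
qed

text \<open>
  Antisymmetrizing the monomial \<open>b\<^sub>0 b\<^sub>1\<^sup>2\<close> in the barycentric coordinates gives a Vandermonde
  determinant, which does not vanish at the point \<open>q\<close> with coordinates \<open>(3/4, 1/4, 0)\<close>; so not all
  eigenfunctions can be orthogonal to it.
\<close>

lemma exists_antisymmetric: "\<exists>n. L2_norm \<nu> (antisym (\<phi> n)) \<noteq> 0"
proof (rule ccontr)
  assume neg: "\<not> ?thesis"
  define g where "g x = complex_of_real (bary 0 x * (bary 1 x)\<^sup>2)" for x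
  define h where "h x = (\<Sum>\<sigma> | \<sigma> permutes {..<3}. of_int (sign \<sigma>) * g (perm_map (inv \<sigma>) x))" for x
  have g: "continuous_on S g" for S unfolding g_def by (intro continuous_intros)
  have gp: "continuous_on G (\<lambda>x. g (perm_map \<sigma> x))" for \<sigma>
    by (intro continuous_on_compose2[OF g[of UNIV]] continuous_intros) auto
  have h: "continuous_on G h" unfolding h_def by (intro continuous_intros gp)
  have "coef h n = 0" for n
  proof -
    have "cmod (L2_inner \<nu> (antisym (\<phi> n)) g) \<le> L2_norm \<nu> (antisym (\<phi> n)) * L2_norm \<nu> g"
      by (intro L2_Cauchy_Schwarz dom_L2 antisym_dom eigenfunction_dom continuous_L2 g)
    then have "0 = L2_inner \<nu> (antisym (\<phi> n)) g" using neg by simp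
    also have "\<dots> = (\<Sum>\<sigma> | \<sigma> permutes {..<3}. of_int (sign \<sigma>) * L2_inner \<nu> (\<phi> n) (\<lambda>x. g (perm_map (inv \<sigma>) x)))"
      by (intro L2_inner_antisym dom_continuous eigenfunction_dom g)
    also have "\<dots> = (\<Sum>\<sigma> | \<sigma> permutes {..<3}. L2_inner \<nu> (\<phi> n) (\<lambda>x. of_int (sign \<sigma>) * g (perm_map (inv \<sigma>) x)))"
      by (simp add: L2_inner_scale_right)
    also have "\<dots> = L2_inner \<nu> (\<phi> n) h"
      unfolding h_def
      by (intro L2_inner_sum_right[symmetric] continuous_L2 basis_L2 continuous_intros gp)
    finally show ?thesis using L2_inner_cnj[of \<nu> h "\<phi> n"] by simp
  qed
  then have "AE x in \<nu>. h x = 0"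
    using coeff_eq_AE[OF continuous_L2[OF h] L2_zero] by simp
  then have zero: "h x = 0" if "x \<in> G" for x using continuous_AE_zero[OF h _ that] by simp
  define q where "q = F 0 (F 0 (p 1))"
  have bq: "bary 0 q = 3/4" "bary 1 q = 1/4" "bary 2 q = 0"
    by (simp_all add: q_def bary_contraction bary_vertex)
  define \<tau> :: "nat \<Rightarrow> nat" where "\<tau> = Transposition.transpose 0 1"
  have \<tau>: "\<tau> permutes {..<3}" unfolding \<tau>_def by (intro permutes_swap_id) auto
  have gq: "g (perm_map (inv \<sigma>) q) = of_real (bary (\<sigma> 0) q * (bary (\<sigma> 1) q)\<^sup>2)" if "\<sigma> permutes {..<3}" for \<sigma>
    using that by (simp add: g_def bary_perm_map permutes_inv permutes_inv_inv)
  \<comment> \<open>The third coordinate of \<open>q\<close> is 0, so a nonzero term needs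
    \<open>\<sigma>\<close> to preserve \<open>{0, 1}\<close>. The two surviving values of
    \<open>g\<close> are 3/64 and 9/64, and they enter with opposite signs.\<close>
  have only: "\<sigma> = id \<or> \<sigma> = \<tau>" if \<sigma>: "\<sigma> permutes {..<3}" and nz: "g (perm_map (inv \<sigma>) q) \<noteq> 0" for \<sigma>
  proof -
    have "\<sigma> 0 \<noteq> 2" "\<sigma> 1 \<noteq> 2" using nz bq unfolding gq[OF \<sigma>] by auto
    moreover have "\<sigma> 0 < 3" "\<sigma> 1 < 3" "\<sigma> 2 < 3" using \<sigma> by simp_all
    moreover have "\<sigma> 0 \<noteq> \<sigma> 1" "\<sigma> 0 \<noteq> \<sigma> 2" "\<sigma> 1 \<noteq> \<sigma> 2"
      by (simp_all add: inj_eq[OF permutes_inj[OF \<sigma>]])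
    ultimately consider "\<sigma> 0 = 0" "\<sigma> 1 = 1" "\<sigma> 2 = 2" | "\<sigma> 0 = 1" "\<sigma> 1 = 0" "\<sigma> 2 = 2"
      by linarith
    then show ?thesis
    proof cases
      case 1
      have "\<sigma> i = id i" for i
        using 1 \<sigma> by (cases "i < 3") (auto simp: less_3_cases permutes_def)
      then show ?thesis by blast
    next
      case 2
      have "\<sigma> i = \<tau> i" for i
        using 2 \<sigma> by (cases "i < 3") (auto simp: less_3_cases permutes_def \<tau>_def transpose_def)
      then show ?thesis by blast
    qed
  qed
  have "h q = (\<Sum>\<sigma>\<in>{id, \<tau>}. of_int (sign \<sigma>) * g (perm_map (inv \<sigma>) q))"
    unfolding h_def
  proof (rule sum.mono_neutral_right)
    show "\<forall>\<sigma>\<in>{\<sigma>. \<sigma> permutes {..<3}} - {id, \<tau>}. of_int (sign \<sigma>) * g (perm_map (inv \<sigma>) q) = 0"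
      using only by auto
  qed (use \<tau> in \<open>auto simp: finite_permutations permutes_id\<close>)
  moreover have "id \<noteq> \<tau>" by (metis \<tau>_def id_apply transpose_apply_first zero_neq_one)
  ultimately have "h q = g (perm_map (inv id) q) - g (perm_map (inv \<tau>) q)"
    by (simp add: \<tau>_def sign_swap_id sign_id)
  also have "\<dots> \<noteq> 0"
    using bq unfolding gq[OF permutes_id] gq[OF \<tau>]
    by (simp add: \<tau>_def power2_eq_square complex_eq_iff)
  finally have "h q \<noteq> 0" .
  then show False using zero[of q] by (simp add: q_def)
qed

text \<open>The test function \<open>\<lambda>x. v (F 0 x)\<close> lies in the domain but takes
  arbitrary values at the corners. The equation for \<open>u\<close> applies to it because
  \<open>eigf\<close> tests against the whole domain.\<close>

lemma localize_eigf:
  assumes u: "eigf l u" "dirichlet u" shows "eigf (5 * l) (localize u)"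
proof -
  have dom: "u \<in> dom" using u by (simp add: eigf_def)
  have "energy p (localize u) v = of_real (5 * l) * L2_inner \<nu> (localize u) v" if v: "v \<in> dom" for v
  proof -
    have "energy p u (\<lambda>x. v (F 0 x)) = of_real l * L2_inner \<nu> u (\<lambda>x. v (F 0 x))"
      using u(1) dom_contraction[OF v, of 0] by (simp add: eigf_def)
    then show ?thesis
      unfolding energy_localize[OF u(2) dom v] L2_inner_localize[OF u(2) dom_continuous[OF dom] dom_continuous[OF v]] by simp
  qed
  then show ?thesis using localize_dom[OF u(2) dom] by (simp add: eigf_def)
qed

lemma localized_eigenfunctions:
  "\<exists>l A c. 0 \<le> l \<and> 0 < A \<and> 0 < c \<and>
    (\<forall>m. \<exists>u. eigf (5 ^ m * l) u \<and> (L2_norm \<nu> u)\<^sup>2 = (1/3) ^ m * A \<and> (LINT x|\<nu>. cmod (u x) ^ (2 * k + 2)) = (1/3) ^ m * c)"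
proof -
  obtain n where n: "L2_norm \<nu> (antisym (\<phi> n)) \<noteq> 0" using exists_antisymmetric by blast
  define u0 where "u0 = antisym (\<phi> n)"
  define u where "u m = (localize ^^ m) u0" for m
  define A where "A = (L2_norm \<nu> u0)\<^sup>2"
  define c where "c = (LINT x|\<nu>. cmod (u0 x) ^ (2 * k + 2))"
  have "eigf (lam n) (\<phi> n)" using energy_eigenfunction eigenfunction_dom by (simp add: eigf_def)
  then have u0: "eigf (lam n) u0" unfolding u0_def by (rule antisym_eigf)
  then have u0c: "continuous_on G u0" by (simp add: eigf_def dom_continuous)
  have A: "0 < A" using n by (simp add: A_def u0_def)
  have "0 < c"
  proof -
    have int: "integrable \<nu> (\<lambda>x. cmod (u0 x) ^ (2 * k + 2))"
      by (intro continuous_integrable continuous_intros u0c)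
    have "c \<noteq> 0"
    proof
      assume "c = 0"
      then have "AE x in \<nu>. cmod (u0 x) ^ (2 * k + 2) = 0"
        unfolding c_def using integral_nonneg_eq_0_iff_AE[OF int] by simp
      then have "AE x in \<nu>. u0 x = 0" by eventually_elim auto
      then have "L2_norm \<nu> u0 = 0" using L2_norm_zero_iff[OF continuous_L2[OF u0c]] by blast
      then show False using A by (simp add: A_def)
    qed
    moreover have "0 \<le> c" unfolding c_def by (intro integral_nonneg_AE) simp
    ultimately show ?thesis by simp
  qed
  moreover have "eigf (5 ^ m * lam n) (u m) \<and> dirichlet (u m) \<and> (LINT x|\<nu>. (cmod (u m x))\<^sup>2) = (1/3) ^ m * A
      \<and> (LINT x|\<nu>. cmod (u m x) ^ (2 * k + 2)) = (1/3) ^ m * c" for m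
  proof (induction m)
    case 0
    have "dirichlet u0" by (simp add: u0_def dirichlet_def antisym_vertex)
    then show ?case using u0 by (simp add: u_def A_def c_def L2_norm_power2)
  next
    case (Suc m)
    have us: "u (Suc m) = localize (u m)" by (simp add: u_def)
    have e: "eigf (5 ^ m * lam n) (u m)" and d: "dirichlet (u m)" using Suc by auto
    have cm: "continuous_on G (u m)" using e by (simp add: eigf_def dom_continuous)
    have "eigf (5 ^ Suc m * lam n) (u (Suc m))" using localize_eigf[OF e d] by (simp add: us mult.assoc)
    moreover have "dirichlet (u (Suc m))" using dirichlet_localize[OF d] by (simp add: us)
    moreover have "(LINT x|\<nu>. (cmod (u (Suc m) x))\<^sup>2) = (1/3) ^ Suc m * A"
      using integral_power_localize[OF d cm, of 1] Suc unfolding us by (simp add: numeral_2_eq_2)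
    moreover have "(LINT x|\<nu>. cmod (u (Suc m) x) ^ (2 * k + 2)) = (1/3) ^ Suc m * c"
      using integral_power_localize[OF d cm, of "2 * k + 1"] Suc unfolding us by simp
    ultimately show ?case by blast
  qed
  ultimately show ?thesis using A lam_nonneg[of n] unfolding L2_norm_power2 by blast
qed

end

section \<open>The nonlinearity and the propagator\<close>

text \<open>The exponent is an arbitrary \<open>n\<close>, not just \<open>2 * k\<close>, so that
  the Lipschitz estimate can be proved by induction on it.\<close>

definition nl :: "nat \<Rightarrow> complex \<Rightarrow> complex" where
  "nl n z = complex_of_real (cmod z ^ n) * z"

text \<open>The constant of the H^1 estimate for the nonlinearity: 30 comes from
  \<open>H1_embedding\<close>, and \<open>2 * k + 2\<close> is 1 for the L^2 part plus
  \<open>2 * k + 1\<close> for the energy part.\<close>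

definition nlc :: "nat \<Rightarrow> real" where
  "nlc k = real (2 * k + 2) * 30 ^ (2 * k + 1)"

lemma cmod_nl: "cmod (nl n z) = cmod z ^ Suc n"
  by (simp add: nl_def norm_mult norm_power mult.commute)

lemma nl_mult: "nl n (c * z) = nl n c * nl n z"
  by (simp add: nl_def norm_mult power_mult_distrib)

text \<open>\<open>nl (Suc n) z\<close> is \<open>cmod z\<close> times \<open>nl n z\<close>. The
  difference of two such products is split as usual, and the reverse triangle inequality bounds the
  change of the modulus.\<close>

lemma nl_lipschitz:
  assumes "cmod z \<le> R" "cmod w \<le> R"
  shows "cmod (nl n z - nl n w) \<le> real (Suc n) * R ^ n * cmod (z - w)"
proof (induction n)
  case 0
  then show ?case by (simp add: nl_def)
next
  case (Suc n)
  have R: "0 \<le> R" using assms(1) norm_ge_zero[of z] by linarith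
  have "nl (Suc n) z - nl (Suc n) w = of_real (cmod z) * (nl n z - nl n w) + of_real (cmod z - cmod w) * nl n w"
    by (simp add: nl_def algebra_simps)
  then have "cmod (nl (Suc n) z - nl (Suc n) w) \<le> cmod (of_real (cmod z) * (nl n z - nl n w)) + cmod (of_real (cmod z - cmod w) * nl n w)"
    by (simp only: norm_triangle_ineq)
  also have "cmod (of_real (cmod z) * (nl n z - nl n w)) = cmod z * cmod (nl n z - nl n w)"
    by (simp add: norm_mult)
  also have "cmod (of_real (cmod z - cmod w) * nl n w) = \<bar>cmod z - cmod w\<bar> * cmod w ^ Suc n"
    by (simp only: norm_mult norm_of_real cmod_nl)
  also have "cmod z * cmod (nl n z - nl n w) \<le> R * (real (Suc n) * R ^ n * cmod (z - w))"
    using assms R Suc by (intro mult_mono) auto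
  also have "\<bar>cmod z - cmod w\<bar> * cmod w ^ Suc n \<le> cmod (z - w) * R ^ Suc n"
    using assms R by (intro mult_mono power_mono norm_triangle_ineq3) auto
  finally have "cmod (nl (Suc n) z - nl (Suc n) w) \<le> R * (real (Suc n) * R ^ n * cmod (z - w)) + cmod (z - w) * R ^ Suc n"
    by simp
  also have "\<dots> = real (Suc (Suc n)) * R ^ Suc n * cmod (z - w)"
    by (simp add: algebra_simps)
  finally show ?case .
qed

lemma continuous_nl [continuous_intros]: "continuous_on S f \<Longrightarrow> continuous_on S (\<lambda>x. nl n (f x))"
  unfolding nl_def by (intro continuous_intros)

lemma measurable_nl [measurable]: "f \<in> borel_measurable M \<Longrightarrow> (\<lambda>x. nl n (f x)) \<in> borel_measurable M"
  by (rule measurable_compose[OF _ borel_measurable_continuous_onI]) (auto intro: continuous_intros)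

text \<open>A continuity argument. Up to the first time at which \<open>m\<close> reaches
  \<open>2 * a\<close>, the step applies with \<open>R = 2 * a\<close> and yields a value below
  \<open>2 * a\<close>, a contradiction.\<close>

lemma bootstrap:
  fixes m :: "real \<Rightarrow> real"
  assumes cont: "continuous_on {0..T} m" and a: "0 < a"
    and step: "\<And>t R. t \<in> {0..T} \<Longrightarrow> 0 \<le> R \<Longrightarrow> (\<And>\<tau>. \<tau> \<in> {0..t} \<Longrightarrow> m \<tau> \<le> R) \<Longrightarrow> m t \<le> a + t * (K * R ^ n)"
    and K: "0 \<le> K" "T * (K * (2 * a) ^ n) < a"
    and t: "t \<in> {0..T}"
  shows "m t \<le> 2 * a"
proof (rule ccontr)
  assume neg: "\<not> m t \<le> 2 * a"
  define S where "S = {0..t} \<inter> m -` {2 * a..}"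
  have ct: "continuous_on {0..t} m" using t by (intro continuous_on_subset[OF cont]) auto
  have "compact S"
    unfolding S_def compact_eq_bounded_closed
    using continuous_closed_preimage[OF ct, of "{2 * a..}"] bounded_Int[of "{0..t}"] by simp
  moreover have "t \<in> S" using neg t by (simp add: S_def)
  ultimately obtain s where s: "s \<in> S" "\<And>x. x \<in> S \<Longrightarrow> s \<le> x"
    using compact_attains_inf[of S] by blast
  have s0: "0 \<le> s" "s \<le> t" "2 * a \<le> m s" using s(1) by (simp_all add: S_def)
  have T0: "(0::real) \<in> {0..T}" using t by simp
  \<comment> \<open>At time 0 the second term vanishes, so any nonnegative \<open>R\<close> above
    \<open>m 0\<close> gives \<open>m 0 \<le> a\<close>.\<close>
  have "m 0 \<le> a + 0 * (K * (max 0 (m 0)) ^ n)" by (rule step[OF T0]) auto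
  then have m0: "m 0 \<le> a" by simp
  \<comment> \<open>The value \<open>2 * a\<close> is attained on \<open>{0..s}\<close>, and by
    minimality of \<open>s\<close> only at \<open>s\<close>. Hence \<open>m s\<close> is exactly
    \<open>2 * a\<close>, and \<open>R = 2 * a\<close> is admissible on the closed interval.\<close>
  have "\<exists>x. 0 \<le> x \<and> x \<le> s \<and> m x = 2 * a"
    using m0 a s0 by (intro IVT' continuous_on_subset[OF ct]) auto
  then obtain x where x: "0 \<le> x" "x \<le> s" "m x = 2 * a" by blast
  then have "x \<in> S" using s0 by (simp add: S_def)
  then have "x = s" using s(2) x(2) by force
  then have ms: "m s = 2 * a" using x(3) by simp
  have "m \<tau> \<le> 2 * a" if "\<tau> \<in> {0..s}" for \<tau>
  proof (rule ccontr)
    assume "\<not> m \<tau> \<le> 2 * a"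
    then have "\<tau> \<in> S" using that s0 by (simp add: S_def)
    then have "\<tau> = s" using s(2) that by force
    then show False using ms \<open>\<not> m \<tau> \<le> 2 * a\<close> by simp
  qed
  then have "m s \<le> a + s * (K * (2 * a) ^ n)"
    using s0 t a by (intro step) auto
  also have "s * (K * (2 * a) ^ n) \<le> T * (K * (2 * a) ^ n)"
    using s0 t K a by (intro mult_right_mono) auto
  finally show False using K ms by simp
qed

context gasket_eigenbasis
begin

lemma eigf_L2: "eigf l u \<Longrightarrow> u \<in> L2 \<nu>"
  by (auto simp: eigf_def intro: dom_L2)

lemma eigf_scale: "eigf l u \<Longrightarrow> eigf l (\<lambda>x. c * u x)"
  by (simp add: eigf_def dom_scale energy_scale_left L2_inner_scale_left)

text \<open>On the continuous representative, which is bounded by \<open>R\<close>, the nonlinearity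
  is Lipschitz with constant \<open>(2 * k + 1) * R ^ (2 * k)\<close>; this controls the energy, and
  the sup bound controls the L^2 norm. The result is then carried back to \<open>u\<close> almost
  everywhere.\<close>

lemma nl_Hs1:
  assumes u: "u \<in> H 1"
  shows "(\<lambda>x. nl (2 * k) (u x)) \<in> H 1"
    "nrm 1 (\<lambda>x. nl (2 * k) (u x)) \<le> nlc k * nrm 1 u ^ (2 * k + 1)"
proof -
  obtain v where v: "v \<in> dom" "AE x in \<nu>. u x = v x" "\<And>x. x \<in> G \<Longrightarrow> cmod (v x) \<le> 30 * nrm 1 u"
    "Re (energy p v v) \<le> (nrm 1 u)\<^sup>2"
    using H1_embedding[OF u] by blast
  have uL: "u \<in> L2 \<nu>" "hsummable 1 u" using u by (simp_all add: Hs_iff)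
  define R where "R = 30 * nrm 1 u"
  have R: "0 \<le> R" "nrm 1 u \<le> R" using nrm_nonneg[OF uL(2)] by (simp_all add: R_def)
  define f where "f x = nl (2 * k) (v x)" for x
  have fc: "continuous_on G f" unfolding f_def by (intro continuous_intros dom_continuous v)
  have fe: "enr m f \<le> (real (2 * k + 1) * R ^ (2 * k + 1))\<^sup>2" for m
  proof -
    have "enr m f \<le> (real (Suc (2 * k)) * R ^ (2 * k))\<^sup>2 * enr m v"
    proof (rule enr_lipschitz)
      show "cmod (f x - f y) \<le> real (Suc (2 * k)) * R ^ (2 * k) * cmod (v x - v y)" if "x \<in> G" "y \<in> G" for x y
        unfolding f_def using v(3)[OF that(1)] v(3)[OF that(2)] by (intro nl_lipschitz) (simp_all add: R_def)
    qed
    also have "enr m v \<le> R\<^sup>2"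
      using enr_le_energy[OF v(1), of m] v(4) power_mono[OF R(2) nrm_nonneg[OF uL(2)], of 2] by linarith
    finally have "enr m f \<le> (real (Suc (2 * k)) * R ^ (2 * k))\<^sup>2 * R\<^sup>2" by (simp add: mult_left_mono)
    then show ?thesis by (simp add: power_mult_distrib mult_ac)
  qed
  have fdom: "f \<in> dom" by (rule domI[OF fc fe])
  have fs: "L2_norm \<nu> f \<le> R ^ (2 * k + 1)"
  proof (rule L2_norm_le_sup[OF fc])
    show "cmod (f x) \<le> R ^ (2 * k + 1)" if "x \<in> G" for x
      using power_mono[OF v(3)[OF that], of "Suc (2 * k)"] by (simp add: f_def cmod_nl R_def)
  qed (use R in simp)
  have "(nrm 1 f)\<^sup>2 \<le> (R ^ (2 * k + 1))\<^sup>2 + (real (2 * k + 1) * R ^ (2 * k + 1))\<^sup>2"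
    using dom_Hs1(2)[OF fdom] power_mono[OF fs, of 2] energy_le[OF fdom fe] by simp
  also have "\<dots> \<le> (real (2 * k + 2) * R ^ (2 * k + 1))\<^sup>2"
  proof -
    have "real (2 * k + 2) * R ^ (2 * k + 1) = R ^ (2 * k + 1) + real (2 * k + 1) * R ^ (2 * k + 1)"
      by (simp add: algebra_simps)
    then show ?thesis using R(1) by (simp only: power2_sum) simp
  qed
  finally have fn: "nrm 1 f \<le> real (2 * k + 2) * R ^ (2 * k + 1)"
    by (rule power2_le_imp_le) (use R in simp)
  have fH: "f \<in> H 1" by (rule dom_Hs1[OF fdom])
  have meas: "(\<lambda>x. nl (2 * k) (u x)) \<in> borel_measurable \<nu>" using L2_measurable[OF uL(1)] by measurable
  have ae: "AE x in \<nu>. f x = nl (2 * k) (u x)" using v(2) by eventually_elim (simp add: f_def)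
  have nL: "(\<lambda>x. nl (2 * k) (u x)) \<in> L2 \<nu>" by (rule L2_cong_AE[OF dom_L2[OF fdom] meas ae])
  have "coef f n = coef (\<lambda>x. nl (2 * k) (u x)) n" for n by (rule coef_cong_AE[OF dom_L2[OF fdom] nL ae])
  then show "(\<lambda>x. nl (2 * k) (u x)) \<in> H 1" using fH nL by (simp add: Hs_iff hsummable_def)
  show "nrm 1 (\<lambda>x. nl (2 * k) (u x)) \<le> nlc k * nrm 1 u ^ (2 * k + 1)"
    using fn nrm_cong_AE[OF dom_L2[OF fdom] nL ae] by (simp add: R_def nlc_def power_mult_distrib mult_ac)
qed

abbreviation propag :: "real \<Rightarrow> (real^2 \<Rightarrow> complex) \<Rightarrow> real^2 \<Rightarrow> complex" where
  "propag \<equiv> propagator \<nu> \<phi> lam"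

lemma prop_props:
  assumes "f \<in> L2 \<nu>"
  shows "propag t f \<in> L2 \<nu>" "coef (propag t f) n = exp (- \<i> * of_real t * of_real (lam n)) * coef f n"
  unfolding propagator_def using assms by (intro spectral_op_props; simp)+

lemma hn_prop: "f \<in> L2 \<nu> \<Longrightarrow> hn s N (propag t f) = hn s N f"
  unfolding hn_def by (intro L2_set_cong refl) (simp add: prop_props norm_mult)

lemma prop_pairing:
  assumes f: "f \<in> L2 \<nu>" and u: "eigf l u"
  shows "L2_inner \<nu> (propag t f) u = exp (- \<i> * of_real t * of_real l) * L2_inner \<nu> f u"
proof -
  have eq: "coef (propag t f) n * cnj (coef u n) = exp (- \<i> * of_real t * of_real l) * (coef f n * cnj (coef u n))" for n
    using eigf_coef[OF u, of n] by (cases "coef u n = 0") (simp_all add: prop_props[OF f])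
  then have "(\<lambda>n. coef (propag t f) n * cnj (coef u n)) sums (exp (- \<i> * of_real t * of_real l) * L2_inner \<nu> f u)"
    using sums_mult[OF inner_sums[OF f eigf_L2[OF u]], of "exp (- \<i> * of_real t * of_real l)"] by (simp only: eq)
  then show ?thesis using inner_sums[OF prop_props(1)[OF f] eigf_L2[OF u]] by (rule sums_unique2[rotated])
qed

lemma prop_eigf:
  assumes u: "eigf l u"
  shows "AE x in \<nu>. propag t u x = exp (- \<i> * of_real t * of_real l) * u x"
proof (rule coeff_eq_AE)
  show "coef (propag t u) n = coef (\<lambda>x. exp (- \<i> * of_real t * of_real l) * u x) n" for n
    using eigf_coef[OF u, of n] by (cases "coef u n = 0") (simp_all add: prop_props[OF eigf_L2[OF u]] L2_inner_scale_left)
qed (use eigf_L2[OF u] in \<open>auto intro: L2_scale prop_props\<close>)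

text \<open>Riemann sums replace Minkowski's integral inequality.\<close>

lemma seminorm_integral_bound:
  assumes int: "seminorm_has_integral (L2_norm \<nu>) f 0 t J" and t: "0 \<le> t"
    and J: "J \<in> L2 \<nu>" and f: "\<And>\<tau>. \<tau> \<in> {0..t} \<Longrightarrow> f \<tau> \<in> L2 \<nu>" and z: "z \<in> L2 \<nu>"
    and q_add: "\<And>x y. x \<in> L2 \<nu> \<Longrightarrow> y \<in> L2 \<nu> \<Longrightarrow> q (\<lambda>a. x a + y a) \<le> q x + q y"
    and q_scale: "\<And>c x. x \<in> L2 \<nu> \<Longrightarrow> q (\<lambda>a. of_real c * x a) = \<bar>c\<bar> * q x"
    and q_le: "\<And>x. x \<in> L2 \<nu> \<Longrightarrow> q x \<le> C * L2_norm \<nu> x" and C: "0 \<le> C"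
    and B: "\<And>\<tau>. \<tau> \<in> {0..t} \<Longrightarrow> q (\<lambda>a. f \<tau> a - z a) \<le> B"
  shows "q (\<lambda>a. J a - of_real t * z a) \<le> t * B"
proof (rule field_le_epsilon)
  fix e :: real assume e: "e > 0"
  define e' where "e' = e / (C + 1)"
  have e': "e' > 0" using e C by (simp add: e'_def)
  obtain \<gamma> where "gauge \<gamma> \<and> (\<forall>D. D tagged_division_of {0..t} \<and> \<gamma> fine D \<longrightarrow>
      L2_norm \<nu> ((\<Sum>(t, K)\<in>D. measure lborel K *\<^sub>R f t) - J) < e')"
    using int[unfolded seminorm_has_integral_def, THEN spec, THEN mp, OF e'] by (rule exE)
  then have \<gamma>: "gauge \<gamma>"
    "\<And>D. D tagged_division_of {0..t} \<Longrightarrow> \<gamma> fine D \<Longrightarrow> L2_norm \<nu> ((\<Sum>(t, K)\<in>D. measure lborel K *\<^sub>R f t) - J) < e'"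
    by simp_all
  obtain D where D: "D tagged_division_of {0..t}" "\<gamma> fine D"
    using fine_division_exists[OF \<gamma>(1), of 0 t] by (auto simp: cbox_interval)
  have finD: "finite D" using D(1) by (rule tagged_division_of_finite)
  have tagD: "\<tau> \<in> {0..t}" if "(\<tau>, K) \<in> D" for \<tau> K
    using tagged_division_ofD(2,3)[OF D(1) that] by blast
  define S where "S a = (\<Sum>(\<tau>, K)\<in>D. of_real (measure lborel K) * f \<tau> a)" for a
  have S_eq: "(\<Sum>(t, K)\<in>D. measure lborel K *\<^sub>R f t) = S"
    by (rule ext) (simp add: S_def sum_fun_apply case_prod_unfold scaleR_fun_def scaleR_conv_of_real)
  have SL: "S \<in> L2 \<nu>"
    unfolding S_def[abs_def] case_prod_unfold using tagD by (intro L2_sum L2_scale f) force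
  have sumK: "(\<Sum>(\<tau>, K)\<in>D. measure lborel K) = t"
  proof -
    have "D tagged_division_of cbox 0 t" using D(1) by (simp add: cbox_interval)
    from additive_content_tagged_division[OF this] show ?thesis using t by simp
  qed
  have q0: "q (\<lambda>a. 0) = 0" using q_scale[OF L2_zero, of 0] by simp
  have qsum: "q (\<lambda>a. \<Sum>i\<in>I. g i a) \<le> (\<Sum>i\<in>I. q (g i))" if "finite I" "\<And>i. i \<in> I \<Longrightarrow> g i \<in> L2 \<nu>" for I and g :: "real \<times> real set \<Rightarrow> real^2 \<Rightarrow> complex"
    using that
  proof (induction I rule: finite_induct)
    case (insert i I)
    have "q (\<lambda>a. g i a + (\<Sum>i\<in>I. g i a)) \<le> q (g i) + q (\<lambda>a. \<Sum>i\<in>I. g i a)"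
      using insert by (intro q_add L2_sum) auto
    then show ?case using insert by simp
  qed (simp add: q0)
  \<comment> \<open>The lengths add up to \<open>t\<close>, so \<open>t\<close> times
    \<open>z\<close> is the Riemann sum of the constant \<open>z\<close> for the same division, and
    the comparison can be made tag by tag.\<close>
  have "S a - of_real t * z a = (\<Sum>(\<tau>, K)\<in>D. of_real (measure lborel K) * (f \<tau> a - z a))" for a
    unfolding S_def sumK[symmetric] case_prod_unfold
    by (simp add: right_diff_distrib sum_subtractf sum_distrib_right)
  then have "q (\<lambda>a. S a - of_real t * z a) = q (\<lambda>a. \<Sum>d\<in>D. of_real (measure lborel (snd d)) * (f (fst d) a - z a))"
    by (simp add: case_prod_unfold)
  also have "\<dots> \<le> (\<Sum>d\<in>D. q (\<lambda>a. of_real (measure lborel (snd d)) * (f (fst d) a - z a)))"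
    using tagD by (intro qsum finD L2_scale L2_diff f z) force
  also have "\<dots> \<le> (\<Sum>d\<in>D. measure lborel (snd d) * B)"
  proof (rule sum_mono)
    fix d assume "d \<in> D"
    then have "fst d \<in> {0..t}" using tagD by (metis prod.collapse)
    then show "q (\<lambda>a. of_real (measure lborel (snd d)) * (f (fst d) a - z a)) \<le> measure lborel (snd d) * B"
      using q_scale[OF L2_diff[OF f z], of "fst d"] B by (simp add: mult_left_mono)
  qed
  also have "\<dots> = t * B" unfolding sumK[symmetric] by (simp add: case_prod_unfold sum_distrib_right)
  finally have 1: "q (\<lambda>a. S a - of_real t * z a) \<le> t * B" .
  have "q (\<lambda>a. J a - S a) \<le> C * L2_norm \<nu> (\<lambda>a. J a - S a)" by (intro q_le L2_diff J SL)
  also have "L2_norm \<nu> (\<lambda>a. J a - S a) = L2_norm \<nu> (S - J)"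
    by (simp add: L2_norm_def norm_minus_commute)
  also have "C * L2_norm \<nu> (S - J) \<le> C * e'"
    using \<gamma>(2)[OF D] C by (intro mult_left_mono) (simp_all add: S_eq)
  also have "\<dots> \<le> e" using e C by (simp add: e'_def divide_le_eq) 
  finally have 2: "q (\<lambda>a. J a - S a) \<le> e" .
  have "q (\<lambda>a. (J a - S a) + (S a - of_real t * z a)) \<le> q (\<lambda>a. J a - S a) + q (\<lambda>a. S a - of_real t * z a)"
    by (intro q_add L2_diff L2_scale J SL z)
  then show "q (\<lambda>a. J a - of_real t * z a) \<le> t * B + e" using 1 2 by simp
qed

lemma norm_basis: "L2_norm \<nu> (\<phi> n) = 1"
proof -
  have "complex_of_real ((L2_norm \<nu> (\<phi> n))\<^sup>2) = 1" using L2_inner_self[of \<nu> "\<phi> n"] by (simp add: orthonormal)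
  then have "(L2_norm \<nu> (\<phi> n))\<^sup>2 = 1" by (simp only: of_real_eq_1_iff)
  then show ?thesis by (simp add: power2_eq_1_iff) (smt (verit) L2_norm_nonneg)
qed

text \<open>The constant depends on \<open>N\<close>, which is harmless: in
  \<open>seminorm_integral_bound\<close> it only expresses continuity and does not appear in the
  conclusion.\<close>

lemma hn_le_L2: "u \<in> L2 \<nu> \<Longrightarrow> hn s N u \<le> (\<Sum>n<N. wt (s/2) n) * L2_norm \<nu> u"
proof -
  assume u: "u \<in> L2 \<nu>"
  have "hn s N u \<le> (\<Sum>n<N. wt (s/2) n * cmod (coef u n))"
    unfolding hn_def by (intro L2_set_le_sum) (simp add: less_imp_le)
  also have "\<dots> \<le> (\<Sum>n<N. wt (s/2) n * L2_norm \<nu> u)"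
    using L2_Cauchy_Schwarz[OF u basis_L2] by (intro sum_mono mult_left_mono) (auto simp: norm_basis less_imp_le)
  finally show ?thesis by (simp add: sum_distrib_right)
qed

lemma nrm_continuous:
  assumes s: "0 \<le> s" and u: "u \<in> C_Hs \<nu> \<phi> lam s T"
  shows "continuous_on {-T..T} (\<lambda>t. nrm s (u t))"
  unfolding continuous_on_def
proof
  fix t assume t: "t \<in> {-T..T}"
  have ut: "u \<tau> \<in> H s" if "\<tau> \<in> {-T..T}" for \<tau> using u that by (simp add: C_Hs_def)
  have diff: "u t' - u t = (\<lambda>x. u t' x - u t x)" for t' by (rule ext) simp
  have lim: "((\<lambda>t'. nrm s (\<lambda>x. u t' x - u t x)) \<longlongrightarrow> 0) (at t within {-T..T})"
  proof -
    have "((\<lambda>t'. nrm s (u t' - u t)) \<longlongrightarrow> 0) (at t within {-T..T})"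
      using u t unfolding C_Hs_def by blast
    then show ?thesis by (simp only: diff)
  qed
  have bd: "norm (nrm s (u t') - nrm s (u t)) \<le> nrm s (\<lambda>x. u t' x - u t x)" if t': "t' \<in> {-T..T}" for t'
  proof -
    have d: "(\<lambda>x. u t' x - u t x) \<in> H s" using s ut t t' by (intro Hs_diff) auto
    have 1: "nrm s (u t') \<le> nrm s (\<lambda>x. u t' x - u t x) + nrm s (u t)"
      using Hs_add(2)[OF s d ut[OF t]] by simp
    have "nrm s (\<lambda>x. (- 1) * (u t' x - u t x)) = nrm s (\<lambda>x. u t' x - u t x)"
      using d s by (subst nrm_scale) (simp_all add: Hs_iff)
    then have 2: "nrm s (u t) \<le> nrm s (\<lambda>x. u t' x - u t x) + nrm s (u t')"
      using Hs_add(2)[OF s Hs_scale[OF s d, of "-1"] ut[OF t']] by simp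
    show ?thesis using 1 2 by (simp add: abs_le_iff)
  qed
  have "((\<lambda>t'. nrm s (u t') - nrm s (u t)) \<longlongrightarrow> 0) (at t within {-T..T})"
    by (rule Lim_null_comparison[OF _ lim]) (use bd in \<open>simp add: eventually_at_filter\<close>)
  then show "((\<lambda>t'. nrm s (u t')) \<longlongrightarrow> nrm s (u t)) (at t within {-T..T})"
    by (simp add: LIM_zero_iff)
qed

end

section \<open>Expansion of the flow along an eigenfunction\<close>

context gasket_eigenbasis
begin

lemma L2_norm_le_AE:
  assumes u: "u \<in> L2 \<nu>" and B: "0 \<le> B" "AE x in \<nu>. cmod (u x) \<le> B"
  shows "L2_norm \<nu> u \<le> B"
proof (rule power2_le_imp_le)
  have "(LINT x|\<nu>. (cmod (u x))\<^sup>2) \<le> (LINT x|\<nu>. B\<^sup>2)"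
  proof (rule integral_mono_AE[OF L2_integrable[OF u]])
    show "AE x in \<nu>. (cmod (u x))\<^sup>2 \<le> B\<^sup>2" using B(2) by eventually_elim (simp add: power_mono)
  qed simp
  then show "(L2_norm \<nu> u)\<^sup>2 \<le> B\<^sup>2" by (simp add: L2_norm_power2)
qed (rule B)

lemma H1_AE_bound: "u \<in> H 1 \<Longrightarrow> AE x in \<nu>. cmod (u x) \<le> 30 * nrm 1 u"
proof -
  assume "u \<in> H 1"
  then obtain v where v: "AE x in \<nu>. u x = v x" "\<And>x. x \<in> G \<Longrightarrow> cmod (v x) \<le> 30 * nrm 1 u"
    using H1_embedding by blast
  have "AE x in \<nu>. x \<in> G" by (rule AE_I2) simp
  with v(1) show ?thesis by eventually_elim (simp add: v(2))
qed

text \<open>The linear evolution of the datum, written explicitly because \<open>propag\<close>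
  returns a chosen representative that is determined only up to null sets.\<close>

definition free :: "real \<Rightarrow> (real^2 \<Rightarrow> complex) \<Rightarrow> real \<Rightarrow> real \<Rightarrow> real^2 \<Rightarrow> complex" where
  "free l f e t x = of_real e * (exp (- \<i> * of_real t * of_real l) * f x)"

lemma free_eigf: "eigf l f \<Longrightarrow> eigf l (free l f e t)"
  unfolding free_def by (intro eigf_scale)

lemma nrm_free: "eigf l f \<Longrightarrow> 0 \<le> e \<Longrightarrow> nrm 1 (free l f e t) = e * nrm 1 f"
proof -
  assume f: "eigf l f" and e: "0 \<le> e"
  have "L2_norm \<nu> (free l f e t) = e * L2_norm \<nu> f"
    unfolding free_def L2_norm_scale using e by simp
  then show ?thesis using eigf_Hs(2)[OF f, of 1] eigf_Hs(2)[OF free_eigf[OF f], of 1 e t] by simp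
qed

lemma H1_solution_Duhamel:
  assumes sol: "H1_solution \<nu> \<phi> lam \<mu> k T u0 u" and t: "t \<in> {0..T}"
  obtains J where "J \<in> L2 \<nu>"
    "seminorm_has_integral (L2_norm \<nu>) (\<lambda>\<tau>. propag (t - \<tau>) (\<lambda>x. nl (2 * k) (u \<tau> x))) 0 t J"
    "AE x in \<nu>. u t x = propag t u0 x - \<i> * of_real \<mu> * J x"
proof -
  have nls: "nls_solution \<nu> \<phi> lam \<mu> k T u0 u" and tT: "t \<in> {-T..T}" and t0: "0 \<le> t"
    using sol t by (auto simp: H1_solution_def)
  from bspec[OF nls[unfolded nls_solution_def] tT] obtain J where J: "J \<in> L2 \<nu>"
    "seminorm_has_oriented_integral (L2_norm \<nu>)
       (\<lambda>\<tau>. propag (t - \<tau>) (\<lambda>x. complex_of_real (cmod (u \<tau> x) ^ (2 * k)) * u \<tau> x)) 0 t J \<and>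
     (AE x in \<nu>. u t x = propag t u0 x - \<i> * of_real \<mu> * J x)"
    by (rule bexE)
  show ?thesis
    by (rule that[OF J(1) conjunct1[OF J(2), unfolded seminorm_has_oriented_integral_def if_P[OF t0], folded nl_def] conjunct2[OF J(2)]])
qed

lemma H1_solution_Hs: "H1_solution \<nu> \<phi> lam \<mu> k T u0 u \<Longrightarrow> t \<in> {0..T} \<Longrightarrow> u t \<in> H 1"
  by (auto simp: H1_solution_def C_Hs_def)

lemma propag_data:
  assumes f: "eigf l f" shows "AE x in \<nu>. propag t (\<lambda>x. of_real e * f x) x = free l f e t x"
  using prop_eigf[OF eigf_scale[OF f, of "of_real e"], of t] by eventually_elim (simp add: free_def)

text \<open>Duhamel's integral is given as an L^2 limit. Each truncated norm \<open>hn 1 N\<close>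
  is invariant under the propagator and passes through the integral with a bound independent of
  \<open>N\<close>, which places the integral in H^1.\<close>

lemma Duhamel_Hs1_bound:
  assumes f: "eigf l f" and sol: "H1_solution \<nu> \<phi> lam \<mu> k T (\<lambda>x. of_real e * f x) u"
    and \<mu>: "\<bar>\<mu>\<bar> = 1" and t: "t \<in> {0..T}" and R: "0 \<le> R" "\<And>\<tau>. \<tau> \<in> {0..t} \<Longrightarrow> nrm 1 (u \<tau>) \<le> R"
  shows "(\<lambda>x. u t x - free l f e t x) \<in> H 1"
    "nrm 1 (\<lambda>x. u t x - free l f e t x) \<le> t * (nlc k * R ^ (2 * k + 1))"
proof -
  define B where "B = nlc k * R ^ (2 * k + 1)"
  have B: "0 \<le> B" using R by (simp add: B_def nlc_def)
  obtain J where J: "J \<in> L2 \<nu>"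
    "seminorm_has_integral (L2_norm \<nu>) (\<lambda>\<tau>. propag (t - \<tau>) (\<lambda>x. nl (2 * k) (u \<tau> x))) 0 t J"
    "AE x in \<nu>. u t x = propag t (\<lambda>x. of_real e * f x) x - \<i> * of_real \<mu> * J x"
    by (rule H1_solution_Duhamel[OF sol t])
  have uH: "u \<tau> \<in> H 1" if "\<tau> \<in> {0..t}" for \<tau> using H1_solution_Hs[OF sol, of \<tau>] that t by simp
  have nH: "(\<lambda>x. nl (2 * k) (u \<tau> x)) \<in> H 1" if "\<tau> \<in> {0..t}" for \<tau> by (rule nl_Hs1[OF uH[OF that]])
  then have nL: "(\<lambda>x. nl (2 * k) (u \<tau> x)) \<in> L2 \<nu>" if "\<tau> \<in> {0..t}" for \<tau> using that by (simp add: Hs_iff)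
  have nB: "nrm 1 (\<lambda>x. nl (2 * k) (u \<tau> x)) \<le> B" if \<tau>: "\<tau> \<in> {0..t}" for \<tau>
  proof -
    have "nrm 1 (u \<tau>) ^ (2 * k + 1) \<le> R ^ (2 * k + 1)"
      using R(2)[OF \<tau>] uH[OF \<tau>] by (intro power_mono nrm_nonneg) (auto simp: Hs_iff)
    then have "nlc k * nrm 1 (u \<tau>) ^ (2 * k + 1) \<le> B"
      unfolding B_def nlc_def by (intro mult_left_mono) auto
    then show ?thesis using nl_Hs1(2)[OF uH[OF \<tau>], of k] by linarith
  qed
  have "hn 1 N J \<le> t * B" for N
  proof -
    have C0: "0 \<le> (\<Sum>n<N. wt (1/2) n)" by (intro sum_nonneg) (simp add: less_imp_le)
    have "hn 1 N (\<lambda>a. J a - of_real t * 0) \<le> t * B"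
    proof (rule seminorm_integral_bound[where q = "hn 1 N" and C = "\<Sum>n<N. wt (1/2) n", OF J(2) _ J(1)])
      show "hn 1 N (\<lambda>a. propag (t - \<tau>) (\<lambda>x. nl (2 * k) (u \<tau> x)) a - 0) \<le> B" if "\<tau> \<in> {0..t}" for \<tau>
        using hn_prop[OF nL[OF that], of 1 N "t - \<tau>"] hn_le_nrm[of 1 "\<lambda>x. nl (2 * k) (u \<tau> x)" N] nH[OF that] nB[OF that]
        by (simp add: Hs_iff)
    qed (use t nL C0 in \<open>auto intro: prop_props L2_zero hn_add hn_le_L2 simp: hn_scale\<close>)
    then show ?thesis by simp
  qed
  moreover have "0 \<le> t * B" using t B by simp
  ultimately have JH: "hsummable 1 J" "nrm 1 J \<le> t * B" using nrm_le[of "t * B" 1 J] by auto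
  have fH: "free l f e t \<in> H 1" using eigf_Hs(1)[OF free_eigf[OF f]] by simp
  have ut: "u t \<in> H 1" using uH t by simp
  show d: "(\<lambda>x. u t x - free l f e t x) \<in> H 1" using Hs_diff(1)[OF _ ut fH] by simp
  have "AE x in \<nu>. u t x - free l f e t x = (- \<i> * of_real \<mu>) * J x"
    using J(3) propag_data[OF f, of t e] by eventually_elim simp
  then have "nrm 1 (\<lambda>x. u t x - free l f e t x) = nrm 1 (\<lambda>x. (- \<i> * of_real \<mu>) * J x)"
    using d by (intro nrm_cong_AE L2_scale J(1)) (simp_all add: Hs_iff)
  also have "\<dots> = nrm 1 J" using nrm_scale[OF JH(1), of "- \<i> * of_real \<mu>"] \<mu> by (simp add: norm_mult)
  finally show "nrm 1 (\<lambda>x. u t x - free l f e t x) \<le> t * (nlc k * R ^ (2 * k + 1))"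
    using JH(2) by (simp add: B_def)
qed

lemma H1_solution_bound:
  assumes f: "eigf l f" and sol: "H1_solution \<nu> \<phi> lam \<mu> k T (\<lambda>x. of_real e * f x) u"
    and \<mu>: "\<bar>\<mu>\<bar> = 1" and e: "0 \<le> e" and a: "e * nrm 1 f \<le> a" "0 < a"
    and small: "T * (nlc k * (2 * a) ^ (2 * k + 1)) < a"
    and t: "t \<in> {0..T}"
  shows "nrm 1 (u t) \<le> 2 * a"
proof (rule bootstrap[where m = "\<lambda>t. nrm 1 (u t)", OF _ a(2) _ _ small t])
  have "u \<in> C_Hs \<nu> \<phi> lam 1 T" using sol by (simp add: H1_solution_def)
  then show "continuous_on {0..T} (\<lambda>t. nrm 1 (u t))"
    by (intro continuous_on_subset[OF nrm_continuous]) (use t in auto)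
  fix t R assume t: "t \<in> {0..T}" and R: "0 \<le> R" "\<And>\<tau>. \<tau> \<in> {0..t} \<Longrightarrow> nrm 1 (u \<tau>) \<le> R"
  note d = Duhamel_Hs1_bound[OF f sol \<mu> t R]
  have fH: "free l f e t \<in> H 1" using eigf_Hs(1)[OF free_eigf[OF f]] by simp
  have "nrm 1 (u t) \<le> nrm 1 (\<lambda>x. u t x - free l f e t x) + nrm 1 (free l f e t)"
    using Hs_add(2)[OF _ d(1) fH] by simp
  then show "nrm 1 (u t) \<le> a + t * (nlc k * R ^ (2 * k + 1))"
    using d(2) a(1) nrm_free[OF f e, of t] by linarith
qed (simp add: nlc_def)

lemma nl_free:
  assumes "0 \<le> e"
  shows "nl (2 * k) (free l f e t x) = of_real (e ^ (2 * k + 1)) * (exp (- \<i> * of_real t * of_real l) * nl (2 * k) (f x))"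
proof -
  have "nl (2 * k) (of_real e) = of_real (e ^ (2 * k + 1))" using assms by (simp add: nl_def mult.commute)
  moreover have "nl (2 * k) (exp (- \<i> * of_real t * of_real l)) = exp (- \<i> * of_real t * of_real l)"
    by (simp add: nl_def)
  ultimately show ?thesis by (simp only: free_def nl_mult)
qed

lemma inner_nl: "L2_inner \<nu> (\<lambda>x. nl (2 * k) (f x)) f = of_real (LINT x|\<nu>. cmod (f x) ^ (2 * k + 2))"
proof -
  have "nl (2 * k) z * cnj z = of_real (cmod z ^ (2 * k + 2))" for z
  proof -
    have "nl (2 * k) z * cnj z = of_real (cmod z ^ (2 * k)) * (z * cnj z)" by (simp add: nl_def)
    also have "z * cnj z = of_real ((cmod z)\<^sup>2)" by (rule complex_norm_square[symmetric])
    finally show ?thesis by (simp add: power_add power2_eq_square)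
  qed
  then show ?thesis unfolding L2_inner_def by (simp only: integral_complex_of_real)
qed

text \<open>In H^1 both functions have norm at most \<open>2 * a\<close>, hence modulus at most
  \<open>60 * a\<close>, which gives the Lipschitz constant. Their difference is 30 times the
  Duhamel bound, and Cauchy-Schwarz pairs the result with \<open>f\<close>.\<close>

lemma nonlinear_pairing_error:
  assumes f: "eigf l f" and sol: "H1_solution \<nu> \<phi> lam \<mu> k T (\<lambda>x. of_real e * f x) u"
    and \<mu>: "\<bar>\<mu>\<bar> = 1" and e: "0 \<le> e" and a: "e * nrm 1 f \<le> a" "0 < a"
    and small: "T * (nlc k * (2 * a) ^ (2 * k + 1)) < a"
    and \<tau>: "\<tau> \<in> {0..T}"
  shows "cmod (L2_inner \<nu> (\<lambda>x. nl (2 * k) (u \<tau> x)) f - L2_inner \<nu> (\<lambda>x. nl (2 * k) (free l f e \<tau> x)) f)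
    \<le> real (2 * k + 1) * (60 * a) ^ (2 * k) * (30 * (T * (nlc k * (2 * a) ^ (2 * k + 1)))) * L2_norm \<nu> f"
proof -
  define d where "d = T * (nlc k * (2 * a) ^ (2 * k + 1))"
  define B where "B = real (2 * k + 1) * (60 * a) ^ (2 * k) * (30 * d)"
  note ub = H1_solution_bound[OF f sol \<mu> e a small]
  have T: "0 \<le> T" using \<tau> by simp
  have d0: "0 \<le> d" using T a by (simp add: d_def nlc_def)
  have ub': "nrm 1 (u s) \<le> 2 * a" if "s \<in> {0..\<tau>}" for s using that \<tau> by (intro ub) auto
  have "\<tau> * (nlc k * (2 * a) ^ (2 * k + 1)) \<le> d"
    unfolding d_def nlc_def using \<tau> a by (intro mult_right_mono) auto
  then have dn: "nrm 1 (\<lambda>x. u \<tau> x - free l f e \<tau> x) \<le> d"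
    using Duhamel_Hs1_bound(2)[OF f sol \<mu> \<tau> _ ub'] a by simp
  have dH: "(\<lambda>x. u \<tau> x - free l f e \<tau> x) \<in> H 1"
    using Duhamel_Hs1_bound(1)[OF f sol \<mu> \<tau> _ ub'] a by simp
  have uH: "u \<tau> \<in> H 1" by (rule H1_solution_Hs[OF sol \<tau>])
  have fH: "free l f e \<tau> \<in> H 1" using eigf_Hs(1)[OF free_eigf[OF f]] by simp
  have nu: "(\<lambda>x. nl (2 * k) (u \<tau> x)) \<in> L2 \<nu>" and nf: "(\<lambda>x. nl (2 * k) (free l f e \<tau> x)) \<in> L2 \<nu>"
    using nl_Hs1(1)[OF uH, of k] nl_Hs1(1)[OF fH, of k] by (simp_all add: Hs_iff)
  have "AE x in \<nu>. cmod (nl (2 * k) (u \<tau> x) - nl (2 * k) (free l f e \<tau> x)) \<le> B"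
    using H1_AE_bound[OF uH] H1_AE_bound[OF fH] H1_AE_bound[OF dH]
  proof eventually_elim
    fix x
    assume x: "cmod (u \<tau> x) \<le> 30 * nrm 1 (u \<tau>)" "cmod (free l f e \<tau> x) \<le> 30 * nrm 1 (free l f e \<tau>)"
      "cmod (u \<tau> x - free l f e \<tau> x) \<le> 30 * nrm 1 (\<lambda>x. u \<tau> x - free l f e \<tau> x)"
    have b1: "cmod (u \<tau> x) \<le> 60 * a" using x(1) ub[OF \<tau>] by linarith
    have b2: "cmod (free l f e \<tau> x) \<le> 60 * a" using x(2) nrm_free[OF f e, of \<tau>] a by linarith
    have b3: "cmod (u \<tau> x - free l f e \<tau> x) \<le> 30 * d" using x(3) dn by linarith
    have "cmod (nl (2 * k) (u \<tau> x) - nl (2 * k) (free l f e \<tau> x)) \<le> real (Suc (2 * k)) * (60 * a) ^ (2 * k) * cmod (u \<tau> x - free l f e \<tau> x)"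
      by (rule nl_lipschitz[OF b1 b2])
    also have "\<dots> \<le> real (Suc (2 * k)) * (60 * a) ^ (2 * k) * (30 * d)"
      using b3 a by (intro mult_left_mono) auto
    finally show "cmod (nl (2 * k) (u \<tau> x) - nl (2 * k) (free l f e \<tau> x)) \<le> B" by (simp add: B_def)
  qed
  then have "L2_norm \<nu> (\<lambda>x. nl (2 * k) (u \<tau> x) - nl (2 * k) (free l f e \<tau> x)) \<le> B"
    using a d0 by (intro L2_norm_le_AE L2_diff nu nf) (simp_all add: B_def)
  then have "L2_norm \<nu> (\<lambda>x. nl (2 * k) (u \<tau> x) - nl (2 * k) (free l f e \<tau> x)) * L2_norm \<nu> f \<le> B * L2_norm \<nu> f"
    by (intro mult_right_mono) auto
  then show ?thesis
    using L2_Cauchy_Schwarz[OF L2_diff[OF nu nf] eigf_L2[OF f]] L2_inner_diff_left[OF nu nf eigf_L2[OF f]]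
    unfolding B_def d_def by simp
qed

text \<open>
  The factor in front of the pairing makes the contribution of the linear flow purely imaginary, so
  that the real part starts with the term of order \<open>2k + 1\<close>.
\<close>

lemma flow_pairing:
  assumes f: "eigf l f" and sol: "H1_solution \<nu> \<phi> lam \<mu> k T (\<lambda>x. of_real e * f x) u"
    and \<mu>: "\<mu> = 1 \<or> \<mu> = -1" and e: "0 \<le> e" and T: "0 \<le> T" and a: "e * nrm 1 f \<le> a" "0 < a"
    and small: "T * (nlc k * (2 * a) ^ (2 * k + 1)) < a"
  defines "E \<equiv> real (2 * k + 1) * (60 * a) ^ (2 * k) * (30 * (T * (nlc k * (2 * a) ^ (2 * k + 1)))) * L2_norm \<nu> f"
  shows "\<bar>Re (\<i> * of_real \<mu> * exp (\<i> * of_real T * of_real l) * L2_inner \<nu> (u T) f)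
      - (T * (LINT x|\<nu>. cmod (f x) ^ (2 * k + 2))) * e ^ (2 * k + 1)\<bar> \<le> T * E"
proof -
  have \<mu>1: "\<bar>\<mu>\<bar> = 1" and \<mu>2: "of_real \<mu> * of_real \<mu> = (1::complex)" using \<mu> by auto
  have fL: "f \<in> L2 \<nu>" by (rule eigf_L2[OF f])
  define I where "I = (LINT x|\<nu>. cmod (f x) ^ (2 * k + 2))"
  define P where "P t = exp (- \<i> * complex_of_real t * complex_of_real l)" for t
  have Pn: "cmod (P t) = 1" for t by (simp add: P_def)
  have Padd: "P (s + t) = P s * P t" for s t
    unfolding P_def exp_add[symmetric] by (simp add: algebra_simps)
  define Q where "Q = exp (\<i> * complex_of_real T * complex_of_real l)"
  have Pinv: "Q * P T = 1"
    unfolding P_def Q_def exp_add[symmetric] by simp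
  have tT: "T \<in> {0..T}" using T by simp
  obtain J where J: "J \<in> L2 \<nu>"
    "seminorm_has_integral (L2_norm \<nu>) (\<lambda>\<tau>. propag (T - \<tau>) (\<lambda>x. nl (2 * k) (u \<tau> x))) 0 T J"
    "AE x in \<nu>. u T x = propag T (\<lambda>x. of_real e * f x) x - \<i> * of_real \<mu> * J x"
    by (rule H1_solution_Duhamel[OF sol tT])
  have uH: "u \<tau> \<in> H 1" if "\<tau> \<in> {0..T}" for \<tau> using H1_solution_Hs[OF sol that] .
  have nL: "(\<lambda>x. nl (2 * k) (u \<tau> x)) \<in> L2 \<nu>" if "\<tau> \<in> {0..T}" for \<tau>
    using nl_Hs1(1)[OF uH[OF that], of k] by (simp add: Hs_iff)
  have nfL: "(\<lambda>x. nl (2 * k) (f x)) \<in> L2 \<nu>"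
    using nl_Hs1(1)[OF eigf_Hs(1)[OF f], of k] by (simp add: Hs_iff)
  \<comment> \<open>The free evolution contributes the phase \<open>P \<tau>\<close> and the
    propagator \<open>P (T - \<tau>)\<close>. Their product is \<open>P T\<close>, so the leading
    part of the paired integrand does not depend on \<open>\<tau>\<close>.\<close>
  define z where "z x = (of_real (e ^ (2 * k + 1)) * P T) * nl (2 * k) (f x)" for x
  have zL: "z \<in> L2 \<nu>" unfolding z_def[abs_def] by (intro L2_scale nfL)
  have zf: "L2_inner \<nu> z f = of_real (e ^ (2 * k + 1)) * P T * of_real I"
    unfolding z_def[abs_def] L2_inner_scale_left inner_nl I_def ..
  have "cmod (L2_inner \<nu> (\<lambda>a. J a - of_real T * z a) f) \<le> T * E"
  proof (rule seminorm_integral_bound[where q = "\<lambda>x. cmod (L2_inner \<nu> x f)" and C = "L2_norm \<nu> f", OF J(2) T J(1)])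
    show "propag (T - \<tau>) (\<lambda>x. nl (2 * k) (u \<tau> x)) \<in> L2 \<nu>" if "\<tau> \<in> {0..T}" for \<tau>
      by (rule prop_props(1)[OF nL[OF that]])
    show "cmod (L2_inner \<nu> (\<lambda>a. x a + y a) f) \<le> cmod (L2_inner \<nu> x f) + cmod (L2_inner \<nu> y f)"
      if "x \<in> L2 \<nu>" "y \<in> L2 \<nu>" for x y
      using that fL by (simp add: L2_inner_add_left norm_triangle_ineq)
    show "cmod (L2_inner \<nu> (\<lambda>a. of_real c * x a) f) = \<bar>c\<bar> * cmod (L2_inner \<nu> x f)" for c x
      by (simp add: L2_inner_scale_left norm_mult)
    show "cmod (L2_inner \<nu> x f) \<le> L2_norm \<nu> f * L2_norm \<nu> x" if "x \<in> L2 \<nu>" for x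
      using L2_Cauchy_Schwarz[OF that fL] by (simp add: mult.commute)
    fix \<tau> assume \<tau>: "\<tau> \<in> {0..T}"
    have "L2_inner \<nu> (\<lambda>x. nl (2 * k) (free l f e \<tau> x)) f = of_real (e ^ (2 * k + 1)) * (P \<tau> * of_real I)"
      unfolding nl_free[OF e] L2_inner_scale_left inner_nl I_def P_def ..
    then have "P (T - \<tau>) * L2_inner \<nu> (\<lambda>x. nl (2 * k) (free l f e \<tau> x)) f = L2_inner \<nu> z f"
      using Padd[of "T - \<tau>" \<tau>] by (simp add: zf mult_ac)
    moreover have "L2_inner \<nu> (propag (T - \<tau>) (\<lambda>x. nl (2 * k) (u \<tau> x))) f = P (T - \<tau>) * L2_inner \<nu> (\<lambda>x. nl (2 * k) (u \<tau> x)) f"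
      unfolding P_def by (rule prop_pairing[OF nL[OF \<tau>] f])
    moreover have "L2_inner \<nu> (\<lambda>a. propag (T - \<tau>) (\<lambda>x. nl (2 * k) (u \<tau> x)) a - z a) f
       = L2_inner \<nu> (propag (T - \<tau>) (\<lambda>x. nl (2 * k) (u \<tau> x))) f - L2_inner \<nu> z f"
      by (rule L2_inner_diff_left[OF prop_props(1)[OF nL[OF \<tau>]] zL fL])
    ultimately have "L2_inner \<nu> (\<lambda>a. propag (T - \<tau>) (\<lambda>x. nl (2 * k) (u \<tau> x)) a - z a) f
       = P (T - \<tau>) * (L2_inner \<nu> (\<lambda>x. nl (2 * k) (u \<tau> x)) f - L2_inner \<nu> (\<lambda>x. nl (2 * k) (free l f e \<tau> x)) f)"
      by (simp only: right_diff_distrib)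
    then have "cmod (L2_inner \<nu> (\<lambda>a. propag (T - \<tau>) (\<lambda>x. nl (2 * k) (u \<tau> x)) a - z a) f)
       = cmod (L2_inner \<nu> (\<lambda>x. nl (2 * k) (u \<tau> x)) f - L2_inner \<nu> (\<lambda>x. nl (2 * k) (free l f e \<tau> x)) f)"
      by (simp only: norm_mult Pn mult_1)
    also have "\<dots> \<le> E"
      unfolding E_def by (rule nonlinear_pairing_error[OF f sol \<mu>1 e a small \<tau>])
    finally show "cmod (L2_inner \<nu> (\<lambda>a. propag (T - \<tau>) (\<lambda>x. nl (2 * k) (u \<tau> x)) a - z a) f) \<le> E" .
  qed (simp_all add: zL)
  moreover have "L2_inner \<nu> (\<lambda>a. J a - of_real T * z a) f = L2_inner \<nu> J f - of_real T * L2_inner \<nu> z f"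
    using L2_inner_diff_left[OF J(1) L2_scale[OF zL] fL, of "of_real T"] by (simp only: L2_inner_scale_left)
  ultimately have err: "cmod (L2_inner \<nu> J f - of_real T * L2_inner \<nu> z f) \<le> T * E" by simp
  have uL: "u T \<in> L2 \<nu>" using uH[OF tT] by (simp add: Hs_iff)
  have e0L: "(\<lambda>x. of_real e * f x) \<in> L2 \<nu>" by (intro L2_scale fL)
  have pL: "propag T (\<lambda>x. of_real e * f x) \<in> L2 \<nu>" by (rule prop_props(1)[OF e0L])
  have "L2_inner \<nu> (u T) f = L2_inner \<nu> (\<lambda>x. propag T (\<lambda>x. of_real e * f x) x - (\<i> * of_real \<mu>) * J x) f"
    by (rule L2_inner_cong_AE) (use J(3) uL fL L2_diff[OF pL L2_scale[OF J(1)]] in \<open>auto intro: L2_measurable\<close>)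
  also have "\<dots> = P T * (of_real e * of_real ((L2_norm \<nu> f)\<^sup>2)) - \<i> * of_real \<mu> * L2_inner \<nu> J f"
    using L2_inner_diff_left[OF pL L2_scale[OF J(1)] fL, of "\<i> * of_real \<mu>"] prop_pairing[OF e0L f, of T]
    by (simp only: L2_inner_scale_left L2_inner_self P_def)
  finally have uT: "L2_inner \<nu> (u T) f
    = P T * (of_real e * of_real ((L2_norm \<nu> f)\<^sup>2)) - \<i> * of_real \<mu> * L2_inner \<nu> J f" .
  have c1: "\<i> * of_real \<mu> * Q * L2_inner \<nu> (u T) f
    = \<i> * of_real \<mu> * (Q * P T) * (of_real e * of_real ((L2_norm \<nu> f)\<^sup>2))
      + (of_real \<mu> * of_real \<mu>) * (Q * L2_inner \<nu> J f)"
    unfolding uT by (simp add: algebra_simps)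
  have c2: "Q * L2_inner \<nu> J f = Q * (L2_inner \<nu> J f - of_real T * L2_inner \<nu> z f)
      + (Q * P T) * of_real (T * I * e ^ (2 * k + 1))"
    unfolding zf by (simp add: algebra_simps)
  have "\<i> * of_real \<mu> * Q * L2_inner \<nu> (u T) f = \<i> * of_real (\<mu> * e * (L2_norm \<nu> f)\<^sup>2)
      + (Q * (L2_inner \<nu> J f - of_real T * L2_inner \<nu> z f) + of_real (T * I * e ^ (2 * k + 1)))"
    unfolding c1 \<mu>2 c2 Pinv by simp
  then have "Re (\<i> * of_real \<mu> * Q * L2_inner \<nu> (u T) f)
    = Re (Q * (L2_inner \<nu> J f - of_real T * L2_inner \<nu> z f)) + T * I * e ^ (2 * k + 1)"
    by (simp only: plus_complex.sel Re_complex_of_real Re_i_times Im_complex_of_real minus_zero add_0)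
  then have "\<bar>Re (\<i> * of_real \<mu> * Q * L2_inner \<nu> (u T) f) - T * I * e ^ (2 * k + 1)\<bar>
     \<le> cmod (Q * (L2_inner \<nu> J f - of_real T * L2_inner \<nu> z f))"
    by (simp only: add_diff_cancel_right' abs_Re_le_cmod)
  also have "\<dots> = cmod (L2_inner \<nu> J f - of_real T * L2_inner \<nu> z f)"
    by (simp add: norm_mult Q_def)
  finally show ?thesis using err unfolding I_def Q_def by linarith
qed

text \<open>With \<open>a\<close> proportional to \<open>e\<close> the error is a multiple of
  \<open>e ^ (4 * k + 1)\<close>: \<open>2 * k\<close> powers come from the Lipschitz constant and
  \<open>2 * k + 1\<close> from the distance to the free evolution. The constants may depend on
  \<open>f\<close>, since the expansion is only used to identify a derivative for one
  \<open>f\<close> at a time.\<close>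

lemma flow_expansion:
  assumes f: "eigf l f" and \<mu>: "\<mu> = 1 \<or> \<mu> = -1" and T: "0 < T" and k: "1 \<le> k"
  shows "\<exists>C e0. 0 < e0 \<and> (\<forall>e u. 0 < e \<and> e < e0 \<and> H1_solution \<nu> \<phi> lam \<mu> k T (\<lambda>x. of_real e * f x) u \<longrightarrow>
    \<bar>Re (\<i> * of_real \<mu> * exp (\<i> * of_real T * of_real l) * L2_inner \<nu> (u T) f)
      - (T * (LINT x|\<nu>. cmod (f x) ^ (2 * k + 2))) * e ^ (2 * k + 1)\<bar> \<le> C * e ^ (2 * k + 2))"
proof -
  \<comment> \<open>The summand 1 keeps \<open>a\<close> positive even if \<open>f\<close>
    vanishes.\<close>
  define A where "A = nrm 1 f + 1"
  define K where "K = nlc k"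
  define C1 where "C1 = T * (K * (2 * A) ^ (2 * k + 1))"
  define C where "C = T * (real (2 * k + 1) * (60 * A) ^ (2 * k) * (30 * C1) * L2_norm \<nu> f)"
  have f1: "hsummable 1 f" using eigf_Hs(1)[OF f, of 1] by (simp add: Hs_iff)
  have A: "0 < A" "nrm 1 f \<le> A" using nrm_nonneg[OF f1] by (simp_all add: A_def)
  have K: "0 < K" by (simp add: K_def nlc_def)
  have C1: "0 < C1" using A K T by (simp add: C1_def)
  have C: "0 \<le> C" using A C1 T by (simp add: C_def)
  define e0 where "e0 = min 1 (A / C1)"
  have e0: "0 < e0" using A C1 by (simp add: e0_def)
  have "\<bar>Re (\<i> * of_real \<mu> * exp (\<i> * of_real T * of_real l) * L2_inner \<nu> (u T) f)
      - (T * (LINT x|\<nu>. cmod (f x) ^ (2 * k + 2))) * e ^ (2 * k + 1)\<bar> \<le> C * e ^ (2 * k + 2)"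
    if e: "0 < e" "e < e0" and sol: "H1_solution \<nu> \<phi> lam \<mu> k T (\<lambda>x. of_real e * f x) u" for e u
  proof -
    define a where "a = e * A"
    have e1: "e < 1" "e * C1 < A" using e C1 by (simp_all add: e0_def pos_less_divide_eq)
    have a: "0 < a" "e * nrm 1 f \<le> a" using e A by (simp_all add: a_def)
    have da: "T * (K * (2 * a) ^ (2 * k + 1)) = e ^ (2 * k + 1) * C1"
      by (simp add: a_def C1_def power_mult_distrib mult_ac)
    \<comment> \<open>Since \<open>k \<ge> 1\<close>, a power of \<open>e\<close> is left over after
      the factor \<open>e\<close> of \<open>a\<close>, and \<open>e < A / C1\<close> absorbs the
      constant.\<close>
    have "e ^ (2 * k + 1) * C1 \<le> e ^ 2 * C1"
      using e e1 C1 k by (intro mult_right_mono power_decreasing) auto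
    also have "\<dots> < e * A" using e e1 by (simp add: power2_eq_square mult.assoc)
    finally have small: "T * (K * (2 * a) ^ (2 * k + 1)) < a" unfolding da by (simp add: a_def)
    have "\<bar>Re (\<i> * of_real \<mu> * exp (\<i> * of_real T * of_real l) * L2_inner \<nu> (u T) f)
      - (T * (LINT x|\<nu>. cmod (f x) ^ (2 * k + 2))) * e ^ (2 * k + 1)\<bar>
      \<le> T * (real (2 * k + 1) * (60 * a) ^ (2 * k) * (30 * (T * (K * (2 * a) ^ (2 * k + 1)))) * L2_norm \<nu> f)"
      unfolding K_def using flow_pairing[OF f sol \<mu> _ _ a(2,1)] small e T by (simp only: K_def less_imp_le)
    also have "\<dots> = C * e ^ (4 * k + 1)"
    proof -
      have "e ^ (4 * k + 1) = e ^ (2 * k) * e ^ (2 * k + 1)" by (simp add: power_add[symmetric])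
      moreover have "(60 * a) ^ (2 * k) = e ^ (2 * k) * (60 * A) ^ (2 * k)"
        by (simp add: a_def power_mult_distrib)
      ultimately show ?thesis unfolding da C_def by (simp only: mult_ac)
    qed
    \<comment> \<open>\<open>4 * k + 1 \<ge> 2 * k + 2\<close> because \<open>k \<ge> 1\<close>: the
      error is of higher order than the main term.\<close>
    also have "\<dots> \<le> C * e ^ (2 * k + 2)"
      using e e1 C k by (intro mult_left_mono power_decreasing) auto
    finally show ?thesis .
  qed
  then show ?thesis using e0 by blast
qed

end

section \<open>Derivatives of the flow map\<close>

text \<open>Letting \<open>h\<close> tend to 0 from the right isolates \<open>c 0\<close>. Once it
  vanishes, a factor \<open>h\<close> cancels on both sides, which lowers \<open>n\<close> by
  one.\<close>

lemma poly_coeffs_zero_of_small: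
  fixes c :: "nat \<Rightarrow> real"
  assumes d: "0 < d" and bd: "\<And>h. 0 < h \<Longrightarrow> h < d \<Longrightarrow> \<bar>\<Sum>m<n. c m * h ^ m\<bar> \<le> C * h ^ n" and m: "m < n"
  shows "c m = 0"
  using bd m
proof (induction n arbitrary: c m)
  case (Suc n)
  have pos: "\<forall>\<^sub>F h in at_right (0::real). 0 < h \<and> h < d"
    using eventually_at_right[of 0 d] d by (auto simp: eventually_at_right_less eventually_conj_iff)
  have split: "(\<Sum>m<Suc n. c m * h ^ m) = c 0 + h * (\<Sum>m<n. c (Suc m) * h ^ m)" for h
    unfolding sum.lessThan_Suc_shift by (simp add: sum_distrib_left mult_ac)
  have "((\<lambda>h. \<Sum>m<Suc n. c m * h ^ m) \<longlongrightarrow> 0) (at_right 0)"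
  proof (rule Lim_null_comparison)
    show "\<forall>\<^sub>F h in at_right 0. norm (\<Sum>m<Suc n. c m * h ^ m) \<le> C * h ^ Suc n"
      using pos by eventually_elim (use Suc.prems(1) in auto)
    have "((\<lambda>h. C * h ^ Suc n) \<longlongrightarrow> C * 0 ^ Suc n) (at_right 0)" by (intro tendsto_intros)
    then show "((\<lambda>h. C * h ^ Suc n) \<longlongrightarrow> 0) (at_right 0)" by simp
  qed
  moreover have "((\<lambda>h. c 0 + h * (\<Sum>m<n. c (Suc m) * h ^ m)) \<longlongrightarrow> c 0 + 0 * (\<Sum>m<n. c (Suc m) * 0 ^ m)) (at_right 0)"
    by (intro tendsto_intros)
  ultimately have c0: "c 0 = 0"
    unfolding split by (metis (no_types, lifting) add_0_right mult_zero_left tendsto_unique trivial_limit_at_right_real)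
  have "\<bar>\<Sum>m<n. c (Suc m) * h ^ m\<bar> \<le> C * h ^ n" if "0 < h" "h < d" for h
  proof -
    have "h * \<bar>\<Sum>m<n. c (Suc m) * h ^ m\<bar> \<le> h * (C * h ^ n)"
      using Suc.prems(1)[OF that] that unfolding split by (simp add: c0 abs_mult mult_ac)
    then show ?thesis using that by simp
  qed
  then have "c (Suc m) = 0" if "m < n" for m using Suc.IH[of "\<lambda>m. c (Suc m)" m] that by blast
  then show ?case using c0 Suc.prems(2) by (cases m) auto
qed simp

text \<open>The expansion says nothing directly about derivatives. By Maclaurin's formula the Taylor
  polynomial of degree below \<open>n\<close> is of size \<open>h ^ n\<close>, so its coefficients
  vanish. What is left compares \<open>g n t\<close> with \<open>fact n * b\<close> at points
  \<open>t\<close> tending to 0, where \<open>g n\<close> is continuous.\<close>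

lemma top_derivative_of_expansion:
  fixes g :: "nat \<Rightarrow> real \<Rightarrow> real"
  assumes d: "0 < d" and der: "\<And>m t. m < n \<Longrightarrow> \<bar>t\<bar> < d \<Longrightarrow> (g m has_real_derivative g (Suc m) t) (at t)"
    and cont: "isCont (g n) 0" and n: "0 < n"
    and exp: "\<And>h. 0 < h \<Longrightarrow> h < d \<Longrightarrow> \<bar>g 0 h - b * h ^ n\<bar> \<le> C * h ^ Suc n"
  shows "g n 0 = fact n * b"
proof -
  have mac: "\<exists>t. 0 < t \<and> t < h \<and> g 0 h = (\<Sum>m<n. g m 0 / fact m * h ^ m) + g n t / fact n * h ^ n" if "0 < h" "h < d" for h
    using that n der by (intro Maclaurin) auto
  obtain r where r: "r > 0" "\<And>t. \<bar>t\<bar> < r \<Longrightarrow> \<bar>g n t - g n 0\<bar> < 1"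
    using cont unfolding continuous_at_eps_delta dist_real_def by (metis diff_zero zero_less_one)
  define B where "B = \<bar>g n 0\<bar> + 1"
  have B0: "B > 0" by (simp add: B_def)
  have Bt: "\<bar>g n t\<bar> \<le> B" if "\<bar>t\<bar> < r" for t
    using r(2)[OF that] unfolding B_def by linarith
  \<comment> \<open>Below \<open>r\<close> the top derivative is bounded by \<open>B\<close>; below
    1 higher powers of \<open>h\<close> are smaller.\<close>
  define d' where "d' = min (min d r) 1"
  have d': "0 < d'" "d' \<le> d" "d' \<le> r" "d' \<le> 1" using d r(1) by (auto simp: d'_def)
  have z: "g m 0 / fact m = 0" if "m < n" for m
  proof (rule poly_coeffs_zero_of_small[OF d'(1) _ that])
    fix h :: real assume h: "0 < h" "h < d'"
    obtain t where t: "0 < t" "t < h" "g 0 h = (\<Sum>m<n. g m 0 / fact m * h ^ m) + g n t / fact n * h ^ n"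
      using mac[of h] h d' by auto
    have "\<bar>g n t / fact n * h ^ n\<bar> \<le> B * h ^ n"
    proof -
      have "\<bar>g n t / fact n\<bar> \<le> B / 1"
        unfolding abs_divide using Bt[of t] B0 t h d' by (intro frac_le) auto
      then have "\<bar>g n t / fact n\<bar> * h ^ n \<le> B * h ^ n" using h by (intro mult_right_mono) auto
      moreover have "\<bar>g n t / fact n * h ^ n\<bar> = \<bar>g n t / fact n\<bar> * h ^ n"
        using h by (simp only: abs_mult power_abs abs_of_pos)
      ultimately show ?thesis by (simp only:)
    qed
    moreover have "\<bar>g 0 h - b * h ^ n\<bar> \<le> \<bar>C\<bar> * h ^ n"
    proof -
      have "C * h ^ Suc n \<le> \<bar>C\<bar> * h ^ n"
        using h d' by (intro mult_mono power_decreasing) auto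
      moreover have "h < d" using h d' by simp
      ultimately show ?thesis using exp[OF h(1)] by linarith
    qed
    moreover have "\<bar>b * h ^ n\<bar> = \<bar>b\<bar> * h ^ n" using h by (simp add: abs_mult)
    ultimately show "\<bar>\<Sum>m<n. g m 0 / fact m * h ^ m\<bar> \<le> (B + \<bar>C\<bar> + \<bar>b\<bar>) * h ^ n"
      unfolding distrib_right using t(3) by linarith
  qed
  have key: "\<exists>t. 0 < t \<and> t < h \<and> \<bar>g n t / fact n - b\<bar> \<le> C * h" if h: "0 < h" "h < d'" for h
  proof -
    obtain t where t: "0 < t" "t < h" "g 0 h = (\<Sum>m<n. g m 0 / fact m * h ^ m) + g n t / fact n * h ^ n"
      using mac[of h] h d' by auto
    have "(\<Sum>m<n. g m 0 / fact m * h ^ m) = 0" using z by (intro sum.neutral) auto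
    then have "g 0 h - b * h ^ n = h ^ n * (g n t / fact n - b)" using t(3) by (simp add: algebra_simps)
    then have "h ^ n * \<bar>g n t / fact n - b\<bar> \<le> h ^ n * (C * h)"
      using exp[of h] h d' by (simp add: abs_mult mult_ac)
    then have "\<bar>g n t / fact n - b\<bar> \<le> C * h" using h by simp
    then show ?thesis using t by blast
  qed
  have "\<bar>g n 0 / fact n - b\<bar> \<le> 0"
  proof (rule field_le_epsilon)
    fix e :: real assume e: "e > 0"
    obtain r1 where r1: "r1 > 0" "\<And>t. \<bar>t\<bar> < r1 \<Longrightarrow> \<bar>g n t - g n 0\<bar> < e / 2"
      using cont e unfolding continuous_at_eps_delta dist_real_def by (metis diff_zero half_gt_zero)
    define h where "h = min (min (d' / 2) r1) (e / (2 * (\<bar>C\<bar> + 1)))"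
    have h: "0 < h" "h < d'" "h \<le> r1" "h \<le> e / (2 * (\<bar>C\<bar> + 1))"
      using d' r1 e by (auto simp: h_def)
    obtain t where t: "0 < t" "t < h" "\<bar>g n t / fact n - b\<bar> \<le> C * h" using key h by blast
    have "C * h \<le> (\<bar>C\<bar> + 1) * h" using h by (intro mult_right_mono) auto
    also have "\<dots> \<le> e / 2" using h(4) by (simp add: field_simps)
    finally have 1: "\<bar>g n t / fact n - b\<bar> \<le> e / 2" using t(3) by linarith
    have "\<bar>g n t / fact n - g n 0 / fact n\<bar> = \<bar>g n t - g n 0\<bar> / fact n"
      by (simp add: diff_divide_distrib[symmetric])
    also have "\<dots> \<le> (e / 2) / 1" using r1(2)[of t] t h e by (intro frac_le) auto
    finally show "\<bar>g n 0 / fact n - b\<bar> \<le> 0 + e" using 1 by linarith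
  qed
  then have "g n 0 / fact n = b" by simp
  then show ?thesis by (simp add: field_simps)
qed

text \<open>A bounded linear functional \<open>L\<close> on the target turns a C^n map along a line
  into a real function whose derivatives have all arguments equal to \<open>v\<close>. The Frechet
  estimates are uniform over arguments in the unit ball, hence the normalization of
  \<open>v\<close>. Identities in the target hold modulo null vectors, which \<open>L\<close>
  annihilates by its bound.\<close>

lemma directional_derivatives:
  fixes X :: "'a::real_vector set" and Y :: "'b::real_vector set" and D :: "nat \<Rightarrow> 'a \<Rightarrow> 'a list \<Rightarrow> 'b"
  assumes mult: "\<And>j x. j \<le> n \<Longrightarrow> x \<in> U \<Longrightarrow> bounded_multilinear_map j X NX Y NY (D j x)"
    and diff: "\<And>j x e. j < n \<Longrightarrow> x \<in> U \<Longrightarrow> e > 0 \<Longrightarrow> \<exists>d>0. \<forall>h\<in>X. NX h < d \<and> x + h \<in> U \<longrightarrow>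
           (\<forall>hs. length hs = j \<and> set hs \<subseteq> X \<and> (\<forall>g\<in>set hs. NX g \<le> 1) \<longrightarrow>
              NY (D j (x + h) hs - D j x hs - D (Suc j) x (h # hs)) \<le> e * NX h)"
    and cont: "\<And>x e. x \<in> U \<Longrightarrow> e > 0 \<Longrightarrow> \<exists>d>0. \<forall>y\<in>U. NX (y - x) < d \<longrightarrow>
           (\<forall>hs. length hs = n \<and> set hs \<subseteq> X \<and> (\<forall>g\<in>set hs. NX g \<le> 1) \<longrightarrow>
              NY (D n y hs - D n x hs) \<le> e)"
    and r: "0 < r" and U: "\<And>t. \<bar>t\<bar> < r \<Longrightarrow> t *\<^sub>R v \<in> U"
    and X: "\<And>c. c *\<^sub>R v \<in> X" "\<And>c. NX (c *\<^sub>R v) = \<bar>c\<bar> * NX v" and v: "NX v \<le> 1" "0 \<le> NX v"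
    and Y: "\<And>y z. y \<in> Y \<Longrightarrow> z \<in> Y \<Longrightarrow> y - z \<in> Y" "\<And>y z. y \<in> Y \<Longrightarrow> z \<in> Y \<Longrightarrow> y + z \<in> Y" "\<And>c y. y \<in> Y \<Longrightarrow> c *\<^sub>R y \<in> Y"
    and L: "\<And>y z. y \<in> Y \<Longrightarrow> z \<in> Y \<Longrightarrow> L (y - z) = L y - L z" "\<And>y z. y \<in> Y \<Longrightarrow> z \<in> Y \<Longrightarrow> L (y + z) = L y + L z"
      "\<And>c y. y \<in> Y \<Longrightarrow> L (c *\<^sub>R y) = c * L y" "\<And>y. y \<in> Y \<Longrightarrow> \<bar>L y\<bar> \<le> K * NY y"
    and K: "0 \<le> K"
  shows "\<And>j t. j < n \<Longrightarrow> \<bar>t\<bar> < r \<Longrightarrow>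
      ((\<lambda>t. L (D j (t *\<^sub>R v) (replicate j v))) has_real_derivative L (D (Suc j) (t *\<^sub>R v) (replicate (Suc j) v))) (at t)"
    and "isCont (\<lambda>t. L (D n (t *\<^sub>R v) (replicate n v))) 0"
proof -
  let ?P = "\<lambda>j t. D j (t *\<^sub>R v) (replicate j v)"
  have vX: "v \<in> X" using X(1)[of 1] by simp
  have zX: "0 \<in> X" using X(1)[of 0] by simp
  have Nz: "NX 0 = 0" using X(2)[of 0] by simp
  have DY: "D j x hs \<in> Y" if "j \<le> n" "x \<in> U" "length hs = j" "set hs \<subseteq> X" for j x hs
    using mult[OF that(1,2)] that(3,4) unfolding bounded_multilinear_map_def by blast
  have rep: "set (replicate j v) \<subseteq> X" "\<forall>g\<in>set (replicate j v). NX g \<le> 1" for j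
    using vX v by auto
  \<comment> \<open>Linearity is available for combinations \<open>c a + b\<close> only. With
    \<open>b = 0\<close> a value at the argument 0 remains; it is null by boundedness of the
    multilinear map.\<close>
  have hom: "L (D (Suc j) x ((c *\<^sub>R v) # replicate j v)) = c * L (D (Suc j) x (v # replicate j v))"
    if j: "Suc j \<le> n" and x: "x \<in> U" for j x c
  proof -
    let ?D = "\<lambda>a. D (Suc j) x (a # replicate j v)"
    note m = mult[OF j x, unfolded bounded_multilinear_map_def]
    have in_X: "set (v # replicate j v) \<subseteq> X" "set (0 # replicate j v) \<subseteq> X" "set ((c *\<^sub>R v) # replicate j v) \<subseteq> X"
      using vX zX X(1) rep by auto
    obtain C where C: "\<And>hs. length hs = Suc j \<Longrightarrow> set hs \<subseteq> X \<Longrightarrow> NY (D (Suc j) x hs) \<le> C * prod_list (map NX hs)"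
      using m by blast
    have y1: "?D v \<in> Y" and y0: "?D 0 \<in> Y"
      and yc: "?D (c *\<^sub>R v) \<in> Y"
      using in_X by (auto intro!: DY[OF j x])
    have "NY (?D 0) \<le> 0"
      using C[of "0 # replicate j v"] in_X by (simp add: Nz)
    then have "K * NY (?D 0) \<le> 0" by (rule mult_nonneg_nonpos[OF K])
    then have L0: "L (?D 0) = 0" using L(4)[OF y0] by linarith
    have "NY (D (Suc j) x ((v # replicate j v)[0 := c *\<^sub>R v + 0])
        - (c *\<^sub>R D (Suc j) x ((v # replicate j v)[0 := v]) + D (Suc j) x ((v # replicate j v)[0 := 0]))) = 0"
      using m in_X(1) vX zX by (metis length_Cons length_replicate zero_less_Suc)
    then have n0: "NY (?D (c *\<^sub>R v)
        - (c *\<^sub>R ?D v + ?D 0)) = 0" by simp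
    have "\<bar>L (?D (c *\<^sub>R v)
        - (c *\<^sub>R ?D v + ?D 0))\<bar> \<le> K * 0"
      using L(4)[OF Y(1)[OF yc Y(2)[OF Y(3)[OF y1] y0]], of c] unfolding n0 .
    then have "L (?D (c *\<^sub>R v))
        - (c * L (?D v) + L (?D 0)) = 0"
      using L(1)[OF yc Y(2)[OF Y(3)[OF y1] y0], of c] L(2)[OF Y(3)[OF y1] y0, of c] L(3)[OF y1, of c] by simp
    then show ?thesis using L0 by simp
  qed
  show "((\<lambda>t. L (?P j t)) has_real_derivative L (?P (Suc j) t)) (at t)"
    if j: "j < n" and t: "\<bar>t\<bar> < r" for j t
    unfolding DERIV_def LIM_eq
  proof (intro allI impI)
    fix e :: real assume e: "e > 0"
    \<comment> \<open>\<open>K + 1\<close> because \<open>K\<close> may be 0; halving makes the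
      final inequality strict.\<close>
    define e' where "e' = (e / 2) / (K + 1)"
    have e': "e' > 0" using e K by (simp add: e'_def)
    have Ce: "K * e' < e"
    proof -
      have "K + 1 \<noteq> 0" using K by linarith
      then have "(K + 1) * e' = e / 2" unfolding e'_def by (metis nonzero_mult_div_cancel_left times_divide_eq_right)
      moreover have "K * e' \<le> (K + 1) * e'" using e' by (intro mult_right_mono) auto
      ultimately show ?thesis using e by linarith
    qed
    have tU: "t *\<^sub>R v \<in> U" by (rule U[OF t])
    obtain d where d: "d > 0" "\<And>h hs. h \<in> X \<Longrightarrow> NX h < d \<Longrightarrow> t *\<^sub>R v + h \<in> U \<Longrightarrow> length hs = j \<Longrightarrow> set hs \<subseteq> X \<Longrightarrow> \<forall>g\<in>set hs. NX g \<le> 1 \<Longrightarrow>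
        NY (D j (t *\<^sub>R v + h) hs - D j (t *\<^sub>R v) hs - D (Suc j) (t *\<^sub>R v) (h # hs)) \<le> e' * NX h"
      using diff[OF j tU e'] by (metis (no_types, lifting))
    define d1 where "d1 = min d (r - \<bar>t\<bar>)"
    have d1: "d1 > 0" using d t by (simp add: d1_def)
    have "norm ((L (?P j (t + h)) - L (?P j t)) / h
        - L (?P (Suc j) t)) < e" if h: "h \<noteq> 0" "norm (h - 0) < d1" for h
    proof -
      have h': "\<bar>h\<bar> < d" "\<bar>t + h\<bar> < r" using h by (auto simp: d1_def)
      have thU: "(t + h) *\<^sub>R v \<in> U" by (rule U[OF h'(2)])
      have th: "(t + h) *\<^sub>R v = t *\<^sub>R v + h *\<^sub>R v" by (rule scaleR_left_distrib)
      have Nh: "NX (h *\<^sub>R v) \<le> \<bar>h\<bar>" using X(2)[of h] v by (simp add: mult_left_le)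
      have a: "?P j (t + h) \<in> Y" "?P j t \<in> Y"
        "D (Suc j) (t *\<^sub>R v) ((h *\<^sub>R v) # replicate j v) \<in> Y"
        using j thU tU rep X(1) vX by (auto intro!: DY)
      have "NY (?P j (t + h) - ?P j t - D (Suc j) (t *\<^sub>R v) ((h *\<^sub>R v) # replicate j v)) \<le> e' * NX (h *\<^sub>R v)"
        unfolding th by (rule d(2)) (use X(1) Nh h' thU rep in \<open>auto simp: th\<close>)
      also have "\<dots> \<le> e' * \<bar>h\<bar>" using Nh e' by (intro mult_left_mono) auto
      finally have "K * NY (?P j (t + h) - ?P j t - D (Suc j) (t *\<^sub>R v) ((h *\<^sub>R v) # replicate j v)) \<le> K * (e' * \<bar>h\<bar>)"
        using K by (rule mult_left_mono)
      then have "\<bar>L (?P j (t + h)) - L (?P j t) - h * L (D (Suc j) (t *\<^sub>R v) (v # replicate j v))\<bar> \<le> K * e' * \<bar>h\<bar>"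
        using L(4)[OF Y(1)[OF Y(1)[OF a(1,2)] a(3)]] L(1)[OF Y(1)[OF a(1,2)] a(3)] L(1)[OF a(1,2)] hom[of j "t *\<^sub>R v" h] j tU
        by simp
      moreover have "(L (?P j (t + h)) - L (?P j t)) / h
        - L (?P (Suc j) t)
        = (L (?P j (t + h)) - L (?P j t) - h * L (D (Suc j) (t *\<^sub>R v) (v # replicate j v))) / h"
        using h by (simp add: diff_divide_distrib)
      ultimately have "norm ((L (?P j (t + h)) - L (?P j t)) / h
        - L (?P (Suc j) t)) \<le> K * e'"
        using h by (simp add: abs_divide pos_divide_le_eq)
      also note Ce
      finally show ?thesis .
    qed
    then show "\<exists>s>0. \<forall>h. h \<noteq> 0 \<and> norm (h - 0) < s \<longrightarrow> norm ((L (?P j (t + h)) - L (?P j t)) / h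
        - L (?P (Suc j) t)) < e"
      using d1 by blast
  qed
  show "isCont (\<lambda>t. L (?P n t)) 0"
    unfolding continuous_at_eps_delta dist_real_def
  proof (intro allI impI)
    fix e :: real assume e: "e > 0"
    define e' where "e' = (e / 2) / (K + 1)"
    have e': "e' > 0" using e K by (simp add: e'_def)
    have Ce: "K * e' < e"
    proof -
      have "K + 1 \<noteq> 0" using K by linarith
      then have "(K + 1) * e' = e / 2" unfolding e'_def by (metis nonzero_mult_div_cancel_left times_divide_eq_right)
      moreover have "K * e' \<le> (K + 1) * e'" using e' by (intro mult_right_mono) auto
      ultimately show ?thesis using e by linarith
    qed
    have tU: "0 *\<^sub>R v \<in> U" using U[of 0] r by simp
    obtain d where d: "d > 0" "\<And>y hs. y \<in> U \<Longrightarrow> NX (y - 0 *\<^sub>R v) < d \<Longrightarrow> length hs = n \<Longrightarrow> set hs \<subseteq> X \<Longrightarrow> \<forall>g\<in>set hs. NX g \<le> 1 \<Longrightarrow>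
        NY (D n y hs - D n (0 *\<^sub>R v) hs) \<le> e'"
      using cont[OF tU e'] by (metis (no_types, lifting))
    have "\<bar>L (?P n t) - L (?P n 0)\<bar> < e" if t: "\<bar>t - 0\<bar> < min d r" for t
    proof -
      have t': "\<bar>t\<bar> < d" "\<bar>t\<bar> < r" using t by auto
      have U': "t *\<^sub>R v \<in> U" by (rule U[OF t'(2)])
      have a: "?P n t \<in> Y" "?P n 0 \<in> Y"
        using U' tU rep vX by (auto intro!: DY)
      have "NX (t *\<^sub>R v) \<le> \<bar>t\<bar>" using X(2)[of t] v by (simp add: mult_left_le)
      then have "NY (?P n t - ?P n 0) \<le> e'"
        using t' U' rep by (intro d(2)) auto
      then have "K * NY (?P n t - ?P n 0) \<le> K * e'"
        using K by (rule mult_left_mono)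
      also note Ce
      finally show ?thesis using L(4)[OF Y(1)[OF a]] L(1)[OF a] by simp
    qed
    then show "\<exists>d>0. \<forall>t. \<bar>t - 0\<bar> < d \<longrightarrow> \<bar>L (?P n t) - L (?P n 0)\<bar> < e"
      using d(1) r by (intro exI[of _ "min d r"]) auto
  qed
qed

context gasket_eigenbasis
begin

section \<open>The space of continuous curves in H^s\<close>

abbreviation CN :: "real \<Rightarrow> real \<Rightarrow> (real \<Rightarrow> real^2 \<Rightarrow> complex) \<Rightarrow> real" where
  "CN s T \<equiv> C_Hs_norm \<nu> \<phi> lam s T"

abbreviation CH :: "real \<Rightarrow> real \<Rightarrow> (real \<Rightarrow> real^2 \<Rightarrow> complex) set" where
  "CH s T \<equiv> C_Hs \<nu> \<phi> lam s T"

lemma fun_ops: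
  "(u :: real^2 \<Rightarrow> complex) - v = (\<lambda>x. u x - v x)" "u + v = (\<lambda>x. u x + v x)" "c *\<^sub>R u = (\<lambda>x. of_real c * u x)"
  by (rule ext; simp add: scaleR_fun_def scaleR_conv_of_real)+

lemma C_Hs_iff:
  "u \<in> CH s T \<longleftrightarrow> (\<forall>t\<in>{-T..T}. u t \<in> H s) \<and>
     (\<forall>t\<in>{-T..T}. ((\<lambda>t'. nrm s (\<lambda>x. u t' x - u t x)) \<longlongrightarrow> 0) (at t within {-T..T}))"
  by (simp only: C_Hs_def fun_ops mem_Collect_eq)

lemma C_Hs_add:
  assumes s: "0 \<le> s" and u: "u \<in> CH s T" and v: "v \<in> CH s T"
  shows "u + v \<in> CH s T"
  unfolding C_Hs_iff
proof (intro conjI ballI)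
  have uH: "u t \<in> H s" "v t \<in> H s" if "t \<in> {-T..T}" for t using u v that by (auto simp: C_Hs_iff)
  show "(u + v) t \<in> H s" if "t \<in> {-T..T}" for t
    using Hs_add(1)[OF s uH[OF that]] by (simp add: fun_ops)
  fix t assume t: "t \<in> {-T..T}"
  show "((\<lambda>t'. nrm s (\<lambda>x. (u + v) t' x - (u + v) t x)) \<longlongrightarrow> 0) (at t within {-T..T})"
  proof (rule Lim_null_comparison)
    have "((\<lambda>t'. nrm s (\<lambda>x. u t' x - u t x) + nrm s (\<lambda>x. v t' x - v t x)) \<longlongrightarrow> 0 + 0) (at t within {-T..T})"
      using u v t unfolding C_Hs_iff by (intro tendsto_add) blast+
    then show "((\<lambda>t'. nrm s (\<lambda>x. u t' x - u t x) + nrm s (\<lambda>x. v t' x - v t x)) \<longlongrightarrow> 0) (at t within {-T..T})" by simp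
    have "norm (nrm s (\<lambda>x. (u + v) t' x - (u + v) t x)) \<le> nrm s (\<lambda>x. u t' x - u t x) + nrm s (\<lambda>x. v t' x - v t x)"
      if t': "t' \<in> {-T..T}" for t'
    proof -
      have d: "(\<lambda>x. u t' x - u t x) \<in> H s" "(\<lambda>x. v t' x - v t x) \<in> H s"
        using Hs_diff(1)[OF s] uH t t' by auto
      have "(\<lambda>x. (u + v) t' x - (u + v) t x) = (\<lambda>x. (u t' x - u t x) + (v t' x - v t x))"
        by (rule ext) simp
      then show ?thesis
        using Hs_add[OF s d] nrm_nonneg[of s "\<lambda>x. (u t' x - u t x) + (v t' x - v t x)"] s by (simp add: Hs_iff)
    qed
    then show "\<forall>\<^sub>F t' in at t within {-T..T}. norm (nrm s (\<lambda>x. (u + v) t' x - (u + v) t x))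
        \<le> nrm s (\<lambda>x. u t' x - u t x) + nrm s (\<lambda>x. v t' x - v t x)"
      by (auto simp: eventually_at_filter)
  qed
qed

lemma C_Hs_scaleR:
  assumes s: "0 \<le> s" and u: "u \<in> CH s T" shows "c *\<^sub>R u \<in> CH s T"
  unfolding C_Hs_iff
proof (intro conjI ballI)
  have uH: "u t \<in> H s" if "t \<in> {-T..T}" for t using u that by (auto simp: C_Hs_iff)
  have sc: "(c *\<^sub>R u) t = (\<lambda>x. of_real c * u t x)" for t
    by (simp add: scaleR_fun_def scaleR_conv_of_real)
  show "(c *\<^sub>R u) t \<in> H s" if "t \<in> {-T..T}" for t
    unfolding sc by (rule Hs_scale[OF s uH[OF that]])
  fix t assume t: "t \<in> {-T..T}"
  have lim: "((\<lambda>t'. \<bar>c\<bar> * nrm s (\<lambda>x. u t' x - u t x)) \<longlongrightarrow> \<bar>c\<bar> * 0) (at t within {-T..T})"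
    using u t unfolding C_Hs_iff by (intro tendsto_mult tendsto_const) blast
  have "\<forall>\<^sub>F t' in at t within {-T..T}. \<bar>c\<bar> * nrm s (\<lambda>x. u t' x - u t x) = nrm s (\<lambda>x. (c *\<^sub>R u) t' x - (c *\<^sub>R u) t x)"
  proof -
    have "\<bar>c\<bar> * nrm s (\<lambda>x. u t' x - u t x) = nrm s (\<lambda>x. (c *\<^sub>R u) t' x - (c *\<^sub>R u) t x)" if t': "t' \<in> {-T..T}" for t'
    proof -
      have "(\<lambda>x. u t' x - u t x) \<in> H s" using Hs_diff(1)[OF s uH[OF t'] uH[OF t]] .
      then have "nrm s (\<lambda>x. of_real c * (u t' x - u t x)) = \<bar>c\<bar> * nrm s (\<lambda>x. u t' x - u t x)"
        using s by (subst nrm_scale) (simp_all add: Hs_iff)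
      then show ?thesis by (simp add: sc right_diff_distrib)
    qed
    then show ?thesis by (auto simp: eventually_at_filter)
  qed
  then show "((\<lambda>t'. nrm s (\<lambda>x. (c *\<^sub>R u) t' x - (c *\<^sub>R u) t x)) \<longlongrightarrow> 0) (at t within {-T..T})"
    using Lim_transform_eventually[OF lim] by simp
qed

lemma C_Hs_minus:
  assumes s: "0 \<le> s" and u: "u \<in> CH s T" and v: "v \<in> CH s T"
  shows "u - v \<in> CH s T"
  using C_Hs_add[OF s u C_Hs_scaleR[OF s v, of "-1"]] by simp

text \<open>\<open>C_Hs_norm\<close> is a real supremum, which bounds its members only when the
  range is bounded above; continuity on a compact interval provides this.\<close>

lemma nrm_le_C_Hs_norm:
  assumes s: "0 \<le> s" and u: "u \<in> CH s T" and T: "0 \<le> T"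
  shows "nrm s (u T) \<le> CN s T u"
  unfolding C_Hs_norm_def
proof (rule cSUP_upper)
  have "compact ((\<lambda>t. nrm s (u t)) ` {-T..T})"
    by (intro compact_continuous_image nrm_continuous s u) simp
  then show "bdd_above ((\<lambda>t. nrm s (u t)) ` {-T..T})"
    by (intro bounded_imp_bdd_above compact_imp_bounded)
qed (use T in simp)

section \<open>The derivative of order \<open>2 * k + 1\<close> at the origin\<close>

text \<open>The derivative along \<open>f\<close>, paired with \<open>f\<close> at time
  \<open>T\<close>, is identified by \<open>flow_expansion\<close> and bounded by multilinearity at
  the origin together with \<open>eigf_pairing\<close>. The constant \<open>C\<close> belongs to the
  derivative at the single point 0, so it is independent of \<open>f\<close> and \<open>l\<close>;
  this uniformity is what the localized family contradicts.\<close>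

lemma top_derivative_bound:
  assumes s: "0 \<le> s" and T: "0 < T" and k: "1 \<le> k" and \<mu>: "\<mu> = 1 \<or> \<mu> = -1"
    and U: "seminorm_open (H s) (nrm s) U" "0 \<in> U"
    and ext: "extends_H1_flow \<nu> \<phi> lam \<mu> k T U \<Phi>"
    and Ck: "Ck_map_on (2 * k + 1) (H s) (nrm s) (CH s T) (CN s T) U \<Phi>"
  shows "\<exists>C. \<forall>l f. 0 \<le> l \<longrightarrow> eigf l f \<longrightarrow> nrm s f \<le> 1 \<longrightarrow>
    fact (2 * k + 1) * (T * (LINT x|\<nu>. cmod (f x) ^ (2 * k + 2)))
      \<le> (1 + l) powr (- (s/2)) * L2_norm \<nu> f * (C * nrm s f ^ (2 * k + 1))"
proof -
  define n where "n = 2 * k + 1"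
  obtain D :: "nat \<Rightarrow> (real^2 \<Rightarrow> complex) \<Rightarrow> (real^2 \<Rightarrow> complex) list \<Rightarrow> real \<Rightarrow> real^2 \<Rightarrow> complex" where
    D0: "\<forall>x\<in>U. D 0 x [] = \<Phi> x" and
    Dm: "\<forall>j\<le>n. \<forall>x\<in>U. bounded_multilinear_map j (H s) (nrm s) (CH s T) (CN s T) (D j x)" and
    Dd: "\<forall>j<n. \<forall>x\<in>U. \<forall>e>0. \<exists>d>0. \<forall>h\<in>H s. nrm s h < d \<and> x + h \<in> U \<longrightarrow>
           (\<forall>hs. length hs = j \<and> set hs \<subseteq> H s \<and> (\<forall>g\<in>set hs. nrm s g \<le> 1) \<longrightarrow>
              CN s T (D j (x + h) hs - D j x hs - D (Suc j) x (h # hs)) \<le> e * nrm s h)" and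
    Dc: "\<forall>x\<in>U. \<forall>e>0. \<exists>d>0. \<forall>y\<in>U. nrm s (y - x) < d \<longrightarrow>
           (\<forall>hs. length hs = n \<and> set hs \<subseteq> H s \<and> (\<forall>g\<in>set hs. nrm s g \<le> 1) \<longrightarrow>
              CN s T (D n y hs - D n x hs) \<le> e)"
    using Ck unfolding Ck_map_on_def n_def[symmetric] by (elim exE conjE) (rule that)
  have "bounded_multilinear_map n (H s) (nrm s) (CH s T) (CN s T) (D n 0)"
    using Dm U(2) by blast
  then obtain C where C: "\<And>hs. length hs = n \<Longrightarrow> set hs \<subseteq> H s \<Longrightarrow> CN s T (D n 0 hs) \<le> C * prod_list (map (nrm s) hs)"
    unfolding bounded_multilinear_map_def by blast
  obtain V where V: "V \<subseteq> U" "seminorm_open (H 1) (nrm 1) V" "0 \<in> V"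
    and sol: "\<forall>u0\<in>V. \<exists>u. H1_solution \<nu> \<phi> lam \<mu> k T u0 u \<and> (\<forall>t\<in>{-T..T}. AE x in \<nu>. \<Phi> u0 t x = u t x)"
    using ext unfolding extends_H1_flow_def by (elim exE conjE) (rule that)
  have minus_zero_fun: "(y :: real^2 \<Rightarrow> complex) - 0 = y" for y by simp
  obtain rU where rU: "rU > 0" "\<And>y. y \<in> H s \<Longrightarrow> nrm s y < rU \<Longrightarrow> y \<in> U"
    using U unfolding seminorm_open_def by (metis minus_zero_fun)
  obtain rV where rV: "rV > 0" "\<And>y. y \<in> H 1 \<Longrightarrow> nrm 1 y < rV \<Longrightarrow> y \<in> V"
    using V(2,3) unfolding seminorm_open_def by (metis minus_zero_fun)
  have "fact n * (T * (LINT x|\<nu>. cmod (f x) ^ (2 * k + 2)))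
      \<le> (1 + l) powr (- (s/2)) * L2_norm \<nu> f * (C * nrm s f ^ n)"
    if l: "0 \<le> l" and f: "eigf l f" and f1: "nrm s f \<le> 1" for l f
  proof -
    define C0 where "C0 = (1 + l) powr (- (s/2)) * L2_norm \<nu> f"
    define \<kappa> where "\<kappa> = \<i> * complex_of_real \<mu> * exp (\<i> * of_real T * of_real l)"
    define L where "L y = Re (\<kappa> * L2_inner \<nu> (y T) f)" for y :: "real \<Rightarrow> real^2 \<Rightarrow> complex"
    define b where "b = T * (LINT x|\<nu>. cmod (f x) ^ (2 * k + 2))"
    have \<kappa>: "cmod \<kappa> = 1" using \<mu> by (auto simp: \<kappa>_def norm_mult)
    have C0: "0 \<le> C0" by (simp add: C0_def)
    have fL: "f \<in> L2 \<nu>" by (rule eigf_L2[OF f])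
    have fH: "f \<in> H s" "f \<in> H 1" using eigf_Hs(1)[OF f] s by auto
    have fh: "hsummable s f" "hsummable 1 f" using fH s by (simp_all add: Hs_iff)
    have cf: "c *\<^sub>R f = (\<lambda>x. of_real c * f x)" for c by (rule fun_ops)
    have X: "c *\<^sub>R f \<in> H s" "nrm s (c *\<^sub>R f) = \<bar>c\<bar> * nrm s f" "c *\<^sub>R f \<in> H 1" "nrm 1 (c *\<^sub>R f) = \<bar>c\<bar> * nrm 1 f" for c
      unfolding cf using Hs_scale fH s nrm_scale[OF fh(1), of "of_real c"] nrm_scale[OF fh(2), of "of_real c"] by auto
    have yT: "y T \<in> H s" "y T \<in> L2 \<nu>" if "y \<in> CH s T" for y
    proof -
      show "y T \<in> H s" using that T by (auto simp: C_Hs_iff)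
      then show "y T \<in> L2 \<nu>" using s by (simp add: Hs_iff)
    qed
    have L_diff: "L (y - z) = L y - L z" if "y \<in> CH s T" "z \<in> CH s T" for y z
      using L2_inner_diff_left[OF yT(2)[OF that(1)] yT(2)[OF that(2)] fL]
      by (simp only: L_def fun_diff_def fun_ops right_diff_distrib minus_complex.sel)
    have L_add: "L (y + z) = L y + L z" if "y \<in> CH s T" "z \<in> CH s T" for y z
      using L2_inner_add_left[OF yT(2)[OF that(1)] yT(2)[OF that(2)] fL]
      by (simp only: L_def plus_fun_def distrib_left plus_complex.sel)
    have L_scale: "L (c *\<^sub>R y) = c * L y" for c y
    proof -
      have "L2_inner \<nu> ((c *\<^sub>R y) T) f = of_real c * L2_inner \<nu> (y T) f"
        unfolding L2_inner_scale_left[symmetric] by (simp add: scaleR_fun_def scaleR_conv_of_real)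
      then have "\<kappa> * L2_inner \<nu> ((c *\<^sub>R y) T) f = of_real c * (\<kappa> * L2_inner \<nu> (y T) f)"
        by (simp only: mult.left_commute)
      moreover have "Re (of_real c * z) = c * Re z" for z by simp
      ultimately show ?thesis by (simp only: L_def)
    qed
    have L_bound: "\<bar>L y\<bar> \<le> C0 * CN s T y" if y: "y \<in> CH s T" for y
    proof -
      have "\<bar>L y\<bar> \<le> cmod (\<kappa> * L2_inner \<nu> (y T) f)" unfolding L_def by (rule abs_Re_le_cmod)
      also have "\<dots> = cmod (L2_inner \<nu> (y T) f)" by (simp add: norm_mult \<kappa>)
      also have "\<dots> \<le> C0 * nrm s (y T)"
        using eigf_pairing[OF f l s yT(1)[OF y]] by (simp add: C0_def mult_ac)
      also have "\<dots> \<le> C0 * CN s T y"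
        using nrm_le_C_Hs_norm[OF s y] T C0 by (intro mult_left_mono) auto
      finally show ?thesis .
    qed
    define N where "N = nrm s f + nrm 1 f + 1"
    have N: "0 < N" "nrm s f < N" "nrm 1 f < N" using nrm_nonneg[OF fh(1)] nrm_nonneg[OF fh(2)] by (simp_all add: N_def)
    \<comment> \<open>The line must stay in \<open>U\<close> for the smoothness and in
      \<open>V\<close>, measured in the H^1 norm, for the identification with solutions.\<close>
    define r where "r = min rU rV / N"
    have r: "0 < r" using rU rV N by (simp add: r_def)
    have small: "\<bar>t\<bar> * nrm s f < rU" "\<bar>t\<bar> * nrm 1 f < rV" if "\<bar>t\<bar> < r" for t
    proof -
      have "\<bar>t\<bar> * N < min rU rV" using that N by (simp add: r_def pos_less_divide_eq)
      moreover have "\<bar>t\<bar> * nrm s f \<le> \<bar>t\<bar> * N" "\<bar>t\<bar> * nrm 1 f \<le> \<bar>t\<bar> * N" using N by (auto intro!: mult_left_mono)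
      ultimately show "\<bar>t\<bar> * nrm s f < rU" "\<bar>t\<bar> * nrm 1 f < rV" by auto
    qed
    have tU: "t *\<^sub>R f \<in> U" if "\<bar>t\<bar> < r" for t using small(1)[OF that] X by (intro rU(2)) auto
    have tV: "t *\<^sub>R f \<in> V" if "\<bar>t\<bar> < r" for t using small(2)[OF that] X by (intro rV(2)) auto
    define g where "g j t = L (D j (t *\<^sub>R f) (replicate j f))" for j t
    have dir: "\<And>j t. j < n \<Longrightarrow> \<bar>t\<bar> < r \<Longrightarrow> (g j has_real_derivative g (Suc j) t) (at t)" "isCont (g n) 0"
      unfolding g_def[abs_def]
      by (rule directional_derivatives[where X = "H s" and NX = "nrm s" and Y = "CH s T" and NY = "CN s T" and K = C0 and U = U,
            OF Dm[rule_format] Dd[rule_format] Dc[rule_format] r tU X(1,2) f1 nrm_nonneg[OF fh(1)]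
              C_Hs_minus[OF s] C_Hs_add[OF s] C_Hs_scaleR[OF s] L_diff L_add L_scale L_bound C0]; assumption)+
    obtain C2 e0 where e0: "0 < e0" and expn: "\<And>e u. 0 < e \<Longrightarrow> e < e0 \<Longrightarrow> H1_solution \<nu> \<phi> lam \<mu> k T (\<lambda>x. of_real e * f x) u \<Longrightarrow>
       \<bar>Re (\<kappa> * L2_inner \<nu> (u T) f) - b * e ^ n\<bar> \<le> C2 * e ^ Suc n"
      using flow_expansion[OF f \<mu> T k] unfolding \<kappa>_def b_def n_def by auto
    have g0: "\<bar>g 0 h - b * h ^ n\<bar> \<le> C2 * h ^ Suc n" if h: "0 < h" "h < min r e0" for h
    proof -
      have hr: "\<bar>h\<bar> < r" using h by simp
      obtain u where u: "H1_solution \<nu> \<phi> lam \<mu> k T (h *\<^sub>R f) u" "\<And>t. t \<in> {-T..T} \<Longrightarrow> AE x in \<nu>. \<Phi> (h *\<^sub>R f) t x = u t x"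
        using sol tV[OF hr] by blast
      have Dh: "D 0 (h *\<^sub>R f) [] = \<Phi> (h *\<^sub>R f)" using D0 tU[OF hr] by blast
      \<comment> \<open>For \<open>j = 0\<close> this is used only to place the value in the target
        space, so that \<open>\<Phi> (h *\<^sub>R f) T\<close> is square integrable and can be
        compared with \<open>u T\<close> almost everywhere.\<close>
      have "bounded_multilinear_map 0 (H s) (nrm s) (CH s T) (CN s T) (D 0 (h *\<^sub>R f))"
        using Dm tU[OF hr] by blast
      then have "D 0 (h *\<^sub>R f) [] \<in> CH s T" unfolding bounded_multilinear_map_def by simp
      then have PL: "\<Phi> (h *\<^sub>R f) T \<in> L2 \<nu>" using yT(2) Dh by simp
      have uL: "u T \<in> L2 \<nu>" using H1_solution_Hs[OF u(1), of T] T by (simp add: Hs_iff)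
      have "L2_inner \<nu> (\<Phi> (h *\<^sub>R f) T) f = L2_inner \<nu> (u T) f"
        using u(2)[of T] T by (intro L2_inner_cong_AE L2_measurable PL uL fL) auto
      then have "g 0 h = Re (\<kappa> * L2_inner \<nu> (u T) f)" by (simp add: g_def L_def Dh)
      moreover have "H1_solution \<nu> \<phi> lam \<mu> k T (\<lambda>x. of_real h * f x) u" using u(1) unfolding cf .
      ultimately show ?thesis using expn[of h u] h by simp
    qed
    have "g n 0 = fact n * b"
      by (rule top_derivative_of_expansion[where d = "min r e0" and C = C2]) (use r e0 dir g0 in \<open>auto simp: n_def\<close>)
    moreover have "g n 0 \<le> C0 * (C * nrm s f ^ n)"
    proof -
      have m: "bounded_multilinear_map n (H s) (nrm s) (CH s T) (CN s T) (D n 0)"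
        using Dm U(2) by blast
      have rep: "set (replicate n f) \<subseteq> H s" using fH by auto
      then have DY: "D n 0 (replicate n f) \<in> CH s T" using m unfolding bounded_multilinear_map_def by simp
      have "g n 0 = L (D n 0 (replicate n f))" by (simp add: g_def)
      also have "\<dots> \<le> C0 * CN s T (D n 0 (replicate n f))" using L_bound[OF DY] by linarith
      also have "\<dots> \<le> C0 * (C * nrm s f ^ n)"
        using C[of "replicate n f"] rep C0 by (intro mult_left_mono) (simp_all add: prod_list_replicate)
      finally show ?thesis .
    qed
    ultimately show ?thesis by (simp add: b_def C0_def)
  qed
  then show ?thesis unfolding n_def by blast
qed

text \<open>At depth \<open>m\<close> both \<open>A\<close> and \<open>c\<close> scale by
  \<open>(1/3) ^ m\<close>, but \<open>A\<close> enters with exponent \<open>k + 1\<close> and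
  \<open>c\<close> linearly, which leaves \<open>(1/3) ^ (m * k)\<close> against the growth
  \<open>5 powr s\<close> per level of the squared weight. The quotient \<open>\<rho>\<close> is
  below 1 exactly under the hypothesis on \<open>s\<close>.\<close>

lemma not_Ck:
  assumes s: "0 < s" "s < ln 3 / ln 5" and T: "0 < T" and k: "1 \<le> k" and \<mu>: "\<mu> = 1 \<or> \<mu> = -1"
    and U: "seminorm_open (H s) (nrm s) U" "0 \<in> U"
    and ext: "extends_H1_flow \<nu> \<phi> lam \<mu> k T U \<Phi>"
  shows "\<not> Ck_map_on (2 * k + 1) (H s) (nrm s) (CH s T) (CN s T) U \<Phi>"
proof
  assume Ck: "Ck_map_on (2 * k + 1) (H s) (nrm s) (CH s T) (CN s T) U \<Phi>"
  have s0: "0 \<le> s" using s by simp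
  obtain C where C: "\<And>l f. 0 \<le> l \<Longrightarrow> eigf l f \<Longrightarrow> nrm s f \<le> 1 \<Longrightarrow>
    fact (2 * k + 1) * (T * (LINT x|\<nu>. cmod (f x) ^ (2 * k + 2)))
      \<le> (1 + l) powr (- (s/2)) * L2_norm \<nu> f * (C * nrm s f ^ (2 * k + 1))"
    using top_derivative_bound[OF s0 T k \<mu> U ext Ck] by blast
  obtain l A c where lAc: "0 \<le> l" "0 < A" "0 < c"
    and loc: "\<And>m. \<exists>u. eigf (5 ^ m * l) u \<and> (L2_norm \<nu> u)\<^sup>2 = (1/3) ^ m * A \<and> (LINT x|\<nu>. cmod (u x) ^ (2 * k + 2)) = (1/3) ^ m * c"
    using localized_eigenfunctions[of k] by blast
  define B where "B = fact (2 * k + 1) * (T * c)"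
  have B: "0 < B" using T lAc by (simp add: B_def)
  define \<rho> where "\<rho> = 5 powr s / 3"
  have \<rho>: "0 < \<rho>" "\<rho> < 1"
  proof -
    have "s * ln 5 < ln 3" using s(2) by (simp add: pos_less_divide_eq)
    then have "exp (s * ln 5) < exp (ln (3::real))" by (simp only: exp_less_cancel_iff)
    then show "0 < \<rho>" "\<rho> < 1" by (simp_all add: \<rho>_def powr_def)
  qed
  have bound: "B \<le> \<bar>C\<bar> * A ^ (k + 1) * ((1 + l) powr s) ^ k * (\<rho> ^ k) ^ m" for m
  proof -
    define lm where "lm = 5 ^ m * l"
    have lm: "0 \<le> lm" using lAc by (simp add: lm_def)
    obtain u where u: "eigf lm u" "(L2_norm \<nu> u)\<^sup>2 = (1/3) ^ m * A" "(LINT x|\<nu>. cmod (u x) ^ (2 * k + 2)) = (1/3) ^ m * c"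
      using loc unfolding lm_def by blast
    define \<beta> where "\<beta> = L2_norm \<nu> u"
    have "\<beta>\<^sup>2 > 0" using u(2) lAc by (simp add: \<beta>_def)
    then have \<beta>: "0 < \<beta>" using L2_norm_nonneg[of \<nu> u] unfolding \<beta>_def by (metis less_eq_real_def zero_less_power2)
    define w where "w = (1 + lm) powr (s/2)"
    have w: "0 < w" using lm by (simp add: w_def)
    have wi: "(1 + lm) powr (- (s/2)) = 1 / w" using lm by (simp add: w_def powr_minus_divide)
    define N where "N = w * \<beta>"
    have N: "0 < N" using w \<beta> by (simp add: N_def)
    have nu: "nrm s u = N" using eigf_Hs(2)[OF u(1) s0] by (simp add: N_def w_def \<beta>_def)
    \<comment> \<open>The derivative bound is available on the unit ball of H^s only, so
      \<open>u\<close> is normalized; multiplying by \<open>N ^ (2 * k + 2)\<close> afterwards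
      restores the homogeneous inequality.\<close>
    define f where "f x = of_real (1 / N) * u x" for x
    have f: "eigf lm f" unfolding f_def by (rule eigf_scale[OF u(1)])
    have uh: "hsummable s u" using eigf_Hs(1)[OF u(1) s0] s0 by (simp add: Hs_iff)
    have fn: "nrm s f = 1" using nrm_scale[OF uh, of "of_real (1 / N)"] N unfolding f_def[abs_def] by (simp add: nu norm_divide)
    have fL: "L2_norm \<nu> f = \<beta> / N" unfolding f_def[abs_def] L2_norm_scale using N by (simp add: \<beta>_def norm_divide)
    have fI: "(LINT x|\<nu>. cmod (f x) ^ (2 * k + 2)) = (1/3) ^ m * c / N ^ (2 * k + 2)"
    proof -
      have "(\<lambda>x. cmod (f x) ^ (2 * k + 2)) = (\<lambda>x. (1 / N) ^ (2 * k + 2) * cmod (u x) ^ (2 * k + 2))"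
        using N by (simp add: f_def norm_mult norm_divide power_mult_distrib power_divide)
      then have "(LINT x|\<nu>. cmod (f x) ^ (2 * k + 2)) = (1 / N) ^ (2 * k + 2) * (LINT x|\<nu>. cmod (u x) ^ (2 * k + 2))"
        by (simp only: integral_mult_right_zero)
      then show ?thesis unfolding u(3) by (simp add: power_divide)
    qed
    have "fact (2 * k + 1) * (T * ((1/3) ^ m * c / N ^ (2 * k + 2))) \<le> 1 / w * (\<beta> / N) * (C * 1 ^ (2 * k + 1))"
      using C[OF lm f] fn unfolding fI fL wi fn by simp
    \<comment> \<open>\<open>C\<close> is just some constant from the boundedness of the derivative;
      its sign is unknown.\<close>
    also have "\<dots> \<le> 1 / w * (\<beta> / N) * \<bar>C\<bar>"
      using w \<beta> N by (intro mult_left_mono) auto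
    finally have "fact (2 * k + 1) * (T * ((1/3) ^ m * c / N ^ (2 * k + 2))) * N ^ (2 * k + 2) \<le> 1 / w * (\<beta> / N) * \<bar>C\<bar> * N ^ (2 * k + 2)"
      using N by (intro mult_right_mono) auto
    moreover have "fact (2 * k + 1) * (T * ((1/3) ^ m * c / N ^ (2 * k + 2))) * N ^ (2 * k + 2) = (1/3) ^ m * B"
      using N by (simp add: B_def)
    moreover have "1 / w * (\<beta> / N) * \<bar>C\<bar> * N ^ (2 * k + 2) = \<bar>C\<bar> * (w\<^sup>2) ^ k * (\<beta>\<^sup>2) ^ (k + 1)"
    proof -
      have "1 / w * (\<beta> / N) * \<bar>C\<bar> * N ^ (2 * k + 2) = \<bar>C\<bar> * (\<beta> / w) * N ^ (2 * k + 1)"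
        using N w by (simp add: field_simps)
      also have "N ^ (2 * k + 1) = w * (w\<^sup>2) ^ k * (\<beta> * (\<beta>\<^sup>2) ^ k)"
        by (simp add: N_def power_mult_distrib power_mult)
      finally show ?thesis using w by (simp add: power2_eq_square)
    qed
    ultimately have 1: "(1/3) ^ m * B \<le> \<bar>C\<bar> * (w\<^sup>2) ^ k * ((1/3) ^ m * A) ^ (k + 1)"
      using u(2) by (simp add: \<beta>_def)
    have "w\<^sup>2 = (1 + lm) powr s" unfolding w_def power2_eq_square powr_add[symmetric] by simp
    also have "\<dots> \<le> (5 ^ m * (1 + l)) powr s"
    proof (rule powr_mono2)
      \<comment> \<open>The 1 in the weight is absorbed into \<open>5 ^ m * (1 + l)\<close>, an
        estimate uniform in \<open>l \<ge> 0\<close>.\<close>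
      have "(1::real) \<le> 5 ^ m" by simp
      then show "1 + lm \<le> 5 ^ m * (1 + l)" by (simp add: lm_def distrib_left)
    qed (use s0 lm in auto)
    also have "\<dots> = (5 powr s) ^ m * (1 + l) powr s"
    proof -
      have "(5 ^ m * (1 + l)) powr s = (5 ^ m) powr s * (1 + l) powr s" using lAc by (simp add: powr_mult)
      also have "((5::real) ^ m) powr s = (5 powr s) ^ m"
        by (simp add: powr_realpow[symmetric] powr_powr mult.commute)
      finally show ?thesis .
    qed
    finally have "(w\<^sup>2) ^ k \<le> ((5 powr s) ^ m * (1 + l) powr s) ^ k" by (intro power_mono) auto
    then have "\<bar>C\<bar> * (w\<^sup>2) ^ k * ((1/3) ^ m * A) ^ (k + 1) \<le> \<bar>C\<bar> * ((5 powr s) ^ m * (1 + l) powr s) ^ k * ((1/3) ^ m * A) ^ (k + 1)"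
      using lAc by (intro mult_right_mono mult_left_mono) auto
    also have "\<dots> = (1/3) ^ m * (\<bar>C\<bar> * A ^ (k + 1) * ((1 + l) powr s) ^ k * ((5 powr s) ^ m * (1/3) ^ m) ^ k)"
      by (simp add: power_mult_distrib mult_ac)
    also have "(5 powr s) ^ m * (1/3) ^ m = \<rho> ^ m"
      by (simp add: \<rho>_def power_mult_distrib[symmetric])
    also have "(\<rho> ^ m) ^ k = (\<rho> ^ k) ^ m" by (simp only: power_mult[symmetric] mult.commute)
    finally have "(1/3) ^ m * B \<le> (1/3) ^ m * (\<bar>C\<bar> * A ^ (k + 1) * ((1 + l) powr s) ^ k * (\<rho> ^ k) ^ m)"
      using 1 by linarith
    then show ?thesis by (rule mult_left_le_imp_le) simp
  qed
  have "\<rho> ^ k < 1" using \<rho> k by (simp add: power_less_one_iff)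
  then have "(\<lambda>m. (\<rho> ^ k) ^ m) \<longlonglongrightarrow> 0" using \<rho> by (intro LIMSEQ_realpow_zero) auto
  then have "(\<lambda>m. \<bar>C\<bar> * A ^ (k + 1) * ((1 + l) powr s) ^ k * (\<rho> ^ k) ^ m) \<longlonglongrightarrow> 0"
    by (rule tendsto_mult_right_zero)
  then have "B \<le> 0" by (rule LIMSEQ_le_const) (use bound in blast)
  then show False using B by simp
qed

end

theorem theorem1:
  fixes p :: "nat \<Rightarrow> real^2" and \<nu> :: "(real^2) measure"
    and \<phi> :: "nat \<Rightarrow> real^2 \<Rightarrow> complex" and lam :: "nat \<Rightarrow> real"
    and s \<mu> :: real and k :: nat
  assumes "equilateral p" and "gasket_measure p \<nu>" and "eigenbasis p \<nu> \<phi> lam"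
    and "0 < s" and "s < ln 3 / ln 5"
    and "\<mu> = 1 \<or> \<mu> = -1" and "k \<ge> 1"
  shows "nls_ill_posed \<nu> \<phi> lam \<mu> k s (2 * k + 1) \<and>
    \<not> (\<exists>T U \<Phi>. T > 0 \<and>
         seminorm_open (Hs \<nu> \<phi> lam s) (Hs_norm \<nu> \<phi> lam s) U \<and> 0 \<in> U \<and>
         (\<forall>u0\<in>U. \<Phi> u0 \<in> C_Hs \<nu> \<phi> lam s T) \<and>
         Ck_map_on (2 * k + 1) (Hs \<nu> \<phi> lam s) (Hs_norm \<nu> \<phi> lam s)
           (C_Hs \<nu> \<phi> lam s T) (C_Hs_norm \<nu> \<phi> lam s T) U \<Phi> \<and>
         (\<exists>V\<subseteq>U. seminorm_open (Hs \<nu> \<phi> lam 1) (Hs_norm \<nu> \<phi> lam 1) V \<and> 0 \<in> V \<and>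
            (\<forall>u0\<in>V. \<exists>u. H1_solution \<nu> \<phi> lam \<mu> k T u0 u \<and>
               (\<forall>t\<in>{-T..T}. AE x in \<nu>. \<Phi> u0 t x = u t x))))"
proof -
  interpret gasket_eigenbasis p \<nu> \<phi> lam
    by unfold_locales (rule assms)+
  have ill: "nls_ill_posed \<nu> \<phi> lam \<mu> k s (2 * k + 1)"
    unfolding nls_ill_posed_def using not_Ck[OF assms(4,5) _ assms(7,6)] by blast
  show ?thesis
  proof (intro conjI ill notI, elim exE conjE)
    fix T :: real and U \<Phi> V
    assume T: "T > 0" and U: "seminorm_open (H s) (nrm s) U" "0 \<in> U"
      and Ck: "Ck_map_on (2 * k + 1) (H s) (nrm s) (CH s T) (C_Hs_norm \<nu> \<phi> lam s T) U \<Phi>"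
      and V: "V \<subseteq> U" "seminorm_open (H 1) (nrm 1) V" "0 \<in> V"
        "\<forall>u0\<in>V. \<exists>u. H1_solution \<nu> \<phi> lam \<mu> k T u0 u \<and> (\<forall>t\<in>{-T..T}. AE x in \<nu>. \<Phi> u0 t x = u t x)"
    have "extends_H1_flow \<nu> \<phi> lam \<mu> k T U \<Phi>"
      unfolding extends_H1_flow_def using V by blast
    then show False using not_Ck[OF assms(4,5) T assms(7,6) U] Ck by blast
  qed
qed

end
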